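(* Let $F: \mathbb{R}^2 \to \mathbb{R}^2$ be an excellent smooth function with critical set $C$. Let $A\subset\mathbb{R}^2$ be a closed annulus containing a single critical curve $\Gamma = A \cap C$; let $\gamma_{\mathrm{in}}$ and $\gamma_{\mathrm{out}}$ be the positively oriented simple closed components (inner and outer, respectively) of the boundary of $A$, assumed to be smooth. Let $k_{\mathrm{in}}$ and $k_{\mathrm{out}}$ be the numbers of inner and outer cusps on $\Gamma$, respectively, and let $s_{\mathrm{in}} = \operatorname{sgn}\det DF(p_{\mathrm{in}})$ for $p_{\mathrm{in}} \in \gamma_{\mathrm{in}}$ and $s_{\mathrm{out}} = -s_{\mathrm{in}} = \operatorname{sgn}\det DF(p_{\mathrm{out}})$ for $p_{\mathrm{out}} \in \gamma_{\mathrm{out}}$. Then $$ r(F(\gamma_{\mathrm{out}})) = r(F(\gamma_{\mathrm{in}})) + s_{\mathrm{in}} k_{\mathrm{in}} + s_{\mathrm{out}} k_{\mathrm{out}}. $$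
   Context: For smooth $F:\mathbb{R}^2\to\mathbb{R}^2$, the critical set $C$ is the set of points $p$ where $DF(p)$ is not invertible. A critical point $p_f$ is a fold if there are local diffeomorphisms $\Psi$ (from a neighborhood of $p_f$ to a neighborhood of $0$, $\Psi(p_f)=0$) and $\Phi$ (from a neighborhood of $0$ to a neighborhood of $F(p_f)$, $\Phi(0)=F(p_f)$) with $F=\Phi\circ\tilde F\circ\Psi$ near $p_f$, where $\tilde F(x,y)=(x,y^2)$; a critical point $p_c$ is a cusp if the same holds with $\tilde F(x,y)=(x,y^3-xy)$. $F$ is excellent if all its critical points are folds or cusps; then $C$ is a disjoint union of isolated smooth curves, its connected components, called critical curves, and cusps are isolated. Near a cusp $p_c$, the local preimage of the image of the critical arc consists of the critical arc itself together with a further (nontrivial) part, which lies on one side of the critical curve; the cusp is said to be effective on that side. (In the normal form $\tilde F(x,y)=(x,y^3-xy)$ the critical set is $x=3y^2$, the nontrivial preimage is $x=\tfrac34 y^2$, and the effective side is $x<3y^2$.) A cusp $q$ in a closed critical curve $\Gamma$ is an inner (resp. outer) cusp if it is effective on the bounded (resp. unbounded) component of $\mathbb{R}^2-\Gamma$. In the setting of the claim, $\det DF$ is nonzero with constant sign $s_{\mathrm{in}}$ on $\gamma_{\mathrm{in}}$ and nonzero with constant opposite sign $s_{\mathrm{out}}$ on $\gamma_{\mathrm{out}}$; thus $\Gamma$ is a simple closed curve in the interior of $A$ separating $\gamma_{\mathrm{in}}$ from $\gamma_{\mathrm{out}}$. Here $\operatorname{sgn}(x)=1$ for $x>0$ and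 $-1$ for $x<0$. Let $\mathbb{S}^1$ be the unit circle and $e:[0,2\pi]\to\mathbb{S}^1$, $e(t)=(\cos t,\sin t)$. A parametrized regular closed curve (prc-curve) is a $C^1$ function $c:\mathbb{S}^1\to\mathbb{R}^2$ with $(c\circ e)'(t)\neq 0$ for all $t$. Its rotation number $r(c)$ is the winding number around $0$ of the closed curve $t\mapsto (c\circ e)'(t)$, $t\in[0,2\pi]$. It does not change under orientation preserving $C^1$ reparametrizations of $\mathbb{S}^1$, so one writes $r(\gamma)$ for an oriented curve $\gamma$; $F(\gamma)$ is oriented by the parametrization $F\circ c$, where $c$ is a regular parametrization of $\gamma$ compatible with its orientation, and $r(F(\gamma))=r(F\circ c)$. Positively oriented means counterclockwise (for both boundary components). *)

theory Defs
  imports "HOL-Complex_Analysis.Complex_Analysis"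
begin

text \<open>Smoothness on an open set: all iterated directional derivatives exist and are continuous.\<close>

fun Ck_on :: "nat \<Rightarrow> 'a::real_normed_vector set \<Rightarrow> ('a \<Rightarrow> 'b::real_normed_vector) \<Rightarrow> bool" where
  "Ck_on 0 S f \<longleftrightarrow> continuous_on S f"
| "Ck_on (Suc n) S f \<longleftrightarrow>
     (\<forall>x\<in>S. f differentiable (at x)) \<and> (\<forall>v. Ck_on n S (\<lambda>x. frechet_derivative f (at x) v))"

definition smooth_on :: "'a::real_normed_vector set \<Rightarrow> ('a \<Rightarrow> 'b::real_normed_vector) \<Rightarrow> bool" where
  "smooth_on S f \<longleftrightarrow> (\<forall>n. Ck_on n S f)"

definition diffeomorphism_between ::
  "'a::real_normed_vector set \<Rightarrow> 'b::real_normed_vector set \<Rightarrow> ('a \<Rightarrow> 'b) \<Rightarrow> bool" where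
  "diffeomorphism_between U V f \<longleftrightarrow>
     open U \<and> open V \<and> smooth_on U f \<and> (\<exists>g. homeomorphism U V f g \<and> smooth_on V g)"

definition critical_set :: "(real^2 \<Rightarrow> real^2) \<Rightarrow> (real^2) set" where
  "critical_set F = {p. \<not> invertible (jacobian F (at p))}"

definition has_normal_form :: "(real^2 \<Rightarrow> real^2) \<Rightarrow> real^2 \<Rightarrow> (real^2 \<Rightarrow> real^2) \<Rightarrow> bool" where
  "has_normal_form F p N \<longleftrightarrow>
     (\<exists>U V W Z \<Psi> \<Phi>.
        diffeomorphism_between U V \<Psi> \<and> p \<in> U \<and> \<Psi> p = 0 \<and>
        diffeomorphism_between W Z \<Phi> \<and> 0 \<in> W \<and> \<Phi> 0 = F p \<and>
        N ` V \<subseteq> W \<and> (\<forall>q\<in>U. F q = \<Phi> (N (\<Psi> q))))"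

definition fold_point :: "(real^2 \<Rightarrow> real^2) \<Rightarrow> real^2 \<Rightarrow> bool" where
  "fold_point F p \<longleftrightarrow> p \<in> critical_set F \<and>
     has_normal_form F p (\<lambda>v. vector [v$1, (v$2)^2])"

definition cusp_point :: "(real^2 \<Rightarrow> real^2) \<Rightarrow> real^2 \<Rightarrow> bool" where
  "cusp_point F p \<longleftrightarrow> p \<in> critical_set F \<and>
     has_normal_form F p (\<lambda>v. vector [v$1, (v$2)^3 - v$1 * v$2])"

definition excellent :: "(real^2 \<Rightarrow> real^2) \<Rightarrow> bool" where
  "excellent F \<longleftrightarrow>
     smooth_on UNIV F \<and> (\<forall>p\<in>critical_set F. fold_point F p \<or> cusp_point F p)"

text \<open>The nontrivial local preimage at a cusp \<open>q\<close> (off the critical set, which it touches only at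
  \<open>q\<close>) lies in \<open>S\<close>. The set below increases with \<open>U\<close> and, at a cusp, is nonempty for every
  \<open>U\<close>; hence this holds for one \<open>U\<close> iff it holds for all sufficiently small ones, and \<open>q\<close>
  cannot be effective on two disjoint sets.\<close>

definition effective_on :: "(real^2 \<Rightarrow> real^2) \<Rightarrow> real^2 \<Rightarrow> (real^2) set \<Rightarrow> bool" where
  "effective_on F q S \<longleftrightarrow>
     (\<exists>U. open U \<and> q \<in> U \<and> {p \<in> U. F p \<in> F ` (critical_set F \<inter> U)} - critical_set F \<subseteq> S)"

definition inner_cusps :: "(real^2 \<Rightarrow> real^2) \<Rightarrow> (real^2) set \<Rightarrow> (real^2) set" where
  "inner_cusps F \<Gamma> = {q \<in> \<Gamma>. cusp_point F q \<and> effective_on F q (inside \<Gamma>)}"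

definition outer_cusps :: "(real^2 \<Rightarrow> real^2) \<Rightarrow> (real^2) set \<Rightarrow> (real^2) set" where
  "outer_cusps F \<Gamma> = {q \<in> \<Gamma>. cusp_point F q \<and> effective_on F q (outside \<Gamma>)}"

definition circ :: "real \<Rightarrow> real^2" where
  "circ t = vector [cos t, sin t]"

definition to_complex :: "real^2 \<Rightarrow> complex" where
  "to_complex v = Complex (v$1) (v$2)"

text \<open>Curves are functions on the unit circle \<open>sphere 0 1\<close>; values elsewhere are irrelevant. Being
  \<open>C\<^sup>1\<close> on the circle means that the periodic function \<open>c \<circ> circ\<close> is \<open>C\<^sup>1\<close> on the real line.\<close>

definition prc_curve :: "(real^2 \<Rightarrow> real^2) \<Rightarrow> bool" where
  "prc_curve c \<longleftrightarrow>
     (c \<circ> circ) C1_differentiable_on UNIV \<and> (\<forall>t. vector_derivative (c \<circ> circ) (at t) \<noteq> 0)"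

text \<open>Library winding numbers are complex-valued and refer to paths on \<open>{0..1}\<close>, hence the
  rescaling of the parameter interval \<open>{0..2*pi}\<close>.\<close>

definition rotation_number :: "(real^2 \<Rightarrow> real^2) \<Rightarrow> complex" where
  "rotation_number c =
     winding_number (\<lambda>t. to_complex (vector_derivative (c \<circ> circ) (at (2 * pi * t)))) 0"

definition regular_parametrization :: "(real^2 \<Rightarrow> real^2) \<Rightarrow> (real^2) set \<Rightarrow> bool" where
  "regular_parametrization c \<gamma> \<longleftrightarrow>
     prc_curve c \<and> inj_on c (sphere 0 1) \<and> c ` sphere 0 1 = \<gamma>"

definition smooth_simple_closed_curve :: "(real^2) set \<Rightarrow> bool" where
  "smooth_simple_closed_curve \<gamma> \<longleftrightarrow>
     (\<exists>c. regular_parametrization c \<gamma> \<and> smooth_on UNIV (c \<circ> circ))"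

definition counterclockwise :: "(real^2 \<Rightarrow> real^2) \<Rightarrow> bool" where
  "counterclockwise c \<longleftrightarrow>
     (\<forall>z \<in> inside (c ` sphere 0 1).
        winding_number (\<lambda>t. to_complex (c (circ (2 * pi * t)))) (to_complex z) = 1)"

definition closed_annulus :: "(real^2) set \<Rightarrow> bool" where
  "closed_annulus A \<longleftrightarrow> A homeomorphic {z :: real^2. 1 \<le> norm z \<and> norm z \<le> 2}"

end

theory Submission
  imports Defs
begin

text \<open>
  Extend a tangent field of \<open>\<Gamma>\<close> to a nowhere vanishing field \<open>X\<close> on the annulus that turns once along
  each boundary curve. The boundary curves also have turning number \<open>1\<close>, and \<open>DF\<close> is invertible along
  them, so \<open>F(\<gamma>)\<close> has the winding number of \<open>DF X\<close> along \<open>\<gamma>\<close> as its rotation number. Hence the two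
  rotation numbers differ by the sum of the indices of the zeros of \<open>DF X\<close> in the annulus. These zeros
  are the cusps, where the kernel of \<open>DF\<close> is tangent to \<open>\<Gamma>\<close>, and in the normal form the index of a
  cusp is seen to be the sign of \<open>det DF\<close> on its effective side.

  That the tangent turns once along a closed curve, the boundary of a contractible open set \<open>U\<close>, is shown
  without parametrizing it: if \<open>n\<close> is a normal field pointing into \<open>U\<close>, contracting \<open>U\<close> to a
  point \<open>p\<^sub>0\<close> deforms \<open>z \<mapsto> z - (z + n z)\<close> to \<open>z \<mapsto> z - p\<^sub>0\<close> through nowhere vanishing maps on the curve.
  For \<open>\<Gamma>\<close>, a component of the zero set of \<open>det DF\<close>, the gradient of \<open>det DF\<close> is such a normal
  field up to sign.
\<close>

section \<open>Winding numbers and indices on a ring\<close>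

text \<open>Nothing is known about the shape of \<open>\<Gamma>\<close> beyond the normal forms, so
  the argument works with \<open>E = s_in * jac F\<close> and its gradient \<open>G\<close>; the
  tangent field is \<open>\<i> * G\<close>. Its extension \<open>X\<close> is merely continuous, so
  the index of \<open>DF X\<close> at a cusp cannot be read off a derivative. Near the cusp
  \<open>X\<close> is therefore traded for a field \<open>Y\<close> from the normal form, parallel
  to \<open>X\<close> on \<open>\<Gamma>\<close>, for which \<open>DF Y\<close> is differentiable at
  the cusp.

  The sign arises as follows. In the coordinates of the cusp \<open>jac F = u * (3 y^2 - x)\<close>
  with \<open>u\<close> nonzero, and the nontrivial preimage lies where
  \<open>3 y^2 - x > 0\<close>. So on the effective side \<open>jac F\<close> has the sign of
  \<open>u\<close>, while the derivative of \<open>DF Y\<close> at the cusp has determinant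
  \<open>6 * u\<close>. Near \<open>\<Gamma>\<close> the inside and the outside are the regions
  where \<open>jac F\<close> has the sign \<open>s_in\<close> and \<open>s_out\<close>; an inner
  cusp thus has index \<open>s_in\<close> and an outer one \<open>s_out\<close>.\<close>

lemma winding_number_mult:
  assumes "path p" "0 \<notin> path_image p" "path q" "0 \<notin> path_image q"
  shows "winding_number (\<lambda>t. p t * q t) 0 = winding_number p 0 + winding_number q 0"
proof -
  obtain a where a: "path a" "pathfinish a - pathstart a = 2 * of_real pi * \<i> * winding_number p 0"
    "\<And>t. t \<in> {0..1} \<Longrightarrow> p t = 0 + exp (a t)"
    using winding_number_as_continuous_log [OF assms(1,2)] by blast
  obtain b where b: "path b" "pathfinish b - pathstart b = 2 * of_real pi * \<i> * winding_number q 0"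
    "\<And>t. t \<in> {0..1} \<Longrightarrow> q t = 0 + exp (b t)"
    using winding_number_as_continuous_log [OF assms(3,4)] by blast
  let ?c = "\<lambda>t. a t + b t"
  have "path ?c"
    using a(1) b(1) by (auto simp: path_def intro: continuous_intros)
  have "winding_number (\<lambda>t. p t * q t) 0 = winding_number (exp \<circ> ?c) 0"
    by (rule winding_number_cong) (simp add: a(3) b(3) exp_add)
  also have "\<dots> = (pathfinish ?c - pathstart ?c) / (2 * of_real pi * \<i>)"
    by (rule winding_number_compose_exp) fact
  also have "pathfinish ?c - pathstart ?c = (pathfinish a - pathstart a) + (pathfinish b - pathstart b)"
    by (simp add: pathfinish_def pathstart_def)
  also have "\<dots> = 2 * of_real pi * \<i> * (winding_number p 0 + winding_number q 0)"
    unfolding a(2) b(2) by (simp add: algebra_simps)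
  finally show ?thesis by simp
qed

lemma winding_number_powi:
  assumes "path p" "0 \<notin> path_image p"
  shows "winding_number (\<lambda>t. p t powi n) 0 = of_int n * winding_number p 0"
proof -
  obtain a where a: "path a" "pathfinish a - pathstart a = 2 * of_real pi * \<i> * winding_number p 0"
    "\<And>t. t \<in> {0..1} \<Longrightarrow> p t = 0 + exp (a t)"
    using winding_number_as_continuous_log [OF assms] by blast
  let ?c = "\<lambda>t. of_int n * a t"
  have "path ?c"
    using a(1) by (auto simp: path_def intro: continuous_intros)
  have "winding_number (\<lambda>t. p t powi n) 0 = winding_number (exp \<circ> ?c) 0"
    by (rule winding_number_cong) (simp add: a(3) exp_power_int)
  also have "\<dots> = (pathfinish ?c - pathstart ?c) / (2 * of_real pi * \<i>)"
    by (rule winding_number_compose_exp) fact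
  also have "pathfinish ?c - pathstart ?c = of_int n * (pathfinish a - pathstart a)"
    by (simp add: pathfinish_def pathstart_def algebra_simps)
  also have "\<dots> = 2 * of_real pi * \<i> * (of_int n * winding_number p 0)"
    unfolding a(2) by (simp add: algebra_simps)
  finally show ?thesis by simp
qed

section \<open>Continuous logarithms on simple closed curves\<close>

lemma winding_number_exp_loop:
  assumes "path p" "pathfinish p = pathstart p"
  shows "winding_number (\<lambda>t. exp (p t)) 0 = 0"
  using winding_number_compose_exp [OF assms(1)] assms(2) by (simp add: o_def)

text \<open>A continuous map from a compact space to a Hausdorff space is closed, so
  \<open>c\<close> is a quotient map onto its image and continuity of \<open>g\<close> can be tested
  after composition with \<open>c\<close>.\<close>

lemma continuous_on_image_factor:
  fixes c :: "'a::t2_space \<Rightarrow> 'b::t2_space" and g :: "'b \<Rightarrow> 'c::t2_space"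
  assumes "compact S" "continuous_on S c" "continuous_on S (\<lambda>t. g (c t))"
  shows "continuous_on (c ` S) g"
proof (subst continuous_on_closed_vimage)
  show "closed (c ` S)"
    using assms compact_continuous_image compact_imp_closed by blast
  show "\<forall>B. closed B \<longrightarrow> closed (g -` B \<inter> c ` S)"
  proof (intro allI impI)
    fix B :: "'c set" assume "closed B"
    then have "closed ((\<lambda>t. g (c t)) -` B \<inter> S)"
      using assms compact_imp_closed continuous_on_closed_vimage by blast
    then have "compact (((\<lambda>t. g (c t)) -` B \<inter> S) \<inter> S)"
      using assms(1) by (rule closed_Int_compact)
    then have "compact ((\<lambda>t. g (c t)) -` B \<inter> S)"
      by (simp add: Int_assoc)
    then have "compact (c ` ((\<lambda>t. g (c t)) -` B \<inter> S))"
      by (intro compact_continuous_image continuous_on_subset [OF assms(2)]) auto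
    moreover have "c ` ((\<lambda>t. g (c t)) -` B \<inter> S) = g -` B \<inter> c ` S"
      by auto
    ultimately show "closed (g -` B \<inter> c ` S)"
      by (simp add: compact_imp_closed)
  qed
qed

text \<open>Winding number zero makes the lifted logarithm agree at both ends of the parameter
  interval. A simple loop identifies no other parameters, so the lift descends to the curve.\<close>

lemma continuous_log_on_simple_loop:
  fixes f :: "complex \<Rightarrow> complex"
  assumes c: "simple_path c" "pathfinish c = pathstart c"
    and f: "continuous_on (path_image c) f" "\<And>z. z \<in> path_image c \<Longrightarrow> f z \<noteq> 0"
    and w: "winding_number (f \<circ> c) 0 = 0"
  obtains g where "continuous_on (path_image c) g" "\<And>z. z \<in> path_image c \<Longrightarrow> f z = exp (g z)"
proof -
  have "path c" using c simple_path_imp_path by blast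
  have pfc: "path (f \<circ> c)" "0 \<notin> path_image (f \<circ> c)"
    using \<open>path c\<close> f by (auto simp: path_continuous_image path_image_compose)
  obtain a where a: "path a" "pathfinish a - pathstart a = 2 * of_real pi * \<i> * winding_number (f \<circ> c) 0"
    "\<And>t. t \<in> {0..1} \<Longrightarrow> (f \<circ> c) t = 0 + exp (a t)"
    using winding_number_as_continuous_log [OF pfc] by blast
  have a01: "a 1 = a 0"
    using a(2) w by (simp add: pathfinish_def pathstart_def)
  have inj: "a s = a t" if "s \<in> {0..1}" "t \<in> {0..1}" "c s = c t" for s t
    using c(1) that a01 unfolding simple_path_def loop_free_def by (metis atLeastAtMost_iff)
  define g where "g z = a (SOME t. t \<in> {0..1} \<and> c t = z)" for z
  have g: "g (c t) = a t" if "t \<in> {0..1}" for t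
  proof -
    have "(SOME s. s \<in> {0..1} \<and> c s = c t) \<in> {0..1} \<and> c (SOME s. s \<in> {0..1} \<and> c s = c t) = c t"
      by (rule someI [of _ t]) (use that in blast)
    then show ?thesis
      unfolding g_def using inj that by blast
  qed
  show ?thesis
  proof
    have "continuous_on {0..1} (\<lambda>t. g (c t))"
      using a(1) unfolding path_def by (rule continuous_on_eq) (simp add: g)
    then show "continuous_on (path_image c) g"
      unfolding path_image_def using \<open>path c\<close>
      by (intro continuous_on_image_factor) (auto simp: path_def)
    show "f z = exp (g z)" if "z \<in> path_image c" for z
      using that a(3) g by (auto simp: path_image_def)
  qed
qed

text \<open>Tietze is applied to the logarithm: an extension of \<open>f\<close> itself might
  vanish, an exponential cannot.\<close>

lemma nonvanishing_extension:
  fixes f :: "complex \<Rightarrow> complex"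
  assumes "simple_path c" "pathfinish c = pathstart c"
    and "continuous_on (path_image c) f" "\<And>z. z \<in> path_image c \<Longrightarrow> f z \<noteq> 0"
    and "winding_number (f \<circ> c) 0 = 0"
  obtains h where "continuous_on UNIV h" "\<And>z. h z \<noteq> 0" "\<And>z. z \<in> path_image c \<Longrightarrow> h z = f z"
proof -
  obtain g where g: "continuous_on (path_image c) g" "\<And>z. z \<in> path_image c \<Longrightarrow> f z = exp (g z)"
    using continuous_log_on_simple_loop assms by blast
  have "closedin (top_of_set UNIV) (path_image c)"
    by (simp add: assms(1) closed_simple_path_image)
  then obtain g' where g': "continuous_on UNIV g'" "\<And>z. z \<in> path_image c \<Longrightarrow> g' z = g z"
    using Tietze_unbounded g(1) by blast
  show ?thesis
    by (rule that [of "\<lambda>z. exp (g' z)"]) (auto intro!: continuous_intros g' simp: g g')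
qed

text \<open>Plugs a hole of \<open>K\<close> without creating zeros. It serves both for the hole of
  a ring and for small discs cut out around zeros.\<close>

lemma refill_inside:
  fixes f :: "complex \<Rightarrow> complex"
  assumes c: "simple_path c" "pathfinish c = pathstart c"
    and f: "continuous_on K f" "closed K" "path_image c \<subseteq> K" "K \<inter> inside (path_image c) = {}"
      "\<And>z. z \<in> path_image c \<Longrightarrow> f z \<noteq> 0"
    and w: "winding_number (f \<circ> c) 0 = 0"
  obtains h where "continuous_on (K \<union> inside (path_image c)) h"
    "\<And>z. z \<in> K \<Longrightarrow> h z = f z" "\<And>z. z \<in> inside (path_image c) \<Longrightarrow> h z \<noteq> 0"
proof -
  obtain h where h: "continuous_on UNIV h" "\<And>z. h z \<noteq> 0" "\<And>z. z \<in> path_image c \<Longrightarrow> h z = f z"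
    using nonvanishing_extension [OF c _ f(5) w] f continuous_on_subset by blast
  let ?S = "path_image c \<union> inside (path_image c)"
  have "closed ?S"
    by (metis c(1) closed_path_image closed_path_image_Un_inside simple_path_imp_path)
  have "continuous_on (?S \<union> K) (\<lambda>z. if z \<in> K then f z else h z)"
  proof -
    have eq: "?S \<union> K = K \<union> ?S" by auto
    show ?thesis unfolding eq
      by (rule continuous_on_cases [OF f(2) \<open>closed ?S\<close> f(1)])
        (use h f(4) in \<open>auto intro: continuous_on_subset\<close>)
  qed
  moreover have "?S \<union> K = K \<union> inside (path_image c)"
    using f(3) by auto
  ultimately show ?thesis
    using that [of "\<lambda>z. if z \<in> K then f z else h z"] f(4) h(2) by (force simp: disjoint_iff)
qed

text \<open>The complement of the filled curve is the outside, which is connected. A compact set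
  with connected complement is Borsukian, so \<open>f\<close> has a continuous logarithm on the
  filled curve.\<close>

lemma winding_number_disc_zero:
  fixes f :: "complex \<Rightarrow> complex"
  assumes c: "simple_path c" "pathfinish c = pathstart c"
    and f: "continuous_on (path_image c \<union> inside (path_image c)) f"
      "\<And>z. z \<in> path_image c \<union> inside (path_image c) \<Longrightarrow> f z \<noteq> 0"
  shows "winding_number (f \<circ> c) 0 = 0"
proof -
  let ?S = "path_image c \<union> inside (path_image c)"
  have "compact ?S"
    using Jordan_inside_outside [OF c] c
    by (metis bounded_Un bounded_simple_path_image closed_path_image closed_path_image_Un_inside compact_eq_bounded_closed simple_path_imp_path)
  moreover have "- ?S = outside (path_image c)"
    by (simp add: union_with_inside)
  moreover have "connected (outside (path_image c))"
    using Jordan_inside_outside [OF c] by blast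
  ultimately have "Borsukian ?S"
    by (simp add: Borsukian_separation_compact)
  moreover have "f \<in> ?S \<rightarrow> - {0}"
    using f(2) by auto
  ultimately obtain g where g: "continuous_on ?S g" "\<And>z. z \<in> ?S \<Longrightarrow> f z = exp (g z)"
    using f(1) unfolding Borsukian_continuous_logarithm by blast
  have "path (g \<circ> c)"
    using c g(1) by (metis continuous_on_subset path_continuous_image simple_path_imp_path sup_ge1)
  moreover have "winding_number (f \<circ> c) 0 = winding_number (\<lambda>t. exp ((g \<circ> c) t)) 0"
    by (rule winding_number_cong) (use g(2) in \<open>auto simp: path_image_def\<close>)
  ultimately show ?thesis
    using c(2) winding_number_exp_loop [of "g \<circ> c"] by (simp add: pathfinish_def pathstart_def)
qed

section \<open>Rings between nested simple closed curves\<close>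

lemma simple_loop_inside_outside:
  fixes c1 c2 :: "real \<Rightarrow> complex"
  assumes "simple_path c1" "pathfinish c1 = pathstart c1" "simple_path c2" "pathfinish c2 = pathstart c2"
    and "path_image c1 \<subseteq> inside (path_image c2)"
  shows "inside (path_image c1) \<subseteq> inside (path_image c2)"
    and "outside (path_image c2) \<union> path_image c2 \<subseteq> outside (path_image c1)"
proof -
  note J1 = Jordan_inside_outside [OF assms(1,2)]
  note J2 = Jordan_inside_outside [OF assms(3,4)]
  let ?O = "outside (path_image c2) \<union> path_image c2"
  have "?O = closure (outside (path_image c2))"
    using J2 by (metis closure_Un_frontier)
  then have con: "connected ?O"
    using J2 connected_imp_connected_closure by metis
  have "\<not> bounded ?O"
    using J2 by auto
  have "?O \<inter> path_image c1 = {}"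
    using assms(5) J2 inside_no_overlap by blast
  show *: "?O \<subseteq> outside (path_image c1)"
  proof
    fix x assume x: "x \<in> ?O"
    have "?O \<subseteq> connected_component_set (- path_image c1) x"
      by (rule connected_component_maximal [OF x con]) (use \<open>?O \<inter> path_image c1 = {}\<close> in blast)
    then show "x \<in> outside (path_image c1)"
      using \<open>\<not> bounded ?O\<close> bounded_subset unfolding outside by blast
  qed
  show "inside (path_image c1) \<subseteq> inside (path_image c2)"
    using * inside_Int_outside [of "path_image c1"] inside_Un_outside [of "path_image c2"] by blast
qed

lemma path_compose_nonzero:
  assumes "path c" "path_image c \<subseteq> K" "continuous_on K f" "\<And>z. z \<in> path_image c \<Longrightarrow> f z \<noteq> (0::complex)"
  shows "path (f \<circ> c)" "0 \<notin> path_image (f \<circ> c)"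
proof -
  show "path (f \<circ> c)"
    by (rule path_continuous_image [OF assms(1) continuous_on_subset [OF assms(3,2)]])
  show "0 \<notin> path_image (f \<circ> c)"
    using assms(4) by (auto simp: path_image_compose)
qed

text \<open>Such a factor brings the winding number along a chosen loop to zero, which is what
  filling in a disc requires.\<close>

lemma winding_number_mult_powi:
  fixes f :: "complex \<Rightarrow> complex"
  assumes "path c" "path_image c \<subseteq> K" "continuous_on K f"
    and "\<And>z. z \<in> path_image c \<Longrightarrow> f z \<noteq> 0" "q \<notin> path_image c"
  shows "winding_number ((\<lambda>z. f z * (z - q) powi (- n)) \<circ> c) 0 =
    winding_number (f \<circ> c) 0 - of_int n * winding_number c q"
proof -
  have sh: "path (\<lambda>t. c t - q)" "0 \<notin> path_image (\<lambda>t. c t - q)"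
    using assms(1,5) by (auto simp: path_def path_image_def intro!: continuous_intros)
  have "path (\<lambda>t. (c t - q) powi (- n))" "0 \<notin> path_image (\<lambda>t. (c t - q) powi (- n))"
    using sh unfolding path_def path_image_def by (auto intro!: continuous_intros)
  then have "winding_number (\<lambda>t. (f \<circ> c) t * (c t - q) powi (- n)) 0 =
      winding_number (f \<circ> c) 0 + winding_number (\<lambda>t. (c t - q) powi (- n)) 0"
    by (intro winding_number_mult path_compose_nonzero [OF assms(1-4)]) auto
  also have "winding_number (\<lambda>t. (c t - q) powi (- n)) 0 = of_int (- n) * winding_number c q"
    using winding_number_powi [OF sh] winding_number_offset [of c q] by simp
  finally show ?thesis by (simp add: o_def)
qed

text \<open>With \<open>p0\<close> in the hole and \<open>n\<close> the winding number along the
  inner loop, \<open>f z * (z - p0) powi (- n)\<close> extends over the hole without zeros, so its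
  winding number along the outer loop is zero too. Both loops wind once around \<open>p0\<close>,
  hence the factor has removed the same \<open>n\<close> from each.\<close>

lemma winding_number_nonvanishing_ring:
  fixes f :: "complex \<Rightarrow> complex"
  assumes c1: "simple_path c1" "pathfinish c1 = pathstart c1"
    and c2: "simple_path c2" "pathfinish c2 = pathstart c2"
    and sub: "path_image c1 \<subseteq> inside (path_image c2)"
    and ccw1: "\<And>z. z \<in> inside (path_image c1) \<Longrightarrow> winding_number c1 z = 1"
    and ccw2: "\<And>z. z \<in> inside (path_image c2) \<Longrightarrow> winding_number c2 z = 1"
    and f: "continuous_on K f" "\<And>z. z \<in> K \<Longrightarrow> f z \<noteq> 0"
    and K: "K = path_image c2 \<union> inside (path_image c2) - inside (path_image c1)"
  shows "winding_number (f \<circ> c2) 0 = winding_number (f \<circ> c1) 0"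
proof -
  note J1 = Jordan_inside_outside [OF c1]
  note J2 = Jordan_inside_outside [OF c2]
  note io = simple_loop_inside_outside [OF c1 c2 sub]
  have p: "path c1" "path c2" using c1 c2 simple_path_imp_path by auto
  have cK: "path_image c1 \<subseteq> K" "path_image c2 \<subseteq> K"
    using sub io(2) inside_Int_outside [of "path_image c1"] inside_no_overlap [of "path_image c1"]
    unfolding K by blast+
  have "closed K" unfolding K
    by (intro closed_Diff closed_path_image_Un_inside p) (use J1 in blast)
  obtain p0 where p0: "p0 \<in> inside (path_image c1)" using J1 by blast
  then have p0K: "p0 \<notin> K" unfolding K by auto
  have pf1: "path (f \<circ> c1)" "0 \<notin> path_image (f \<circ> c1)"
    using path_compose_nonzero [OF p(1) cK(1) f(1)] f(2) cK(1) by blast+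
  obtain n where n: "winding_number (f \<circ> c1) 0 = of_int n"
    using integer_winding_number [OF pf1(1) _ pf1(2)] c1(2)
    by (auto simp: pathfinish_def pathstart_def elim: Ints_cases)
  define g where "g z = f z * (z - p0) powi (- n)" for z
  have g: "continuous_on K g" "\<And>z. z \<in> K \<Longrightarrow> g z \<noteq> 0"
    unfolding g_def using f p0K by (auto intro!: continuous_intros)
  have wg: "winding_number (g \<circ> c) 0 = winding_number (f \<circ> c) 0 - of_int n * winding_number c p0"
    if "path c" "path_image c \<subseteq> K" for c
    unfolding g_def using that f(2) p0K
    by (subst winding_number_mult_powi [OF that f(1)]) auto
  have "winding_number (g \<circ> c1) 0 = 0"
    using wg [OF p(1) cK(1)] n ccw1 [OF p0] by simp
  moreover have "K \<inter> inside (path_image c1) = {}"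
    unfolding K by blast
  moreover have "\<And>z. z \<in> path_image c1 \<Longrightarrow> g z \<noteq> 0"
    using cK(1) g(2) by blast
  ultimately obtain h where h: "continuous_on (K \<union> inside (path_image c1)) h"
    "\<And>z. z \<in> K \<Longrightarrow> h z = g z" "\<And>z. z \<in> inside (path_image c1) \<Longrightarrow> h z \<noteq> 0"
    using refill_inside [OF c1 g(1) \<open>closed K\<close> cK(1)] by blast
  have KI: "K \<union> inside (path_image c1) = path_image c2 \<union> inside (path_image c2)"
    unfolding K using io by blast
  have h0: "h z \<noteq> 0" if "z \<in> K \<union> inside (path_image c1)" for z
    using that h(2,3) g(2) by (metis UnE)
  have "winding_number (h \<circ> c2) 0 = 0"
    by (rule winding_number_disc_zero [OF c2 h(1) [unfolded KI] h0 [unfolded KI]])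
  moreover have "winding_number (h \<circ> c2) 0 = winding_number (g \<circ> c2) 0"
    by (rule winding_number_cong) (use h(2) cK in \<open>auto simp: path_image_def image_subset_iff\<close>)
  moreover have "winding_number c2 p0 = 1"
    using ccw2 p0 io by blast
  ultimately show ?thesis
    using wg [OF p(2) cK(2)] n by simp
qed

lemma finite_avoid_cball:
  fixes q :: "'a::metric_space"
  assumes "open M" "q \<in> M" "finite Z" "q \<notin> Z"
  shows "eventually (\<lambda>r. cball q r \<subseteq> M - Z) (at_right (0::real))"
proof -
  have "open (M - Z)"
    using assms finite_imp_closed by (intro open_Diff)
  then obtain e where "e > 0" "cball q e \<subseteq> M - Z"
    using assms open_contains_cball by (metis DiffI)
  then show ?thesis
    unfolding eventually_at_right_field by (meson less_imp_le order_trans subset_cball)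
qed

text \<open>Induction on the zeros, with \<open>f\<close> varying: the factor
  \<open>(z - q) powi (- n q)\<close> cancels the index at \<open>q\<close>, and the product is
  refilled without zeros in a small disc. The factor contributes \<open>- n q\<close> along
  \<open>c2\<close>, which surrounds \<open>q\<close>, and nothing along \<open>c1\<close>.\<close>

lemma winding_number_ring_index:
  fixes f :: "complex \<Rightarrow> complex" and n :: "complex \<Rightarrow> int"
  assumes c1: "simple_path c1" "pathfinish c1 = pathstart c1"
    and c2: "simple_path c2" "pathfinish c2 = pathstart c2"
    and sub: "path_image c1 \<subseteq> inside (path_image c2)"
    and ccw1: "\<And>z. z \<in> inside (path_image c1) \<Longrightarrow> winding_number c1 z = 1"
    and ccw2: "\<And>z. z \<in> inside (path_image c2) \<Longrightarrow> winding_number c2 z = 1"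
    and K: "K = path_image c2 \<union> inside (path_image c2) - inside (path_image c1)"
    and "finite Z" "Z \<subseteq> inside (path_image c2) \<inter> outside (path_image c1)"
    and "continuous_on K f" "\<And>z. z \<in> K - Z \<Longrightarrow> f z \<noteq> 0"
    and "\<And>z. z \<in> Z \<Longrightarrow> eventually (\<lambda>r. winding_number (f \<circ> circlepath z r) 0 = of_int (n z)) (at_right 0)"
  shows "winding_number (f \<circ> c2) 0 = winding_number (f \<circ> c1) 0 + (\<Sum>z\<in>Z. of_int (n z))"
  using assms(9-)
proof (induction Z arbitrary: f rule: finite_induct)
  case empty
  then show ?case
    using winding_number_nonvanishing_ring [OF c1 c2 sub ccw1 ccw2 empty(2) _ K] by (simp add: o_def)
next
  case (insert q Z)
  let ?M = "inside (path_image c2) \<inter> outside (path_image c1)"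
  have p: "path c1" "path c2" using c1 c2 simple_path_imp_path by auto
  note io = simple_loop_inside_outside [OF c1 c2 sub]
  have oM: "open ?M"
    using Jordan_inside_outside [OF c1] Jordan_inside_outside [OF c2] by (intro open_Int) auto
  have MK: "?M \<subseteq> K"
    using inside_Int_outside [of "path_image c1"] unfolding K by blast
  have "closed K" unfolding K
    by (intro closed_Diff closed_path_image_Un_inside p) (use Jordan_inside_outside [OF c1] in blast)
  have cK: "path_image c1 \<subseteq> K" "path_image c2 \<subseteq> K"
    using sub io(2) inside_Int_outside [of "path_image c1"] inside_no_overlap [of "path_image c1"]
    unfolding K by blast+
  have cM: "path_image c1 \<inter> ?M = {}" "path_image c2 \<inter> ?M = {}"
    using inside_no_overlap [of "path_image c2"] outside_no_overlap [of "path_image c1"] by blast+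
  have qM: "q \<in> ?M" "Z \<subseteq> ?M" using insert.prems(1) by auto
  have "eventually (\<lambda>r. cball q r \<subseteq> ?M - Z \<and> winding_number (f \<circ> circlepath q r) 0 = of_int (n q) \<and> r > 0) (at_right 0)"
    by (intro eventually_conj finite_avoid_cball oM insert.hyps qM insert.prems(4) insertI1 eventually_at_right_less)
  then obtain r where r: "cball q r \<subseteq> ?M - Z" "winding_number (f \<circ> circlepath q r) 0 = of_int (n q)" "r > 0"
    using eventually_happens by fastforce
  define c where "c = circlepath q r"
  have c: "simple_path c" "pathfinish c = pathstart c" "path_image c = sphere q r"
      "inside (path_image c) = ball q r" "path c"
  proof -
    show "simple_path c" "pathfinish c = pathstart c" and im: "path_image c = sphere q r" and "path c"
      using r(3) unfolding c_def by (simp_all add: simple_path_circlepath)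
    show "inside (path_image c) = ball q r"
      using inside_frontier_eq_interior [of "cball q r"] by (simp add: im)
  qed
  let ?K = "K - ball q r"
  have sK: "sphere q r \<subseteq> ?K" "sphere q r \<subseteq> K - insert q Z"
    using r MK qM by auto
  \<comment> \<open>Only the values of \<open>g\<close> off \<open>ball q r\<close> enter below; at
    \<open>q\<close> the factor may blow up.\<close>
  define g where "g z = f z * (z - q) powi (- n q)" for z
  have g: "continuous_on (K - {q}) g"
    unfolding g_def
    by (intro continuous_intros continuous_on_subset [OF insert.prems(2)]) auto
  have g0: "\<And>z. z \<in> K - insert q Z \<Longrightarrow> g z \<noteq> 0"
    unfolding g_def using insert.prems(3) by auto
  have wg: "winding_number (g \<circ> c') 0 = winding_number (f \<circ> c') 0 - of_int (n q) * winding_number c' q"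
    if "path c'" "path_image c' \<subseteq> K - insert q Z" for c'
    unfolding g_def using that insert.prems(3)
    by (subst winding_number_mult_powi [OF that(1) _ insert.prems(2)]) auto
  have "continuous_on ?K g"
    using g by (rule continuous_on_subset) (use r(3) in auto)
  moreover have "closed ?K" using \<open>closed K\<close> by auto
  moreover have "winding_number (g \<circ> c) 0 = 0"
    using wg [of c] c sK r(2,3) by (simp add: c_def winding_number_circlepath_centre)
  moreover have "path_image c \<subseteq> ?K" "?K \<inter> inside (path_image c) = {}"
      "\<And>z. z \<in> path_image c \<Longrightarrow> g z \<noteq> 0"
    using sK g0 unfolding c(3) c(4) [unfolded c(3)] by blast+
  ultimately obtain h where "continuous_on (?K \<union> inside (path_image c)) h"
      "\<And>z. z \<in> ?K \<Longrightarrow> h z = g z" "\<And>z. z \<in> inside (path_image c) \<Longrightarrow> h z \<noteq> 0"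
    using refill_inside [OF c(1,2)] by blast
  then have h: "continuous_on (?K \<union> ball q r) h"
      "\<And>z. z \<in> ?K \<Longrightarrow> h z = g z" "\<And>z. z \<in> ball q r \<Longrightarrow> h z \<noteq> 0"
    unfolding c(4) by blast+
  have Kb: "?K \<union> ball q r = K" using r(1) MK ball_subset_cball [of q r] by blast
  have avoid: "path_image c1 \<subseteq> K - insert q Z" "path_image c2 \<subseteq> K - insert q Z"
    using cK cM qM by blast+
  have hc: "winding_number (h \<circ> c') 0 = winding_number (g \<circ> c') 0" if "path_image c' \<subseteq> K - ball q r" for c'
    by (rule winding_number_cong) (use h(2) that in \<open>simp add: path_image_def image_subset_iff\<close>)
  have "ball q r \<subseteq> ?M" using r(1) ball_subset_cball [of q r] by blast
  have IH: "winding_number (h \<circ> c2) 0 = winding_number (h \<circ> c1) 0 + (\<Sum>z\<in>Z. of_int (n z))"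
  proof (rule insert.IH)
    show "Z \<subseteq> ?M" by (rule qM)
    show "continuous_on K h" using h(1) Kb by simp
    show "h z \<noteq> 0" if "z \<in> K - Z" for z
    proof (cases "z \<in> ball q r")
      case False
      then have "z \<noteq> q" using r(3) by auto
      then show ?thesis using h(2) g0 False that by auto
    qed (use h(3) in auto)
    show "eventually (\<lambda>r. winding_number (h \<circ> circlepath z r) 0 = of_int (n z)) (at_right 0)" if "z \<in> Z" for z
    proof -
      have z: "z \<notin> cball q r" using r(1) that by auto
      \<comment> \<open>Circles this small around \<open>z\<close> miss \<open>cball q r\<close>, so
        \<open>h = g\<close> on them, and they do not surround \<open>q\<close>, so the factor
        leaves the index at \<open>z\<close> unchanged.\<close>
      have "eventually (\<lambda>s. cball z s \<subseteq> (?M - cball q r) - (insert q Z - {z})) (at_right 0)"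
        by (rule finite_avoid_cball) (use oM z qM that insert.hyps in auto)
      moreover have "eventually (\<lambda>s. winding_number (f \<circ> circlepath z s) 0 = of_int (n z)) (at_right 0)"
        using insert.prems(4) that by blast
      moreover have "eventually (\<lambda>s. s > 0) (at_right (0::real))"
        by (rule eventually_at_right_less)
      ultimately show ?thesis
      proof eventually_elim
        case (elim s)
        have sub: "path_image (circlepath z s) \<subseteq> K - insert q Z" "path_image (circlepath z s) \<subseteq> K - ball q r"
          using elim(1,3) MK by auto
        have "q \<notin> cball z s" using elim(1) insert.hyps that by auto
        then have "winding_number (circlepath z s) q = 0"
          using elim(3) by (intro winding_number_zero_outside [of _ "cball z s"]) auto
        then show ?case
          using elim(2) hc [OF sub(2)] wg [OF _ sub(1)] by simp
      qed
    qed
  qed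
  have "winding_number c2 q = 1" "winding_number c1 q = 0"
    using qM ccw2 winding_number_zero_in_outside [OF p(1) c1(2)] by auto
  moreover have "path_image c1 \<subseteq> K - ball q r" "path_image c2 \<subseteq> K - ball q r"
    using cK cM \<open>ball q r \<subseteq> ?M\<close> by blast+
  ultimately have "winding_number (f \<circ> c2) 0 - of_int (n q) = winding_number (f \<circ> c1) 0 + (\<Sum>z\<in>Z. of_int (n z))"
    using IH hc wg [OF p(1) avoid(1)] wg [OF p(2) avoid(2)] by simp
  then show ?case
    using insert.hyps by (simp add: algebra_simps o_def)
qed

section \<open>The turning number of a simple loop\<close>

lemma winding_number_const_mult:
  assumes "path p" "0 \<notin> path_image p" "a \<noteq> 0"
  shows "winding_number (\<lambda>t. a * p t) 0 = winding_number p 0"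
  using winding_number_mult [of "\<lambda>t. a" p] assms
  by (simp add: winding_number_zero_const path_def path_image_def image_constant_conv)

section \<open>Regular closed curves and their normals\<close>

lemma MVT_nonzero:
  fixes f f' :: "real \<Rightarrow> real"
  assumes "\<And>x. x \<in> closed_segment a b \<Longrightarrow> (f has_real_derivative f' x) (at x)"
    and "\<And>x. x \<in> closed_segment a b \<Longrightarrow> f' x > 0" "a \<noteq> b"
  shows "f a \<noteq> f b"
proof -
  have "f u < f v" if "u < v" "{u..v} \<subseteq> closed_segment a b" for u v
    using that assms(1,2) by (intro DERIV_pos_imp_increasing [OF that(1)]) (meson atLeastAtMost_iff subsetD)
  then show ?thesis
    using assms(3) by (metis closed_segment_commute closed_segment_eq_real_ivl linorder_neqE_linordered_idom order_less_imp_le order_less_irrefl subset_refl)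
qed

text \<open>Loops live on the whole line with period 1. Derivatives at the endpoints are then
  two-sided, and a parameter can be moved by an integer to lie close to a given one.\<close>

locale regular_loop =
  fixes p p' :: "real \<Rightarrow> complex"
  assumes periodic: "p (t + 1) = p t"
    and deriv: "(p has_vector_derivative p' t) (at t)"
    and cont_deriv: "continuous_on UNIV p'"
    and regular: "p' t \<noteq> 0"
    and inj: "p s = p t \<Longrightarrow> t - s \<in> \<int>"
begin

lemma periodic_int: "p (t + of_int k) = p t"
proof (induction k rule: int_induct [where k = 0])
  case (step1 i) then show ?case using periodic [of "t + of_int i"] by (simp add: ac_simps)
next
  case (step2 i) then show ?case using periodic [of "t + of_int (i - 1)"] by (simp add: ac_simps)
qed simp

lemma deriv_periodic: "p' (t + 1) = p' t"
proof -
  have "((\<lambda>x. x + 1) has_vector_derivative 1) (at t)"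
    by (auto intro!: derivative_eq_intros)
  from vector_diff_chain_at [OF this deriv] have "((\<lambda>x. p (x + 1)) has_vector_derivative p' (t + 1)) (at t)"
    by (simp add: o_def)
  then show ?thesis
    using vector_derivative_unique_at [OF deriv [of t]] by (simp add: periodic)
qed

lemma cont: "continuous_on S p"
  by (intro continuous_at_imp_continuous_on ballI has_vector_derivative_continuous [OF deriv])

lemma simple: "simple_path p" "pathfinish p = pathstart p" "path p"
proof -
  show "pathfinish p = pathstart p"
    using periodic [of 0] by (simp add: pathfinish_def pathstart_def)
  show "path p" by (simp add: path_def cont)
  have "s = t \<or> s = 0 \<and> t = 1 \<or> s = 1 \<and> t = 0" if st: "s \<in> {0..1}" "t \<in> {0..1}" "p s = p t" for s t
  proof -
    obtain k :: int where "t - s = of_int k" using inj [OF st(3)] by (auto elim: Ints_cases)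
    moreover have "k = -1 \<or> k = 0 \<or> k = 1"
      using st calculation by auto
    ultimately show ?thesis using st by auto
  qed
  then show "simple_path p"
    unfolding simple_path_def loop_free_def using \<open>path p\<close> by blast
qed

lemma path_image_eq: "path_image p = range p"
proof -
  have "p t \<in> p ` {0..1}" for t
    using periodic_int [of "frac t" "\<lfloor>t\<rfloor>"] frac_ge_0 [of t] frac_lt_1 [of t]
    by (metis atLeastAtMost_iff frac_def diff_add_cancel imageI less_imp_le)
  then show ?thesis by (auto simp: path_image_def)
qed

text \<open>Suppose that a short normal segment at \<open>p t\<close> ends at a curve point
  \<open>p u\<close>. If \<open>u\<close> is close to \<open>t\<close>, the coordinate of
  \<open>p\<close> along \<open>p' t\<close> is strictly monotone between them, whereas a normal
  displacement leaves it fixed. Otherwise \<open>p u\<close> and \<open>p t\<close> are at least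
  \<open>m\<close> apart, too far for the segment.\<close>

lemma normal_segments_avoid:
  obtains \<delta> where "\<delta> > 0"
    "\<And>t s. t \<in> {0..1} \<Longrightarrow> 0 < \<bar>s\<bar> \<Longrightarrow> \<bar>s\<bar> \<le> \<delta> \<Longrightarrow> p t + of_real s * \<i> * p' t \<notin> path_image p"
proof -
  let ?A = "(\<lambda>t. (t, t)) ` {0..1::real}"
  let ?O = "{x. inner (p' (snd x)) (p' (fst x)) > 0}"
  have "compact ?A" by (intro compact_continuous_image continuous_intros) auto
  moreover have "open ?O"
    by (intro open_Collect_less continuous_intros continuous_on_compose2 [OF cont_deriv]) auto
  moreover have "?A \<subseteq> ?O" using regular by auto
  ultimately obtain \<eta>0 where \<eta>0: "\<eta>0 > 0" "(\<Union>x\<in>?A. ball x \<eta>0) \<subseteq> ?O"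
    by (rule compact_subset_open_imp_ball_epsilon_subset)
  \<comment> \<open>The cap 1/2 keeps \<open>(0, 1/2)\<close> in the compact set \<open>?B\<close>
    of far parameter pairs.\<close>
  define \<eta> where "\<eta> = min \<eta>0 (1/2)"
  have \<eta>: "\<eta> > 0" "\<eta> \<le> 1/2" using \<eta>0 by (auto simp: \<eta>_def)
  have near: "inner (p' u) (p' t) > 0" if "t \<in> {0..1}" "\<bar>u - t\<bar> < \<eta>" for t u
  proof -
    have "(t, u) \<in> ball (t, t) \<eta>0"
      using that by (simp add: \<eta>_def dist_Pair_Pair dist_real_def abs_minus_commute)
    then show ?thesis using \<eta>0(2) that(1) by fastforce
  qed
  \<comment> \<open>The range \<open>{-1..2}\<close> contains every \<open>u\<close> within 1/2 of
    some \<open>t\<close> in \<open>{0..1}\<close>.\<close>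
  let ?B = "({0..1} \<times> {-1..2::real}) \<inter> {x. \<eta> \<le> \<bar>snd x - fst x\<bar> \<and> \<bar>snd x - fst x\<bar> \<le> 1/2}"
  have "compact ?B"
    by (intro compact_Int_closed compact_Times closed_Collect_conj closed_Collect_le continuous_intros) auto
  moreover have "?B \<noteq> {}"
  proof -
    have "(0, 1/2) \<in> ?B" using \<eta> by auto
    then show ?thesis by blast
  qed
  moreover have "continuous_on ?B (\<lambda>x. norm (p (snd x) - p (fst x)))"
    by (intro continuous_intros continuous_on_compose2 [OF cont [of UNIV]]) auto
  ultimately obtain x0 where x0: "x0 \<in> ?B"
    "\<And>x. x \<in> ?B \<Longrightarrow> norm (p (snd x0) - p (fst x0)) \<le> norm (p (snd x) - p (fst x))"
    using continuous_attains_inf [of ?B "\<lambda>x. norm (p (snd x) - p (fst x))"] by blast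
  define m where "m = norm (p (snd x0) - p (fst x0))"
  have "p (snd x0) \<noteq> p (fst x0)"
  proof
    assume "p (snd x0) = p (fst x0)"
    then obtain k :: int where "fst x0 - snd x0 = of_int k"
      using inj by (metis Ints_cases)
    moreover have "\<bar>fst x0 - snd x0\<bar> \<le> 1/2" using x0(1) by (simp add: abs_minus_commute)
    ultimately have "\<bar>real_of_int k\<bar> < 1" by linarith
    then have "k = 0" by linarith
    with \<open>fst x0 - snd x0 = of_int k\<close> show False using x0(1) \<eta> by auto
  qed
  then have "m > 0" by (simp add: m_def)
  obtain B where B: "B > 0" "\<And>t. t \<in> {0..1} \<Longrightarrow> norm (p' t) \<le> B"
  proof -
    have "compact (p' ` {0..1})"
      by (intro compact_continuous_image continuous_on_subset [OF cont_deriv]) auto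
    then obtain B where "B > 0" "\<forall>x\<in>p' ` {0..1}. norm x \<le> B"
      using compact_imp_bounded bounded_pos by blast
    then show ?thesis using that by blast
  qed
  show ?thesis
  proof
    \<comment> \<open>With this bound on \<open>s\<close> the displacement has norm at most
      \<open>m / 2\<close>.\<close>
    show "m / (2 * B) > 0" using \<open>m > 0\<close> B by simp
    fix t s :: real
    assume t: "t \<in> {0..1}" and s: "0 < \<bar>s\<bar>" "\<bar>s\<bar> \<le> m / (2 * B)"
    show "p t + of_real s * \<i> * p' t \<notin> path_image p"
    proof
      assume "p t + of_real s * \<i> * p' t \<in> path_image p"
      then obtain u0 where "p u0 = p t + of_real s * \<i> * p' t"
        by (auto simp: path_image_eq)
      \<comment> \<open>Subtracting the integer nearest to \<open>u0 - t\<close> brings the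
        parameter within 1/2 of \<open>t\<close> without moving the point.\<close>
      moreover define u where "u = u0 + of_int (- round (u0 - t))"
      ultimately have pu: "p u = p t + of_real s * \<i> * p' t"
        using periodic_int by metis
      have ut: "\<bar>u - t\<bar> \<le> 1/2"
        using of_int_round_abs_le [of "u0 - t"] by (simp add: u_def algebra_simps abs_minus_commute)
      have "u \<noteq> t" using pu s regular by auto
      show False
      proof (cases "\<bar>u - t\<bar> < \<eta>")
        case True
        have "inner (p t) (p' t) \<noteq> inner (p u) (p' t)"
        proof (rule MVT_nonzero [of t u "\<lambda>x. inner (p x) (p' t)" "\<lambda>x. inner (p' x) (p' t)"])
          fix x assume "x \<in> closed_segment t u"
          then have "\<bar>x - t\<bar> < \<eta>" using True
            by (auto simp: closed_segment_eq_real_ivl split: if_splits)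
          then show "inner (p' x) (p' t) > 0" using near t by blast
          show "((\<lambda>x. inner (p x) (p' t)) has_real_derivative inner (p' x) (p' t)) (at x)"
            unfolding has_real_derivative_iff_has_vector_derivative
            by (rule bounded_linear.has_vector_derivative [OF bounded_linear_inner_left deriv])
        qed (use \<open>u \<noteq> t\<close> in auto)
        then show False
          by (simp add: pu inner_complex_def algebra_simps)
      next
        case False
        moreover have "- 1 \<le> u" "u \<le> 2" using t ut unfolding abs_le_iff by auto
        ultimately have "(t, u) \<in> ?B" using t ut by auto
        then have "m \<le> norm (of_real s * \<i> * p' t)"
          using x0(2) [of "(t, u)"] pu by (simp add: m_def)
        also have "\<dots> = \<bar>s\<bar> * norm (p' t)" by (simp add: norm_mult)
        also have "\<dots> \<le> m / (2 * B) * B"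
          using s B t by (intro mult_mono) auto
        also have "\<dots> < m" using \<open>m > 0\<close> B by simp
        finally show False by simp
      qed
    qed
  qed
qed

text \<open>Which normal direction points inside is decided at one point. An inside point
  \<open>w\<close> near the curve lies on the normal at its nearest curve point, so it determines a
  sign; all short normals with that sign form a connected set off the curve, hence lie inside
  together with \<open>w\<close>.\<close>

lemma normal_to_inside:
  obtains s :: real where "s \<noteq> 0" "\<And>t. t \<in> {0..1} \<Longrightarrow> p t + of_real s * \<i> * p' t \<in> inside (path_image p)"
proof -
  obtain \<delta> where \<delta>: "\<delta> > 0"
    "\<And>t s. t \<in> {0..1} \<Longrightarrow> 0 < \<bar>s\<bar> \<Longrightarrow> \<bar>s\<bar> \<le> \<delta> \<Longrightarrow> p t + of_real s * \<i> * p' t \<notin> path_image p"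
    using normal_segments_avoid by blast
  obtain t0 where t0: "t0 \<in> {0..1}" "\<And>t. t \<in> {0..1} \<Longrightarrow> norm (p' t0) \<le> norm (p' t)"
  proof -
    have "continuous_on {0..1} (\<lambda>t. norm (p' t))"
      by (intro continuous_intros continuous_on_subset [OF cont_deriv]) auto
    then show ?thesis
      using continuous_attains_inf [of "{0..1}" "\<lambda>t. norm (p' t)"] that by auto
  qed
  have "p 0 \<in> frontier (inside (path_image p))"
    using Jordan_inside_outside [OF simple(1,2)] by (simp add: path_image_eq)
  then have "p 0 \<in> closure (inside (path_image p))"
    by (simp add: frontier_def)
  moreover have "\<delta> * norm (p' t0) > 0"
    using \<delta> regular by simp
  \<comment> \<open>As \<open>norm (p' t0)\<close> is the minimal speed, this distance forces the
    normal coordinate \<open>s\<close> of \<open>w\<close> below \<open>\<delta>\<close>, wherever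
    its nearest curve point is.\<close>
  ultimately obtain w where w: "w \<in> inside (path_image p)" "dist w (p 0) < \<delta> * norm (p' t0)"
    by (meson closure_approachable)
  obtain t where t: "t \<in> {0..1}" "\<And>u. dist w (p t) \<le> dist w (p u)"
  proof -
    have "compact (path_image p)" "path_image p \<noteq> {}"
      using simple by (auto simp: compact_path_image)
    then obtain z where z: "z \<in> path_image p" "\<And>y. y \<in> path_image p \<Longrightarrow> dist w z \<le> dist w y"
      using distance_attains_inf [OF compact_imp_closed] by metis
    then obtain t where t: "t \<in> {0..1}" "z = p t"
      by (auto simp: path_image_def)
    have "dist w (p t) \<le> dist w (p u)" for u
      using z(2) [of "p u"] t(2) by (simp add: path_image_eq)
    then show ?thesis using t(1) that by blast
  qed
  have orth: "inner (w - p t) (p' t) = 0"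
  proof -
    have der: "((\<lambda>u. inner (w - p u) (w - p u)) has_real_derivative - 2 * inner (w - p t) (p' t)) (at t)"
    proof -
      have "((\<lambda>u. w - p u) has_vector_derivative 0 - p' t) (at t)"
        by (intro has_vector_derivative_diff has_vector_derivative_const deriv)
      from bounded_bilinear.has_vector_derivative [OF bounded_bilinear_inner this this]
      show ?thesis
        unfolding has_real_derivative_iff_has_vector_derivative by (simp add: inner_commute)
    qed
    have mn: "inner (w - p t) (w - p t) \<le> inner (w - p u) (w - p u)" for u
      using t(2) [of u] by (simp add: dist_norm norm_le)
    \<comment> \<open>The squared distance to \<open>w\<close> is minimal at \<open>t\<close>, so
      its derivative vanishes there.\<close>
    have "- 2 * inner (w - p t) (p' t) = 0"
      by (rule DERIV_local_min [OF der zero_less_one]) (use mn in blast)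
    then show ?thesis by simp
  qed
  define s where "s = Im ((w - p t) / p' t)"
  have "Re ((w - p t) / p' t) = 0"
    using orth by (simp add: Re_divide inner_complex_def)
  then have "(w - p t) / p' t = of_real s * \<i>"
    by (simp add: complex_eq_iff s_def)
  then have ws: "w = p t + of_real s * \<i> * p' t"
    using regular [of t] by (simp add: field_simps)
  have wp: "w \<notin> path_image p" using w(1) inside_no_overlap by blast
  then have "s \<noteq> 0" using ws path_image_eq by auto
  have "\<bar>s\<bar> * norm (p' t) = dist w (p t)" by (simp add: ws dist_norm norm_mult)
  also have "\<dots> < \<delta> * norm (p' t0)" using t(2) [of 0] w(2) by linarith
  also have "\<dots> \<le> \<delta> * norm (p' t)" using t0 t \<delta> by simp
  finally have "\<bar>s\<bar> < \<delta>" using regular by simp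
  let ?n = "\<lambda>x. p (fst x) + of_real (sgn s * snd x) * \<i> * p' (fst x)"
  let ?N = "?n ` ({0..1} \<times> {0<..\<delta>})"
  have "connected ?N"
    by (intro connected_continuous_image continuous_intros connected_Times
        continuous_on_compose2 [OF cont [of UNIV]] continuous_on_compose2 [OF cont_deriv]) auto
  moreover have "?N \<subseteq> - path_image p"
  proof
    fix y assume "y \<in> ?N"
    then obtain x t' where xt: "t' \<in> {0..1}" "x \<in> {0<..\<delta>}" "y = ?n (t', x)" by auto
    have "\<bar>sgn s * x\<bar> = x" using \<open>s \<noteq> 0\<close> xt(2) by (simp add: abs_mult abs_sgn_eq)
    then show "y \<in> - path_image p"
      using \<delta>(2) [OF xt(1), of "sgn s * x"] xt(2,3) by simp
  qed
  moreover have "w \<in> ?N"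
  proof
    show "w = ?n (t, \<bar>s\<bar>)" using ws by (simp add: sgn_mult_abs mult.commute [of "sgn s"] abs_mult_sgn)
    show "(t, \<bar>s\<bar>) \<in> {0..1} \<times> {0<..\<delta>}" using t \<open>\<bar>s\<bar> < \<delta>\<close> \<open>s \<noteq> 0\<close> by simp
  qed
  ultimately have N: "y \<in> inside (path_image p)" if "y \<in> ?N" for y
    by (intro inside_same_component [OF _ w(1)])
      (use that in \<open>simp add: connected_component_def, blast\<close>)
  show ?thesis
  proof
    show "sgn s * \<delta> \<noteq> 0" using \<open>s \<noteq> 0\<close> \<delta> by (simp add: sgn_eq_0_iff)
    fix t :: real assume "t \<in> {0..1}"
    then have "?n (t, \<delta>) \<in> ?N" using \<delta>(1) by (intro imageI) auto
    then show "p t + of_real (sgn s * \<delta>) * \<i> * p' t \<in> inside (path_image p)"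
      using N by simp
  qed
qed

end

section \<open>Contracting a region bounded by the curve\<close>

lemma homotopic_with_canon_iff:
  "homotopic_with_canon (\<lambda>_. True) S T f g \<longleftrightarrow>
    (\<exists>h. continuous_on ({0..1::real} \<times> S) h \<and> h \<in> {0..1} \<times> S \<rightarrow> T \<and>
      (\<forall>x\<in>S. h (0, x) = f x) \<and> (\<forall>x\<in>S. h (1, x) = g x))"
  by (subst homotopic_with) (simp_all add: conj_assoc)

lemma contraction_to_point:
  fixes U :: "complex set"
  assumes "contractible U" "p0 \<in> U"
  obtains h where "continuous_on ({0..1::real} \<times> U) h" "h \<in> {0..1} \<times> U \<rightarrow> U"
    "\<And>x. x \<in> U \<Longrightarrow> h (0, x) = x" "\<And>x. x \<in> U \<Longrightarrow> h (1, x) = p0"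
proof -
  have "homotopic_with_canon (\<lambda>h. True) U U (\<lambda>x. x) (\<lambda>x. p0)"
    by (rule homotopic_into_contractible) (use assms in auto)
  then obtain h where "continuous_on ({0..1::real} \<times> U) h" "h \<in> {0..1} \<times> U \<rightarrow> U"
    "\<And>x. x \<in> U \<Longrightarrow> h (0, x) = x" "\<And>x. x \<in> U \<Longrightarrow> h (1, x) = p0"
    unfolding homotopic_with_canon_iff by blast
  then show ?thesis using that by blast
qed

context regular_loop
begin

theorem turning_number:
  assumes p0: "p0 \<in> inside (path_image p)"
  shows "winding_number p' 0 = winding_number p p0"
proof -
  obtain s :: real where s: "s \<noteq> 0" "\<And>t. t \<in> {0..1} \<Longrightarrow> p t + of_real s * \<i> * p' t \<in> inside (path_image p)"
    using normal_to_inside by blast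
  let ?U = "inside (path_image p)"
  let ?f = "\<lambda>t. p t + of_real s * \<i> * p' t"
  have "open ?U" using Jordan_inside_outside [OF simple(1,2)] by blast
  then have "contractible ?U"
    using simply_connected_inside_simple_path simple contractible_eq_simply_connected_2d by blast
  then obtain h where h: "continuous_on ({0..1::real} \<times> ?U) h" "h \<in> {0..1} \<times> ?U \<rightarrow> ?U"
    "\<And>x. x \<in> ?U \<Longrightarrow> h (0, x) = x" "\<And>x. x \<in> ?U \<Longrightarrow> h (1, x) = p0"
    by (rule contraction_to_point [OF _ p0]) (rule that)
  have f1: "?f 1 = ?f 0" using periodic [of 0] deriv_periodic [of 0] by simp
  have hom: "homotopic_loops (-{0}) (\<lambda>t. p t - ?f t) (\<lambda>t. p t - p0)"
    unfolding homotopic_loops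
  proof (intro exI [of _ "\<lambda>x. p (snd x) - h (fst x, ?f (snd x))"] conjI ballI)
    show "continuous_on ({0..1} \<times> {0..1}) (\<lambda>x. p (snd x) - h (fst x, ?f (snd x)))"
      by (intro continuous_intros continuous_on_compose2 [OF h(1)] continuous_on_compose2 [OF cont [of UNIV]]
          continuous_on_compose2 [OF cont_deriv]) (use s(2) in auto)
    show "(\<lambda>x. p (snd x) - h (fst x, ?f (snd x))) \<in> {0..1} \<times> {0..1} \<rightarrow> - {0}"
    proof
      fix x :: "real \<times> real" assume x: "x \<in> {0..1} \<times> {0..1}"
      then have "h (fst x, ?f (snd x)) \<in> ?U" using h(2) s(2) by auto
      moreover have "p (snd x) \<notin> ?U" using inside_no_overlap path_image_eq by blast
      ultimately show "p (snd x) - h (fst x, ?f (snd x)) \<in> - {0}" by auto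
    qed
  qed (use h s(2) f1 periodic [of 0] in \<open>auto simp: pathfinish_def pathstart_def\<close>)
  have "winding_number (\<lambda>t. p t - p0) 0 = winding_number (\<lambda>t. p t - ?f t) 0"
    using winding_number_homotopic_loops [OF hom] by simp
  \<comment> \<open>At the start of the homotopy the loop is a constant multiple of the velocity, so
    it has the winding number of \<open>p'\<close>.\<close>
  also have "(\<lambda>t. p t - ?f t) = (\<lambda>t. (- of_real s * \<i>) * p' t)"
    by (auto simp: algebra_simps)
  also have "winding_number \<dots> 0 = winding_number p' 0"
    by (rule winding_number_const_mult)
      (use cont_deriv regular s in \<open>auto simp: path_def path_image_def intro: continuous_on_subset\<close>)
  finally show ?thesis using winding_number_offset [of p p0] by simp
qed

end

text \<open>The contraction is applied on the set \<open>\<Gamma>\<close> instead of along a loop: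
  after division by \<open>z - p0\<close> it is a homotopy to the constant 1, so the quotient has a
  continuous logarithm on \<open>\<Gamma>\<close>. Tietze extends that logarithm, and
  \<open>(z - p0) * exp (g z)\<close> then has its only zero at \<open>p0\<close>.\<close>

lemma normal_field_extension:
  fixes U \<Gamma> :: "complex set"
  assumes "closed \<Gamma>" "contractible U" "p0 \<in> U" "U \<inter> \<Gamma> = {}"
    and G: "continuous_on \<Gamma> G" and \<delta>: "\<delta> \<noteq> (0::real)" "\<And>z. z \<in> \<Gamma> \<Longrightarrow> z + of_real \<delta> * G z \<in> U"
  obtains g where "continuous_on UNIV g" "\<And>z. z \<in> \<Gamma> \<Longrightarrow> \<i> * G z = (z - p0) * exp (g z)"
proof -
  obtain h where h: "continuous_on ({0..1::real} \<times> U) h" "h \<in> {0..1} \<times> U \<rightarrow> U"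
    "\<And>x. x \<in> U \<Longrightarrow> h (0, x) = x" "\<And>x. x \<in> U \<Longrightarrow> h (1, x) = p0"
    by (rule contraction_to_point [OF assms(2,3)]) (rule that)
  let ?f = "\<lambda>z. z + of_real \<delta> * G z"
  let ?k = "\<lambda>x::real \<times> complex. (snd x - h (fst x, ?f (snd x))) / (snd x - p0)"
  have p0: "p0 \<notin> \<Gamma>" using assms(3,4) by blast
  have "homotopic_with_canon (\<lambda>h. True) \<Gamma> (-{0}) (\<lambda>z. ?k (0, z)) (\<lambda>z. 1)"
    unfolding homotopic_with_canon_iff
  proof (intro exI [of _ ?k] conjI ballI)
    show "continuous_on ({0..1} \<times> \<Gamma>) ?k"
      by (intro continuous_intros continuous_on_compose2 [OF h(1)] continuous_on_compose2 [OF G])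
        (use \<delta>(2) p0 in auto)
    show "?k \<in> {0..1} \<times> \<Gamma> \<rightarrow> - {0}"
    proof
      fix x :: "real \<times> complex" assume x: "x \<in> {0..1} \<times> \<Gamma>"
      then have "h (fst x, ?f (snd x)) \<in> U" using h(2) \<delta>(2) by auto
      then show "?k x \<in> - {0}" using x p0 assms(4) by auto
    qed
    show "?k (1, z) = 1" if "z \<in> \<Gamma>" for z
      using h(4) p0 that \<delta>(2) by auto
  qed auto
  then obtain g0 where g0: "continuous_on \<Gamma> g0" "\<And>z. z \<in> \<Gamma> \<Longrightarrow> ?k (0, z) = exp (g0 z)"
    using inessential_eq_continuous_logarithm [of \<Gamma> "\<lambda>z. ?k (0, z)"] by blast
  \<comment> \<open>The initial map of the homotopy is \<open>- \<delta> * G\<close>; the added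
    constant multiplies it by \<open>- \<i> / \<delta>\<close> and yields
    \<open>\<i> * G\<close>.\<close>
  have "\<i> * G z = (z - p0) * exp (g0 z + Ln (- \<i> / of_real \<delta>))" if "z \<in> \<Gamma>" for z
  proof -
    have "z \<noteq> p0" using assms(3,4) that by blast
    then have "- of_real \<delta> * G z = (z - p0) * exp (g0 z)"
      using g0(2) [OF that] h(3) [OF \<delta>(2) [OF that]] by (simp add: field_simps)
    then have "G z = (z - p0) * exp (g0 z) / (- of_real \<delta>)" using \<delta>(1) by (simp add: field_simps)
    then show ?thesis using \<delta>(1) by (simp add: exp_add)
  qed
  moreover have "continuous_on \<Gamma> (\<lambda>z. g0 z + Ln (- \<i> / of_real \<delta>))"
    by (intro continuous_intros g0)
  then obtain g where "continuous_on UNIV g" "\<And>z. z \<in> \<Gamma> \<Longrightarrow> g z = g0 z + Ln (- \<i> / of_real \<delta>)"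
    by (rule Tietze_unbounded [where U = UNIV]) (use assms(1) in auto)
  ultimately show ?thesis using that [of g] by simp
qed

section \<open>Indices of zeros\<close>

lemma winding_number_const_mult_circlepath:
  assumes "a \<noteq> 0" "r > 0"
  shows "winding_number (\<lambda>t. a * circlepath 0 r t) 0 = 1"
    and "winding_number (\<lambda>t. a * cnj (circlepath 0 r t)) 0 = - 1"
proof -
  have c: "path (circlepath 0 r)" "0 \<notin> path_image (circlepath 0 r)"
    using assms by auto
  have a: "path (\<lambda>t::real. a)" "0 \<notin> path_image (\<lambda>t::real. a)" "winding_number (\<lambda>t::real. a) 0 = 0"
    using assms(1) by (auto simp: path_def path_image_def winding_number_zero_const)
  show "winding_number (\<lambda>t. a * circlepath 0 r t) 0 = 1"
    using winding_number_mult [OF a(1,2) c] a(3) winding_number_circlepath_centre [of r 0] assms(2) by simp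
  have "path (cnj \<circ> circlepath 0 r)" "0 \<notin> path_image (cnj \<circ> circlepath 0 r)"
    using c by (auto simp: path_image_def path_def intro!: continuous_intros)
  moreover have "winding_number (cnj \<circ> circlepath 0 r) 0 = - 1"
    using winding_number_cnj [OF c] winding_number_circlepath_centre [of r 0] assms(2) by simp
  ultimately show "winding_number (\<lambda>t. a * cnj (circlepath 0 r t)) 0 = - 1"
    using winding_number_mult [OF a(1,2), of "cnj \<circ> circlepath 0 r"] a(3) by simp
qed

lemma real_linear_eq:
  fixes L :: "complex \<Rightarrow> complex"
  assumes "linear L" shows "L v = Re v *\<^sub>R L 1 + Im v *\<^sub>R L \<i>"
proof -
  have "v = Re v *\<^sub>R 1 + Im v *\<^sub>R \<i>" by (simp add: complex_eq_iff)
  then show ?thesis by (metis assms linear_add linear_cmul)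
qed

text \<open>The Wirtinger form of a real-linear map; \<open>Im (cnj (L 1) * L \<i>)\<close> is its
  real determinant.\<close>

lemma real_linear_complex_decomposition:
  fixes L :: "complex \<Rightarrow> complex"
  assumes "linear L"
  defines "\<alpha> \<equiv> (L 1 - \<i> * L \<i>) / 2" and "\<beta> \<equiv> (L 1 + \<i> * L \<i>) / 2"
  shows "L z = \<alpha> * z + \<beta> * cnj z" and "(cmod \<alpha>)\<^sup>2 - (cmod \<beta>)\<^sup>2 = Im (cnj (L 1) * L \<i>)"
proof -
  show "L z = \<alpha> * z + \<beta> * cnj z"
    using real_linear_eq [OF assms(1), of z] unfolding \<alpha>_def \<beta>_def
    by (simp add: complex_eq_iff field_simps)
  show "(cmod \<alpha>)\<^sup>2 - (cmod \<beta>)\<^sup>2 = Im (cnj (L 1) * L \<i>)"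
    unfolding \<alpha>_def \<beta>_def cmod_power2 by (simp add: power2_eq_square field_simps)
qed

text \<open>On small circles \<open>g\<close> is close to its linear part, in which
  \<open>\<alpha> * z\<close> or \<open>\<beta> * cnj z\<close> dominates according to the sign of
  the determinant. These two wind 1 and -1 times.\<close>

lemma index_of_regular_zero:
  fixes g L :: "complex \<Rightarrow> complex"
  assumes W: "open W" "q \<in> W" "continuous_on W g" and "g q = 0"
    and der: "(g has_derivative L) (at q)" and "Im (cnj (L 1) * L \<i>) \<noteq> 0"
  shows "eventually (\<lambda>r. winding_number (g \<circ> circlepath q r) 0 = of_real (sgn (Im (cnj (L 1) * L \<i>)))) (at_right 0)"
proof -
  have lin: "linear L" using der has_derivative_linear by blast
  define \<alpha> \<beta> where "\<alpha> = (L 1 - \<i> * L \<i>) / 2" and "\<beta> = (L 1 + \<i> * L \<i>) / 2"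
  define J where "J = Im (cnj (L 1) * L \<i>)"
  have L: "L z = \<alpha> * z + \<beta> * cnj z" for z
    unfolding \<alpha>_def \<beta>_def by (rule real_linear_complex_decomposition(1) [OF lin])
  have J: "(cmod \<alpha>)\<^sup>2 - (cmod \<beta>)\<^sup>2 = J"
    unfolding \<alpha>_def \<beta>_def J_def by (rule real_linear_complex_decomposition(2) [OF lin])
  have "J \<noteq> 0" using assms(6) by (simp add: J_def)
  \<comment> \<open>Half the gap between the two coefficients: the smaller term and the
    linearization error together stay below the larger term.\<close>
  define \<epsilon> where "\<epsilon> = \<bar>cmod \<alpha> - cmod \<beta>\<bar> / 2"
  have "\<epsilon> > 0" using J \<open>J \<noteq> 0\<close> by (auto simp: \<epsilon>_def)
  then obtain d where d: "d > 0" "\<And>y. norm (y - q) < d \<Longrightarrow> norm (g y - g q - L (y - q)) \<le> \<epsilon> * norm (y - q)"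
    using der unfolding has_derivative_at_alt by blast
  have "eventually (\<lambda>r. cball q r \<subseteq> W - {}) (at_right 0)"
    by (rule finite_avoid_cball) (use W in auto)
  moreover have "eventually (\<lambda>r. r < d) (at_right 0)"
    using d(1) unfolding eventually_at_right_field by blast
  moreover have "eventually (\<lambda>r. r > 0) (at_right (0::real))"
    by (rule eventually_at_right_less)
  ultimately show ?thesis
  proof eventually_elim
    case (elim r)
    let ?c = "circlepath q r"
    have pg: "path (g \<circ> ?c)"
    proof (rule path_continuous_image)
      have "path_image ?c \<subseteq> W" using elim sphere_cball [of q r] by auto
      then show "continuous_on (path_image ?c) g" by (rule continuous_on_subset [OF W(3)])
    qed simp
    have loop: "pathfinish (g \<circ> ?c) = pathstart (g \<circ> ?c)"
      using pathfinish_circlepath [of q r] pathstart_circlepath [of q r] by (simp add: pathfinish_def pathstart_def)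
    have c0: "?c t = q + circlepath 0 r t" "norm (circlepath 0 r t) = r" for t
      using elim by (auto simp: circlepath norm_mult)
    have est: "norm (g (?c t) - L (circlepath 0 r t)) \<le> \<epsilon> * r" for t
      using d(2) [of "?c t"] elim assms(4) by (simp add: c0)
    have p0: "path (circlepath 0 r)" "circlepath 0 r 1 = circlepath 0 r 0"
      using pathfinish_circlepath [of 0 r] pathstart_circlepath [of 0 r] by (auto simp: pathfinish_def pathstart_def)
    show ?case
    proof (cases "J > 0")
      case True
      then have "(cmod \<beta>)\<^sup>2 < (cmod \<alpha>)\<^sup>2" using J by linarith
      then have ab: "cmod \<beta> < cmod \<alpha>" by (rule power2_less_imp_less) simp
      have "winding_number (g \<circ> ?c) 0 = winding_number (\<lambda>t. \<alpha> * circlepath 0 r t) 0"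
      proof (rule winding_number_nearby_loops_eq)
        fix t :: real
        have "norm (g (?c t) - \<alpha> * circlepath 0 r t) \<le>
            norm (g (?c t) - L (circlepath 0 r t)) + norm (\<beta> * cnj (circlepath 0 r t))"
          by (rule order_trans [OF _ norm_triangle_ineq]) (simp add: L)
        also have "\<dots> \<le> \<epsilon> * r + cmod \<beta> * r"
          using est [of t] by (simp add: norm_mult c0)
        also have "\<dots> = (\<epsilon> + cmod \<beta>) * r" by (simp add: algebra_simps)
        also have "\<dots> < cmod \<alpha> * r"
          using elim ab by (intro mult_strict_right_mono) (auto simp: \<epsilon>_def field_simps)
        finally show "norm ((g \<circ> ?c) t - \<alpha> * circlepath 0 r t) < norm (\<alpha> * circlepath 0 r t - 0)"
          by (simp add: norm_mult c0)
      qed (use pg loop p0 in \<open>auto simp: path_def pathfinish_def pathstart_def intro!: continuous_intros\<close>)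
      moreover have "\<alpha> \<noteq> 0" using ab by auto
      ultimately show ?thesis
        using winding_number_const_mult_circlepath(1) elim True by (simp add: J_def)
    next
      case False
      then have "J < 0" using \<open>J \<noteq> 0\<close> by auto
      then have "(cmod \<alpha>)\<^sup>2 < (cmod \<beta>)\<^sup>2" using J by linarith
      then have ab: "cmod \<alpha> < cmod \<beta>" by (rule power2_less_imp_less) simp
      have "winding_number (g \<circ> ?c) 0 = winding_number (\<lambda>t. \<beta> * cnj (circlepath 0 r t)) 0"
      proof (rule winding_number_nearby_loops_eq)
        fix t :: real
        have "norm (g (?c t) - \<beta> * cnj (circlepath 0 r t)) \<le>
            norm (g (?c t) - L (circlepath 0 r t)) + norm (\<alpha> * circlepath 0 r t)"
          by (rule order_trans [OF _ norm_triangle_ineq]) (simp add: L)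
        also have "\<dots> \<le> \<epsilon> * r + cmod \<alpha> * r"
          using est [of t] by (simp add: norm_mult c0)
        also have "\<dots> = (\<epsilon> + cmod \<alpha>) * r" by (simp add: algebra_simps)
        also have "\<dots> < cmod \<beta> * r"
          using elim ab by (intro mult_strict_right_mono) (auto simp: \<epsilon>_def field_simps)
        finally show "norm ((g \<circ> ?c) t - \<beta> * cnj (circlepath 0 r t)) < norm (\<beta> * cnj (circlepath 0 r t) - 0)"
          by (simp add: norm_mult c0)
      qed (use pg loop p0 in \<open>auto simp: path_def pathfinish_def pathstart_def intro!: continuous_intros\<close>)
      moreover have "\<beta> \<noteq> 0" using ab by auto
      ultimately show ?thesis
        using winding_number_const_mult_circlepath(2) elim \<open>J < 0\<close> by (simp add: J_def)
    qed
  qed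
qed

text \<open>Off the critical set \<open>C\<close> the maps \<open>M z\<close> are injective, and on \<open>C\<close> the two fields are
  proportional, so the straight homotopy between \<open>X\<close> and \<open>\<plusminus>Y\<close> creates no new zeros.\<close>

lemma index_parallel_fields:
  fixes M :: "complex \<Rightarrow> complex \<Rightarrow> complex" and X Y :: "complex \<Rightarrow> complex" and C :: "complex set"
  assumes W: "open W" "q \<in> W" "q \<in> C" and lin: "\<And>z. linear (M z)"
    and cont: "continuous_on W X" "continuous_on W Y"
      "continuous_on W (\<lambda>z. M z (X z))" "continuous_on W (\<lambda>z. M z (Y z))"
    and XY: "\<And>z. z \<in> W \<Longrightarrow> X z \<noteq> 0" "\<And>z. z \<in> W \<Longrightarrow> Y z \<noteq> 0"
    and M: "\<And>z v. z \<in> W - C \<Longrightarrow> v \<noteq> 0 \<Longrightarrow> M z v \<noteq> 0"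
    and par: "\<And>z. z \<in> W \<inter> C \<Longrightarrow> \<exists>c. X z = c *\<^sub>R Y z"
    and nz: "\<And>z. z \<in> W - {q} \<Longrightarrow> M z (Y z) \<noteq> 0"
    and ind: "eventually (\<lambda>r. winding_number ((\<lambda>z. M z (Y z)) \<circ> circlepath q r) 0 = n) (at_right 0)"
  shows "eventually (\<lambda>r. winding_number ((\<lambda>z. M z (X z)) \<circ> circlepath q r) 0 = n) (at_right 0)"
proof -
  obtain c where c: "X q = c *\<^sub>R Y q" using par W by blast
  \<comment> \<open>With this sign \<open>X\<close> and \<open>\<tau> *\<^sub>R Y\<close> have
    positive inner product at \<open>q\<close>, and by continuity nearby.\<close>
  define \<tau> :: real where "\<tau> = sgn c"
  have "c \<noteq> 0" using c XY(1) W by auto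
  then have \<tau>: "\<tau> \<noteq> 0" by (simp add: \<tau>_def sgn_eq_0_iff)
  let ?i = "\<lambda>z. inner (X z) (\<tau> *\<^sub>R Y z)"
  have "?i q = \<bar>c\<bar> * (norm (Y q))\<^sup>2"
    by (simp add: c \<tau>_def dot_square_norm abs_sgn)
  then have "?i q > 0" using \<open>c \<noteq> 0\<close> XY(2) W by simp
  have "continuous_on W ?i" by (intro continuous_intros cont)
  then have "open (W \<inter> ?i -` {0<..})"
    using W(1) by (rule continuous_open_preimage) auto
  moreover have "W \<inter> ?i -` {0<..} = {z \<in> W. ?i z > 0}" by auto
  ultimately have "open {z \<in> W. ?i z > 0}" "q \<in> {z \<in> W. ?i z > 0}"
    using \<open>?i q > 0\<close> W by auto
  then have "eventually (\<lambda>r. cball q r \<subseteq> {z \<in> W. ?i z > 0} - {}) (at_right 0)"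
    by (intro finite_avoid_cball) auto
  moreover have "eventually (\<lambda>r. r > 0) (at_right (0::real))"
    by (rule eventually_at_right_less)
  ultimately show ?thesis
    using ind
  proof eventually_elim
    case (elim r)
    let ?c = "circlepath q r" and ?f = "\<lambda>z. M z (X z)" and ?g = "\<lambda>z. M z (Y z)"
    have sph: "?c t \<in> W \<and> ?i (?c t) > 0 \<and> ?c t \<noteq> q" for t
    proof -
      have s: "?c t \<in> sphere q r" using elim(2) by (auto simp: circlepath dist_norm norm_mult)
      then have "?c t \<in> cball q r" by simp
      then have "?c t \<in> {z \<in> W. ?i z > 0}" using elim(1) by blast
      then show ?thesis using s elim(2) by auto
    qed
    have pth: "path (h \<circ> ?c)" if "continuous_on W h" for h :: "complex \<Rightarrow> complex"
      by (rule path_continuous_image) (use sph in \<open>auto simp: path_image_def intro: continuous_on_subset [OF that]\<close>)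
    have loop: "?c 1 = ?c 0"
      using pathfinish_circlepath [of q r] pathstart_circlepath [of q r] by (simp add: pathfinish_def pathstart_def)
    have "winding_number (?f \<circ> ?c) 0 = winding_number (\<lambda>t. of_real \<tau> * (?g \<circ> ?c) t) 0"
    proof (rule winding_number_loops_linear_eq)
      show "path (\<lambda>t. of_real \<tau> * (?g \<circ> ?c) t)" "path (?f \<circ> ?c)"
        using pth [OF cont(3)] pth [OF cont(4)] unfolding path_def by (auto intro!: continuous_intros)
      fix t :: real
      let ?z = "?c t"
      show "0 \<notin> closed_segment (of_real \<tau> * (?g \<circ> ?c) t) ((?f \<circ> ?c) t)"
      proof
        assume "0 \<in> closed_segment (of_real \<tau> * (?g \<circ> ?c) t) ((?f \<circ> ?c) t)"
        then obtain u where u: "0 \<le> u" "u \<le> 1" "0 = (1 - u) *\<^sub>R (\<tau> *\<^sub>R M ?z (Y ?z)) + u *\<^sub>R M ?z (X ?z)"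
          by (auto simp: closed_segment_def scaleR_conv_of_real)
        \<comment> \<open>A zero on the segment would put the convex combination \<open>v\<close>
          into the kernel of \<open>M ?z\<close>. But \<open>v\<close> is nonzero by its inner
          product with \<open>Y\<close>, and on \<open>C\<close> it is a multiple of
          \<open>Y\<close>.\<close>
        define v where "v = (1 - u) *\<^sub>R (\<tau> *\<^sub>R Y ?z) + u *\<^sub>R X ?z"
        have Mv: "M ?z v = 0"
          using u(3) lin [of ?z] by (simp add: v_def linear_add linear_cmul)
        have pos: "inner v (\<tau> *\<^sub>R Y ?z) > 0"
        proof -
          define y where "y = \<tau> *\<^sub>R Y ?z"
          have "inner v y = (1 - u) * inner y y + u * inner (X ?z) y"
            by (simp add: v_def y_def [symmetric] inner_add_left)
          moreover have "inner y y > 0" using \<tau> XY(2) sph unfolding inner_gt_zero_iff y_def by simp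
          moreover have "inner (X ?z) y > 0" using sph [of t] by (simp add: y_def)
          ultimately show ?thesis
            using u(1,2) unfolding y_def [symmetric]
            by (cases "u = 0") (simp_all add: add_nonneg_pos)
        qed
        then have "v \<noteq> 0" by auto
        show False
        proof (cases "?z \<in> C")
          case True
          then obtain b where "X ?z = b *\<^sub>R Y ?z" using par sph by blast
          then have v: "v = ((1 - u) * \<tau> + u * b) *\<^sub>R Y ?z"
            by (simp add: v_def algebra_simps)
          then have "((1 - u) * \<tau> + u * b) *\<^sub>R M ?z (Y ?z) = 0"
            using Mv lin [of ?z] by (simp add: linear_cmul)
          then show False using nz sph v \<open>v \<noteq> 0\<close> by auto
        next
          case False
          then show False using M Mv \<open>v \<noteq> 0\<close> sph by blast
        qed
      qed
    qed (use loop in \<open>auto simp: pathfinish_def pathstart_def\<close>)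
    also have "\<dots> = winding_number (\<lambda>t::real. of_real \<tau>) 0 + winding_number (?g \<circ> ?c) 0"
      by (rule winding_number_mult) (use pth [OF cont(4)] \<tau> nz sph in \<open>auto simp: path_image_def path_def\<close>)
    also have "\<dots> = n" using elim(3) \<tau> by (simp add: winding_number_zero_const)
    finally show ?case .
  qed
qed

section \<open>The two sides of a level curve\<close>

text \<open>The two curves cut the plane into three connected pieces, each contained in
  \<open>A\<close> or disjoint from it as it misses the frontier. Boundedness excludes the outer
  piece, connectedness of \<open>A\<close> forces the middle one, and the inner one is excluded
  because \<open>c1\<close> would otherwise run in the interior of \<open>A\<close>.\<close>

lemma annulus_eq_between:
  fixes c1 c2 :: "real \<Rightarrow> complex"
  assumes c1: "simple_path c1" "pathfinish c1 = pathstart c1"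
    and c2: "simple_path c2" "pathfinish c2 = pathstart c2"
    and sub: "path_image c1 \<subseteq> inside (path_image c2)"
    and A: "compact A" "connected A" "frontier A = path_image c1 \<union> path_image c2"
  shows "A = path_image c2 \<union> inside (path_image c2) - inside (path_image c1)"
proof -
  let ?\<gamma>1 = "path_image c1" and ?\<gamma>2 = "path_image c2"
  let ?M = "inside ?\<gamma>2 \<inter> outside ?\<gamma>1"
  note io = simple_loop_inside_outside [OF c1 c2 sub]
  note J1 = Jordan_inside_outside [OF c1] and J2 = Jordan_inside_outside [OF c2]
  have o: "open (inside ?\<gamma>2)" "open (outside ?\<gamma>1)" using J1 J2 by simp_all
  have con: "connected (inside ?\<gamma>1)" "connected (inside ?\<gamma>2)" "connected (outside ?\<gamma>1)" "connected (outside ?\<gamma>2)"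
    using J1 J2 by simp_all
  have ne: "?\<gamma>1 \<noteq> {}" "?\<gamma>2 \<noteq> {}" by simp_all
  have no: "inside ?\<gamma>1 \<inter> ?\<gamma>1 = {}" "inside ?\<gamma>2 \<inter> ?\<gamma>2 = {}" "outside ?\<gamma>1 \<inter> ?\<gamma>1 = {}" "outside ?\<gamma>2 \<inter> ?\<gamma>2 = {}"
      "inside ?\<gamma>1 \<inter> outside ?\<gamma>1 = {}" "inside ?\<gamma>2 \<inter> outside ?\<gamma>2 = {}"
    using inside_no_overlap outside_no_overlap inside_Int_outside by blast+
  have cover: "inside ?\<gamma>1 \<union> outside ?\<gamma>1 \<union> ?\<gamma>1 = UNIV" "inside ?\<gamma>2 \<union> outside ?\<gamma>2 \<union> ?\<gamma>2 = UNIV"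
    using inside_Un_outside [of ?\<gamma>1] inside_Un_outside [of ?\<gamma>2] by blast+
  have dich: "S \<subseteq> A \<or> S \<inter> A = {}" if "connected S" "S \<inter> (?\<gamma>1 \<union> ?\<gamma>2) = {}" for S
    using connected_Int_frontier [OF that(1), of A] that(2) A(3) by blast
  have "frontier A \<subseteq> A"
    using A(1) by (simp add: compact_imp_closed frontier_subset_closed)
  then have gA: "?\<gamma>1 \<subseteq> A" "?\<gamma>2 \<subseteq> A" using A(3) by auto
  have I: "inside ?\<gamma>1 \<subseteq> A \<or> inside ?\<gamma>1 \<inter> A = {}"
    by (rule dich [OF con(1)]) (use io no in blast)
  have O: "outside ?\<gamma>2 \<inter> A = {}"
  proof -
    have "outside ?\<gamma>2 \<subseteq> A \<or> outside ?\<gamma>2 \<inter> A = {}"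
      by (rule dich [OF con(4)]) (use io no in blast)
    moreover have "\<not> bounded (outside ?\<gamma>2)" using J2 by simp
    ultimately show ?thesis
      using A(1) compact_imp_bounded bounded_subset by blast
  qed
  have M: "?M \<subseteq> A \<or> ?M \<inter> A = {}"
  proof -
    \<comment> \<open>Connectedness of the middle piece: two points separated by neither curve are
      not separated by their union, since the curves have empty, hence connected,
      intersection.\<close>
    have cc: "connected_component (- (?\<gamma>1 \<union> ?\<gamma>2)) a b" if "a \<in> ?M" "b \<in> ?M" for a b
    proof (rule Janiszewski)
      show "compact ?\<gamma>1" "closed ?\<gamma>2"
        using c1 c2 by (auto simp: compact_simple_path_image closed_simple_path_image)
      have "?\<gamma>1 \<inter> ?\<gamma>2 = {}" using sub no by blast
      then show "connected (?\<gamma>1 \<inter> ?\<gamma>2)" by simp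
      show "connected_component (- ?\<gamma>1) a b"
        unfolding connected_component_def using that no con by (intro exI [of _ "outside ?\<gamma>1"]) blast
      show "connected_component (- ?\<gamma>2) a b"
        unfolding connected_component_def using that no con by (intro exI [of _ "inside ?\<gamma>2"]) blast
    qed
    have "a \<in> A \<longleftrightarrow> b \<in> A" if ab: "a \<in> ?M" "b \<in> ?M" for a b
    proof -
      obtain T where "connected T" "T \<subseteq> - (?\<gamma>1 \<union> ?\<gamma>2)" "a \<in> T" "b \<in> T"
        using cc [OF ab] unfolding connected_component_def by blast
      then show ?thesis using dich [of T] by blast
    qed
    then show ?thesis by blast
  qed
  have MA: "?M \<subseteq> A"
  proof (rule ccontr)
    assume "\<not> ?M \<subseteq> A"
    then have "?M \<inter> A = {}" using M by blast
    moreover have "A \<subseteq> inside ?\<gamma>2 \<union> outside ?\<gamma>1" using io cover by blast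
    moreover have "inside ?\<gamma>2 \<inter> A \<noteq> {}" "outside ?\<gamma>1 \<inter> A \<noteq> {}"
      using sub io gA ne by blast+
    ultimately show False
      using connectedD [OF A(2) o] by blast
  qed
  have "inside ?\<gamma>1 \<inter> A = {}"
  proof (rule ccontr)
    assume "inside ?\<gamma>1 \<inter> A \<noteq> {}"
    then have "inside ?\<gamma>2 \<subseteq> A" using I MA gA cover by blast
    then have "?\<gamma>1 \<subseteq> interior A" using sub o(1) interior_maximal by blast
    then show False using A(3) ne by (auto simp: frontier_def)
  qed
  then show ?thesis using MA gA O cover no io by blast
qed

section \<open>Connectedness of the sides of a level set\<close>

lemma norm_diff_scaleR_less:
  fixes a b :: "'a::real_inner"
  assumes "s > 0" "s * (norm b)\<^sup>2 \<le> inner b a" "inner b a > 0"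
  shows "norm (a - s *\<^sub>R b) < norm a"
proof -
  have "(norm (a - s *\<^sub>R b))\<^sup>2 = (norm a)\<^sup>2 - 2 * s * inner b a + s * (s * (norm b)\<^sup>2)"
    by (simp add: power2_norm_eq_inner inner_diff_left inner_diff_right inner_commute algebra_simps)
  also have "\<dots> \<le> (norm a)\<^sup>2 - 2 * s * inner b a + s * inner b a"
    using assms by (intro add_left_mono mult_left_mono) auto
  also have "\<dots> < (norm a)\<^sup>2" using assms by simp
  finally show ?thesis by (rule power2_less_imp_less) simp
qed

text \<open>Directions \<open>v\<close> with \<open>inner v (w - z) > 0\<close> enter the ball,
  where \<open>E\<close> is positive near \<open>z\<close>, so \<open>E\<close> cannot decrease
  along them to first order. A nonzero gradient that is nonnegative on this open half-space is
  positive on its inner normal \<open>w - z\<close>.\<close>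

lemma gradient_points_into_ball:
  fixes E :: "'a::euclidean_space \<Rightarrow> real"
  assumes der: "(E has_derivative (\<lambda>v. inner g v)) (at z)" and "g \<noteq> 0" "E z = 0" "w \<noteq> z"
    and pos: "\<exists>d>0. \<forall>y \<in> ball w (dist w z). dist z y < d \<longrightarrow> E y > 0"
  shows "inner g (w - z) > 0"
proof -
  have nonneg: "inner g v \<ge> 0" if v: "inner v (w - z) > 0" for v
  proof -
    have line: "((\<lambda>t. E (z + t *\<^sub>R v)) has_real_derivative inner g v) (at 0)"
    proof -
      have "((\<lambda>t. z + t *\<^sub>R v) has_derivative (\<lambda>t. t *\<^sub>R v)) (at 0)"
        by (auto intro!: derivative_eq_intros)
      moreover have "(E has_derivative (\<lambda>v. inner g v)) (at (z + 0 *\<^sub>R v))" using der by simp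
      ultimately have "((\<lambda>t. E (z + t *\<^sub>R v)) has_derivative (\<lambda>t. inner g (t *\<^sub>R v))) (at 0)"
        by (rule has_derivative_compose)
      then show ?thesis by (simp add: has_field_derivative_def mult_commute_abs)
    qed
    obtain d where d: "d > 0" "\<And>y. y \<in> ball w (dist w z) \<Longrightarrow> dist z y < d \<Longrightarrow> E y > 0"
      using pos by blast
    have "v \<noteq> 0" using v by auto
    show ?thesis
    proof (rule ccontr)
      assume "\<not> inner g v \<ge> 0"
      then have "inner g v < 0" by simp
      then obtain e where e: "e > 0" "\<And>h. 0 < h \<Longrightarrow> h < e \<Longrightarrow> E (z + h *\<^sub>R v) < E z"
        using DERIV_neg_dec_right [OF line] by auto
      \<comment> \<open>The three bounds keep the step within the range of decrease of
        \<open>E\<close>, within distance \<open>d\<close> of \<open>z\<close>, and inside the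
        ball.\<close>
      define h where "h = min (e / 2) (min (d / (2 * norm v)) (inner v (w - z) / (norm v)\<^sup>2))"
      have h: "h > 0" "h < e" "h * norm v < d" "h * (norm v)\<^sup>2 \<le> inner v (w - z)"
      proof -
        show "h > 0" "h < e" using e(1) d(1) v \<open>v \<noteq> 0\<close> by (auto simp: h_def)
        have "h \<le> d / (2 * norm v)" "h \<le> inner v (w - z) / (norm v)\<^sup>2" by (auto simp: h_def)
        then have "h * norm v \<le> d / 2" "h * (norm v)\<^sup>2 \<le> inner v (w - z)"
          using \<open>v \<noteq> 0\<close> by (auto simp: field_simps)
        then show "h * norm v < d" "h * (norm v)\<^sup>2 \<le> inner v (w - z)" using d(1) by auto
      qed
      have "norm (w - z - h *\<^sub>R v) < norm (w - z)"
        using h v by (intro norm_diff_scaleR_less)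
      then have "z + h *\<^sub>R v \<in> ball w (dist w z)"
        by (simp add: dist_norm algebra_simps)
      moreover have "dist z (z + h *\<^sub>R v) < d" using h by (simp add: dist_norm)
      ultimately have "E (z + h *\<^sub>R v) > 0" by (rule d(2))
      then show False using e(2) [OF h(1,2)] assms(3) by simp
    qed
  qed
  show ?thesis
  proof (rule ccontr)
    assume "\<not> inner g (w - z) > 0"
    moreover have "inner g (w - z) \<ge> 0" using nonneg [of "w - z"] assms(4) by simp
    ultimately have zero: "inner g (w - z) = 0" by simp
    have "inner (w - z) (w - z) > 0" using assms(4) by (metis inner_gt_zero_iff right_minus_eq)
    \<comment> \<open>If \<open>g\<close> were orthogonal to \<open>w - z\<close>, tilting the
      direction by \<open>- g\<close> would still enter the ball, but with derivative
      \<open>- inner g g\<close>.\<close>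
    then have "inner ((w - z) - g) (w - z) > 0"
      using zero unfolding inner_diff_left [of "w - z" g] by linarith
    then have "inner g ((w - z) - g) \<ge> 0" by (rule nonneg)
    then have "inner g g \<le> 0"
      using zero unfolding inner_diff_right [of g "w - z" g] by linarith
    then show False using assms(2) by (metis inner_gt_zero_iff not_le)
  qed
qed

text \<open>The one-sided collar \<open>?K\<close>, an image of
  \<open>\<Gamma> \<times> {0<..\<delta>}\<close>, is connected. Any \<open>w\<close> in
  \<open>U\<close> reaches it: the open ball around \<open>w\<close> up to a nearest point
  \<open>z\<close> of \<open>\<Gamma>\<close> stays in \<open>U\<close>, and since the gradient at
  \<open>z\<close> points into this ball, the ball meets the collar segment at
  \<open>z\<close>.\<close>

lemma side_connected:
  fixes E :: "'a::euclidean_space \<Rightarrow> real" and G :: "'a \<Rightarrow> 'a"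
  assumes \<Gamma>: "compact \<Gamma>" "connected \<Gamma>" "\<Gamma> \<noteq> {}"
    and U: "open U" "open U'" "U \<inter> U' = {}" "U \<union> U' = - \<Gamma>"
    and E: "\<And>z. z \<in> \<Gamma> \<Longrightarrow> (E has_derivative (\<lambda>v. inner (G z) v)) (at z)"
      "\<And>z. z \<in> \<Gamma> \<Longrightarrow> G z \<noteq> 0" "\<And>z. z \<in> \<Gamma> \<Longrightarrow> E z = 0" "continuous_on \<Gamma> G"
    and pos: "\<And>z. z \<in> \<Gamma> \<Longrightarrow> \<exists>d>0. \<forall>y\<in>U. dist z y < d \<longrightarrow> E y > 0"
    and \<delta>: "\<delta> > 0" "\<And>z s. z \<in> \<Gamma> \<Longrightarrow> 0 < s \<Longrightarrow> s \<le> \<delta> \<Longrightarrow> z + s *\<^sub>R G z \<in> U"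
  shows "connected U"
proof -
  let ?n = "\<lambda>x. fst x + snd x *\<^sub>R G (fst x)"
  let ?K = "?n ` (\<Gamma> \<times> {0<..\<delta>})"
  have K: "connected ?K"
    by (intro connected_continuous_image continuous_intros connected_Times \<Gamma>
        continuous_on_compose2 [OF E(4)]) auto
  have KU: "?K \<subseteq> U" using \<delta>(2) by auto
  have meet: "connected_component U w k" if w: "w \<in> U" and k: "k \<in> ?K" for w k
  proof -
    obtain z where z: "z \<in> \<Gamma>" "\<And>y. y \<in> \<Gamma> \<Longrightarrow> dist w z \<le> dist w y"
      using distance_attains_inf [OF compact_imp_closed [OF \<Gamma>(1)] \<Gamma>(3)] by metis
    let ?B = "ball w (dist w z)"
    have "w \<noteq> z" using w z(1) U(4) by auto
    have "?B \<inter> \<Gamma> = {}" using z(2) by (fastforce simp: not_le [symmetric])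
    then have "?B \<subseteq> U \<union> U'" using U(4) by blast
    moreover have "w \<in> ?B" using \<open>w \<noteq> z\<close> by simp
    ultimately have BU: "?B \<subseteq> U"
      using connectedD [OF connected_ball [of w "dist w z"] U(1,2)] U(3) w by blast
    have i: "inner (G z) (w - z) > 0"
    proof (rule gradient_points_into_ball)
      show "\<exists>d>0. \<forall>y\<in>?B. dist z y < d \<longrightarrow> E y > 0"
        using pos [OF z(1)] BU by (meson subsetD)
    qed (use z(1) E \<open>w \<noteq> z\<close> in auto)
    define s where "s = min \<delta> (inner (G z) (w - z) / (norm (G z))\<^sup>2)"
    have s: "s > 0" "s \<le> \<delta>" "s * (norm (G z))\<^sup>2 \<le> inner (G z) (w - z)"
    proof -
      have "norm (G z) > 0" using E(2) z(1) by simp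
      then show "s > 0" "s \<le> \<delta>" using i \<delta>(1) by (auto simp: s_def)
      have "s \<le> inner (G z) (w - z) / (norm (G z))\<^sup>2" by (simp add: s_def)
      then show "s * (norm (G z))\<^sup>2 \<le> inner (G z) (w - z)"
        using \<open>norm (G z) > 0\<close> by (simp add: field_simps)
    qed
    have "norm (w - z - s *\<^sub>R G z) < norm (w - z)"
      using s i by (intro norm_diff_scaleR_less)
    then have "?n (z, s) \<in> ?B" by (simp add: dist_norm algebra_simps)
    then have "connected_component U w (?n (z, s))"
      unfolding connected_component_def using BU \<open>w \<in> ?B\<close> connected_ball by blast
    moreover have "connected_component U (?n (z, s)) k"
    proof -
      have "?n (z, s) \<in> ?K" using z(1) s by (intro imageI) auto
      then show ?thesis unfolding connected_component_def using K KU k by blast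
    qed
    ultimately show ?thesis by (rule connected_component_trans)
  qed
  obtain z0 where "z0 \<in> \<Gamma>" using \<Gamma>(3) by blast
  then have k: "?n (z0, \<delta>) \<in> ?K" using \<delta>(1) by (intro imageI) auto
  show ?thesis
    unfolding connected_iff_connected_component
  proof (intro ballI)
    fix a b assume "a \<in> U" "b \<in> U"
    then show "connected_component U a b"
      using connected_component_trans [OF meet [OF _ k] connected_component_sym [OF meet [OF _ k]]] by blast
  qed
qed

text \<open>While \<open>G\<close> at the moved point has positive inner product with
  \<open>G z\<close>, \<open>E\<close> increases strictly along the normal line at \<open>z\<close>.
  Compactness of \<open>\<Gamma>\<close> makes the admissible length uniform.\<close>

lemma gradient_collar:
  fixes E :: "'a::euclidean_space \<Rightarrow> real" and G :: "'a \<Rightarrow> 'a"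
  assumes \<Gamma>: "compact \<Gamma>" "\<Gamma> \<subseteq> M" "open M"
    and E: "\<And>z. (E has_derivative (\<lambda>v. inner (G z) v)) (at z)"
      "\<And>z. z \<in> \<Gamma> \<Longrightarrow> G z \<noteq> 0" "\<And>z. z \<in> \<Gamma> \<Longrightarrow> E z = 0" "continuous_on UNIV G"
  obtains \<delta> where "\<delta> > 0"
    "\<And>z s. z \<in> \<Gamma> \<Longrightarrow> 0 < s \<Longrightarrow> s \<le> \<delta> \<Longrightarrow> z + s *\<^sub>R G z \<in> M \<and> E (z + s *\<^sub>R G z) > 0"
    "\<And>z s. z \<in> \<Gamma> \<Longrightarrow> 0 < s \<Longrightarrow> s \<le> \<delta> \<Longrightarrow> z - s *\<^sub>R G z \<in> M \<and> E (z - s *\<^sub>R G z) < 0"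
proof -
  let ?n = "\<lambda>x. fst x + snd x *\<^sub>R G (fst x)"
  let ?O = "?n -` M \<inter> {x. inner (G (?n x)) (G (fst x)) > 0}"
  have "compact (\<Gamma> \<times> {0::real})" using \<Gamma>(1) by (intro compact_Times) auto
  moreover have "open ?O"
  proof (intro open_Int open_vimage \<Gamma> open_Collect_less)
    show cn: "continuous_on UNIV ?n"
      by (intro continuous_intros continuous_on_compose2 [OF E(4)]) auto
    show "continuous_on UNIV (\<lambda>x. inner (G (?n x)) (G (fst x)))"
      by (intro continuous_intros continuous_on_compose2 [OF E(4) cn] continuous_on_compose2 [OF E(4)]) auto
  qed auto
  moreover have "\<Gamma> \<times> {0} \<subseteq> ?O" using \<Gamma>(2) E(2) by auto
  ultimately obtain e where e: "e > 0" "(\<Union>x\<in>\<Gamma> \<times> {0}. ball x e) \<subseteq> ?O"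
    by (rule compact_subset_open_imp_ball_epsilon_subset)
  have near: "z + s *\<^sub>R G z \<in> M \<and> inner (G (z + s *\<^sub>R G z)) (G z) > 0" if "z \<in> \<Gamma>" "\<bar>s\<bar> < e" for z s
  proof -
    have "(z, s) \<in> ball (z, 0) e" using that(2) by (simp add: dist_Pair_Pair dist_real_def)
    then have "(z, s) \<in> ?O" using e(2) that(1) by blast
    then show ?thesis by auto
  qed
  have der: "((\<lambda>s. E (z + s *\<^sub>R G z)) has_real_derivative inner (G (z + s *\<^sub>R G z)) (G z)) (at s)" for z s
  proof -
    have "((\<lambda>t. z + t *\<^sub>R G z) has_derivative (\<lambda>t. t *\<^sub>R G z)) (at s)"
      by (auto intro!: derivative_eq_intros)
    from has_derivative_compose [OF this E(1)]
    show ?thesis by (simp add: has_field_derivative_def mult_commute_abs)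
  qed
  show ?thesis
  proof
    show "e / 2 > 0" using e by simp
    fix z s assume z: "z \<in> \<Gamma>" and s: "0 < s" "s \<le> e / 2"
    have incr: "\<exists>y. ((\<lambda>s. E (z + s *\<^sub>R G z)) has_real_derivative y) (at x) \<and> 0 < y" if "\<bar>x\<bar> < e" for x
      using der near [OF z that] by blast
    have "E (z + 0 *\<^sub>R G z) < E (z + s *\<^sub>R G z)"
      by (rule DERIV_pos_imp_increasing [OF s(1)]) (use incr s e in auto)
    then show "z + s *\<^sub>R G z \<in> M \<and> E (z + s *\<^sub>R G z) > 0"
      using near [OF z, of s] s e(1) E(3) [OF z] by simp
    have "E (z + (- s) *\<^sub>R G z) < E (z + 0 *\<^sub>R G z)"
      by (rule DERIV_pos_imp_increasing) (use incr s e in auto)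
    then show "z - s *\<^sub>R G z \<in> M \<and> E (z - s *\<^sub>R G z) < 0"
      using near [OF z, of "- s"] s e(1) E(3) [OF z] by simp
  qed
qed

text \<open>The positive side \<open>U\<close> and the negative side \<open>U'\<close> are connected
  open sets that partition the complement of \<open>\<Gamma>\<close>, one bounded and the other not,
  so they are its inside and outside. The complement of \<open>U\<close> is
  \<open>U' \<union> \<Gamma>\<close>, which is connected; hence \<open>U\<close> is simply
  connected.\<close>

lemma level_curve_sides:
  fixes c1 c2 :: "real \<Rightarrow> complex" and E :: "complex \<Rightarrow> real" and G :: "complex \<Rightarrow> complex"
  assumes c1: "simple_path c1" "pathfinish c1 = pathstart c1"
    and c2: "simple_path c2" "pathfinish c2 = pathstart c2"
    and sub: "path_image c1 \<subseteq> inside (path_image c2)"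
    and A: "A = path_image c2 \<union> inside (path_image c2) - inside (path_image c1)"
    and \<Gamma>: "\<Gamma> = A \<inter> {z. E z = 0}" "connected \<Gamma>" "\<Gamma> \<noteq> {}"
    and E: "\<And>z. (E has_derivative (\<lambda>v. inner (G z) v)) (at z)"
      "\<And>z. z \<in> \<Gamma> \<Longrightarrow> G z \<noteq> 0" "continuous_on UNIV G"
    and pos: "\<And>z. z \<in> path_image c1 \<Longrightarrow> E z > 0" and neg: "\<And>z. z \<in> path_image c2 \<Longrightarrow> E z < 0"
  shows "compact \<Gamma>"
    and "\<Gamma> \<subseteq> inside (path_image c2) \<inter> outside (path_image c1)"
    and "inside \<Gamma> = inside (path_image c1) \<union> (inside (path_image c2) \<inter> {z. E z > 0})"
    and "outside \<Gamma> = outside (path_image c2) \<union> (outside (path_image c1) \<inter> {z. E z < 0})"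
    and "contractible (inside \<Gamma>)"
    and "\<exists>\<delta>>0. \<forall>z\<in>\<Gamma>. z + \<delta> *\<^sub>R G z \<in> inside \<Gamma>"
proof -
  let ?\<gamma>1 = "path_image c1" and ?\<gamma>2 = "path_image c2"
  let ?M = "inside ?\<gamma>2 \<inter> outside ?\<gamma>1"
  \<comment> \<open>The sign of \<open>E\<close> is controlled only near \<open>\<Gamma>\<close> and
    on the ring, so the whole hole joins \<open>U\<close> and the whole exterior joins
    \<open>U'\<close>, whatever \<open>E\<close> does there.\<close>
  define U where "U = inside ?\<gamma>1 \<union> (inside ?\<gamma>2 \<inter> {z. E z > 0})"
  define U' where "U' = outside ?\<gamma>2 \<union> (outside ?\<gamma>1 \<inter> {z. E z < 0})"
  note io = simple_loop_inside_outside [OF c1 c2 sub]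
  note J1 = Jordan_inside_outside [OF c1] and J2 = Jordan_inside_outside [OF c2]
  have op: "open (inside ?\<gamma>1)" "open (inside ?\<gamma>2)" "open (outside ?\<gamma>1)" "open (outside ?\<gamma>2)"
    using J1 J2 by simp_all
  have no: "inside ?\<gamma>1 \<inter> ?\<gamma>1 = {}" "inside ?\<gamma>2 \<inter> ?\<gamma>2 = {}" "outside ?\<gamma>1 \<inter> ?\<gamma>1 = {}" "outside ?\<gamma>2 \<inter> ?\<gamma>2 = {}"
      "inside ?\<gamma>1 \<inter> outside ?\<gamma>1 = {}" "inside ?\<gamma>2 \<inter> outside ?\<gamma>2 = {}"
    using inside_no_overlap outside_no_overlap inside_Int_outside by blast+
  have cover: "inside ?\<gamma>1 \<union> outside ?\<gamma>1 \<union> ?\<gamma>1 = UNIV" "inside ?\<gamma>2 \<union> outside ?\<gamma>2 \<union> ?\<gamma>2 = UNIV"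
    using inside_Un_outside [of ?\<gamma>1] inside_Un_outside [of ?\<gamma>2] by blast+
  have contE: "continuous_on UNIV E"
    by (intro continuous_at_imp_continuous_on ballI has_derivative_continuous [OF E(1)])
  have E0: "E z = 0" if "z \<in> \<Gamma>" for z using that \<Gamma>(1) by auto
  have pc: "path c1" "path c2" using c1 c2 simple_path_imp_path by auto
  have cpt: "compact (?\<gamma>2 \<union> inside ?\<gamma>2)"
    using J2 pc by (simp add: compact_eq_bounded_closed bounded_path_image closed_path_image_Un_inside)
  have "\<Gamma> = (?\<gamma>2 \<union> inside ?\<gamma>2) \<inter> (- inside ?\<gamma>1 \<inter> {z. E z = 0})"
    unfolding \<Gamma>(1) A by blast
  moreover have "closed (- inside ?\<gamma>1 \<inter> {z. E z = 0})"
    using op by (intro closed_Int closed_Compl closed_Collect_eq contE continuous_intros) auto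
  ultimately show cG: "compact \<Gamma>"
    using cpt compact_Int_closed by metis
  have notg: "\<Gamma> \<inter> ?\<gamma>1 = {}" "\<Gamma> \<inter> ?\<gamma>2 = {}" using pos neg E0 by fastforce+
  show GM: "\<Gamma> \<subseteq> ?M"
    using notg cover unfolding \<Gamma>(1) A by blast
  have U: "open U" "open U'"
    unfolding U_def U'_def using op
    by (intro open_Un open_Int open_Collect_less contE continuous_intros; simp)+
  have disj: "U \<inter> U' = {}"
    unfolding U_def U'_def using no io by fastforce
  have un: "U \<union> U' = - \<Gamma>"
  proof
    show "U \<union> U' \<subseteq> - \<Gamma>"
      unfolding U_def U'_def using E0 GM no by fastforce
    show "- \<Gamma> \<subseteq> U \<union> U'"
    proof
      fix z assume z: "z \<in> - \<Gamma>"
      consider "z \<in> inside ?\<gamma>1" | "z \<in> ?\<gamma>1" | "z \<in> ?\<gamma>2" | "z \<in> outside ?\<gamma>2" | "z \<in> ?M"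
        using cover by blast
      then show "z \<in> U \<union> U'"
      proof cases
        case 2 then show ?thesis using pos sub by (auto simp: U_def)
      next
        case 3 then show ?thesis using neg io by (auto simp: U'_def)
      next
        case 5
        then have "E z \<noteq> 0" using z no unfolding \<Gamma>(1) A by blast
        then show ?thesis using 5 by (auto simp: U_def U'_def)
      qed (auto simp: U_def U'_def)
    qed
  qed
  obtain \<delta> where \<delta>: "\<delta> > 0"
    "\<And>z s. z \<in> \<Gamma> \<Longrightarrow> 0 < s \<Longrightarrow> s \<le> \<delta> \<Longrightarrow> z + s *\<^sub>R G z \<in> ?M \<and> E (z + s *\<^sub>R G z) > 0"
    "\<And>z s. z \<in> \<Gamma> \<Longrightarrow> 0 < s \<Longrightarrow> s \<le> \<delta> \<Longrightarrow> z - s *\<^sub>R G z \<in> ?M \<and> E (z - s *\<^sub>R G z) < 0"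
    using gradient_collar [OF cG GM _ E(1,2) E0 E(3)] op by (metis open_Int)
  have near: "\<exists>d>0. \<forall>y. dist z y < d \<longrightarrow> y \<in> ?M" if "z \<in> \<Gamma>" for z
    using open_Int [OF op(2,3)] GM that by (meson mem_ball open_contains_ball subsetD)
  have posU: "\<exists>d>0. \<forall>y\<in>U. dist z y < d \<longrightarrow> E y > 0" if z: "z \<in> \<Gamma>" for z
  proof -
    obtain d where d: "d > 0" "\<And>y. dist z y < d \<Longrightarrow> y \<in> ?M" using near [OF z] by blast
    have "E y > 0" if "y \<in> U" "dist z y < d" for y
      using that(1) d(2) [OF that(2)] no unfolding U_def by blast
    then show ?thesis using d(1) by blast
  qed
  have negU': "\<exists>d>0. \<forall>y\<in>U'. dist z y < d \<longrightarrow> - E y > 0" if z: "z \<in> \<Gamma>" for z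
  proof -
    obtain d where d: "d > 0" "\<And>y. dist z y < d \<Longrightarrow> y \<in> ?M" using near [OF z] by blast
    have "- E y > 0" if "y \<in> U'" "dist z y < d" for y
    proof -
      have "E y < 0" using that(1) d(2) [OF that(2)] no unfolding U'_def by blast
      then show ?thesis by simp
    qed
    then show ?thesis using d(1) by blast
  qed
  have conU: "connected U"
  proof (rule side_connected [OF cG \<Gamma>(2,3) U disj un E(1,2) E0 _ posU \<delta>(1)])
    show "continuous_on \<Gamma> G" using E(3) by (rule continuous_on_subset) simp
    show "z + s *\<^sub>R G z \<in> U" if "z \<in> \<Gamma>" "0 < s" "s \<le> \<delta>" for z s
      using \<delta>(2) [OF that] by (simp add: U_def)
  qed
  have col': "z + s *\<^sub>R - G z \<in> U'" if "z \<in> \<Gamma>" "0 < s" "s \<le> \<delta>" for z s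
    using \<delta>(3) [OF that] by (simp add: U'_def)
  \<comment> \<open>The negative side is the positive side of \<open>- E\<close>, with gradient
    \<open>- G\<close>.\<close>
  have conU': "connected U'"
  proof (rule side_connected [OF cG \<Gamma>(2,3) U(2,1) _ _ _ _ _ _ negU' \<delta>(1) col'])
    show "continuous_on \<Gamma> (\<lambda>z. - G z)" by (intro continuous_on_minus continuous_on_subset [OF E(3)]) simp
    show "((\<lambda>a. - E a) has_derivative (\<lambda>v. inner (- G z) v)) (at z)" for z
      using has_derivative_minus [OF E(1) [of z]] by simp
  qed (use disj un E(2) E0 in auto)
  have nb: "\<not> bounded U'" using J2 unfolding U'_def by simp
  have bU: "bounded U"
  proof (rule bounded_subset)
    show "bounded (inside ?\<gamma>2)" using J2 by simp
    show "U \<subseteq> inside ?\<gamma>2" using io(1) unfolding U_def by blast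
  qed
  have "U \<union> U' = - \<Gamma>" by (rule un)
  then have in1: "inside \<Gamma> \<subseteq> U" by (rule inside_subset [OF conU' nb])
  have out: "U' \<subseteq> outside \<Gamma>"
  proof
    fix x assume x: "x \<in> U'"
    have "U' \<subseteq> connected_component_set (- \<Gamma>) x"
      by (rule connected_component_maximal [OF x conU']) (use un in blast)
    then have "\<not> bounded (connected_component_set (- \<Gamma>) x)" using nb bounded_subset by metis
    then show "x \<in> outside \<Gamma>" unfolding outside by simp
  qed
  have in2: "U \<subseteq> inside \<Gamma>"
  proof
    fix x assume x: "x \<in> U"
    have "connected_component_set (- \<Gamma>) x \<subseteq> U"
    proof (rule ccontr)
      let ?C = "connected_component_set (- \<Gamma>) x"
      assume "\<not> ?C \<subseteq> U"
      moreover have "?C \<subseteq> - \<Gamma>" by (rule connected_component_subset)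
      moreover have "x \<in> ?C" using x un by (simp add: connected_component_refl_eq) blast
      ultimately show False
        using connectedD [OF connected_connected_component U] disj un x by blast
    qed
    then have "bounded (connected_component_set (- \<Gamma>) x)" using bU bounded_subset by metis
    then show "x \<in> inside \<Gamma>" using x un unfolding inside_def by blast
  qed
  have inU: "inside \<Gamma> = U" using in1 in2 by blast
  then show "inside \<Gamma> = inside ?\<gamma>1 \<union> (inside ?\<gamma>2 \<inter> {z. E z > 0})" by (simp add: U_def)
  have "outside \<Gamma> = U'"
    using out inU inside_Un_outside [of \<Gamma>] inside_Int_outside [of \<Gamma>] un by blast
  then show "outside \<Gamma> = outside ?\<gamma>2 \<union> (outside ?\<gamma>1 \<inter> {z. E z < 0})" by (simp add: U'_def)
  \<comment> \<open>Collar points on the negative side tend to each point of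
    \<open>\<Gamma>\<close>. So \<open>U' \<union> \<Gamma>\<close> lies between the connected set
    \<open>U'\<close> and its closure.\<close>
  have "\<Gamma> \<subseteq> closure U'"
  proof
    fix z assume z: "z \<in> \<Gamma>"
    show "z \<in> closure U'"
      unfolding closure_approachable
    proof (intro allI impI)
      fix e :: real assume "e > 0"
      define s where "s = min \<delta> (e / (2 * norm (G z)))"
      have G0: "norm (G z) > 0" using E(2) z by simp
      have s: "0 < s" "s \<le> \<delta>" "s \<le> e / (2 * norm (G z))"
        using \<open>e > 0\<close> \<delta>(1) G0 by (auto simp: s_def)
      then have "s * norm (G z) < e" using G0 \<open>e > 0\<close> by (simp add: field_simps)
      then show "\<exists>y\<in>U'. dist y z < e"
        using col' [OF z s(1,2)] s(1) by (intro bexI [of _ "z + s *\<^sub>R - G z"]) (auto simp: dist_norm)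
    qed
  qed
  then have "connected (U' \<union> \<Gamma>)"
    by (intro connected_intermediate_closure [OF conU']) (auto simp: closure_subset)
  moreover have "- U = U' \<union> \<Gamma>" using un disj by blast
  ultimately have "simply_connected U"
    using simply_connected_iff_simple [OF U(1) bU] conU by simp
  then show "contractible (inside \<Gamma>)"
    using contractible_eq_simply_connected_2d U(1) inU by simp
  show "\<exists>\<delta>>0. \<forall>z\<in>\<Gamma>. z + \<delta> *\<^sub>R G z \<in> inside \<Gamma>"
    unfolding inU by (rule exI [of _ \<delta>]) (use \<delta> in \<open>auto simp: U_def\<close>)
qed

section \<open>Continuous families of linear maps\<close>

locale linear_maps =
  fixes M :: "complex \<Rightarrow> complex \<Rightarrow> complex"
  assumes linear: "linear (M z)"
    and cont1: "continuous_on UNIV (\<lambda>z. M z 1)" and cont2: "continuous_on UNIV (\<lambda>z. M z \<i>)"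
begin

lemma continuous_apply:
  assumes "continuous_on S a" "continuous_on S b"
  shows "continuous_on S (\<lambda>x. M (a x) (b x))"
proof -
  have "continuous_on S (\<lambda>x. Re (b x) *\<^sub>R M (a x) 1 + Im (b x) *\<^sub>R M (a x) \<i>)"
    by (intro continuous_intros assms continuous_on_compose2 [OF cont1 assms(1)]
        continuous_on_compose2 [OF cont2 assms(1)]) auto
  then show ?thesis by (simp flip: real_linear_eq [OF linear])
qed

text \<open>Equal winding numbers give a homotopy from \<open>u\<close> to \<open>v\<close> off
  zero, and \<open>M\<close> is injective along \<open>p\<close>, so it carries the homotopy along.
  This lets the velocity of a boundary curve be replaced by the field \<open>X\<close> under
  \<open>DF\<close>.\<close>

lemma winding_number_apply_cong:
  assumes p: "path p" "pathfinish p = pathstart p"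
    and u: "path u" "pathfinish u = pathstart u" "0 \<notin> path_image u"
    and v: "path v" "pathfinish v = pathstart v" "0 \<notin> path_image v"
    and w: "winding_number u 0 = winding_number v 0"
    and inj: "\<And>z w. z \<in> path_image p \<Longrightarrow> w \<noteq> 0 \<Longrightarrow> M z w \<noteq> 0"
  shows "winding_number (\<lambda>t. M (p t) (u t)) 0 = winding_number (\<lambda>t. M (p t) (v t)) 0"
proof -
  have "homotopic_loops (-{0}) u v"
    using winding_number_homotopic_loops_eq [OF u(1,3) v(1,3) u(2) v(2)] w by simp
  then obtain h where h: "continuous_on ({0..1::real} \<times> {0..1::real}) h" "h \<in> {0..1} \<times> {0..1} \<rightarrow> -{0}"
    "\<forall>x\<in>{0..1}. h (0, x) = u x" "\<forall>x\<in>{0..1}. h (1, x) = v x"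
    "\<forall>t\<in>{0..1}. pathfinish (h \<circ> Pair t) = pathstart (h \<circ> Pair t)"
    unfolding homotopic_loops by blast
  have "homotopic_loops (-{0}) (\<lambda>t. M (p t) (u t)) (\<lambda>t. M (p t) (v t))"
    unfolding homotopic_loops
  proof (intro exI [of _ "\<lambda>x. M (p (snd x)) (h x)"] conjI ballI)
    show "continuous_on ({0..1} \<times> {0..1}) (\<lambda>x. M (p (snd x)) (h x))"
      using p(1) unfolding path_def
      by (intro continuous_apply h(1)) (rule continuous_on_compose2, auto intro: continuous_intros)
    show "(\<lambda>x. M (p (snd x)) (h x)) \<in> {0..1} \<times> {0..1} \<rightarrow> - {0}"
    proof
      fix x :: "real \<times> real" assume x: "x \<in> {0..1} \<times> {0..1}"
      then have "h x \<noteq> 0" using h(2) by fastforce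
      moreover have "p (snd x) \<in> path_image p" using x by (auto simp: path_image_def)
      ultimately show "M (p (snd x)) (h x) \<in> - {0}" using inj by simp
    qed
  qed (use h(3,4,5) p(2) in \<open>auto simp: pathfinish_def pathstart_def\<close>)
  then show ?thesis by (rule winding_number_homotopic_loops)
qed

end

section \<open>Turning numbers and the zeros of the tangent field\<close>

text \<open>The data at a zero \<open>q\<close> of index \<open>n\<close>: a local model \<open>Y\<close> of the tangent field \<open>\<i> G\<close> for
  which \<open>z \<mapsto> M z (Y z)\<close> has a regular zero at \<open>q\<close>.\<close>

definition cusp_model ::
  "(complex \<Rightarrow> complex \<Rightarrow> complex) \<Rightarrow> (complex \<Rightarrow> real) \<Rightarrow> (complex \<Rightarrow> complex) \<Rightarrow> complex \<Rightarrow> int \<Rightarrow> bool" where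
  "cusp_model M E G q n \<longleftrightarrow> (\<exists>W Y L. open W \<and> q \<in> W \<and> continuous_on W Y \<and> (\<forall>p\<in>W. Y p \<noteq> 0) \<and>
      (\<forall>p\<in>W. E p = 0 \<longrightarrow> (\<exists>c. \<i> * G p = c *\<^sub>R Y p)) \<and> (\<forall>p\<in>W - {q}. M p (Y p) \<noteq> 0) \<and> M q (Y q) = 0 \<and>
      ((\<lambda>p. M p (Y p)) has_derivative L) (at q) \<and> Im (cnj (L 1) * L \<i>) \<noteq> 0 \<and>
      sgn (Im (cnj (L 1) * L \<i>)) = real_of_int n)"

text \<open>The index count freed of \<open>F\<close>: \<open>E\<close> stands for the signed
  Jacobian, \<open>M\<close> for the derivative and \<open>Q\<close> for the cusps. Off
  \<open>Q\<close> the extended field is not killed by \<open>M\<close>: where \<open>E\<close> is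
  nonzero \<open>M\<close> is injective, and on \<open>\<Gamma>\<close> the field is
  \<open>\<i> * G\<close>.\<close>

lemma ring_turning_index:
  fixes p1 p2 p1' p2' :: "real \<Rightarrow> complex" and E :: "complex \<Rightarrow> real" and G :: "complex \<Rightarrow> complex"
    and M :: "complex \<Rightarrow> complex \<Rightarrow> complex" and n :: "complex \<Rightarrow> int"
  assumes R1: "regular_loop p1 p1'" and R2: "regular_loop p2 p2'"
    and sub: "path_image p1 \<subseteq> inside (path_image p2)"
    and ccw1: "\<And>z. z \<in> inside (path_image p1) \<Longrightarrow> winding_number p1 z = 1"
    and ccw2: "\<And>z. z \<in> inside (path_image p2) \<Longrightarrow> winding_number p2 z = 1"
    and A: "compact A" "connected A" "frontier A = path_image p1 \<union> path_image p2"
    and \<Gamma>: "\<Gamma> = A \<inter> {z. E z = 0}" "connected \<Gamma>" "\<Gamma> \<noteq> {}"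
    and E: "\<And>z. (E has_derivative (\<lambda>v. inner (G z) v)) (at z)"
      "\<And>z. z \<in> \<Gamma> \<Longrightarrow> G z \<noteq> 0" "continuous_on UNIV G"
    and pos: "\<And>z. z \<in> path_image p1 \<Longrightarrow> E z > 0" and neg: "\<And>z. z \<in> path_image p2 \<Longrightarrow> E z < 0"
    and M: "linear_maps M" "\<And>z v. E z \<noteq> 0 \<Longrightarrow> v \<noteq> 0 \<Longrightarrow> M z v \<noteq> 0"
    and Q: "Q \<subseteq> \<Gamma>" "\<And>z. z \<in> \<Gamma> - Q \<Longrightarrow> M z (\<i> * G z) \<noteq> 0"
    and cusp: "\<And>z. z \<in> Q \<Longrightarrow> cusp_model M E G z (n z)"
  shows "finite Q"
    and "winding_number (\<lambda>t. M (p2 t) (p2' t)) 0 =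
      winding_number (\<lambda>t. M (p1 t) (p1' t)) 0 + (\<Sum>z\<in>Q. of_int (n z))"
proof -
  interpret r1: regular_loop p1 p1' by fact
  interpret r2: regular_loop p2 p2' by fact
  interpret linear_maps M by fact
  have c1: "simple_path p1" "pathfinish p1 = pathstart p1" and c2: "simple_path p2" "pathfinish p2 = pathstart p2"
    using r1.simple r2.simple by auto
  note AK = annulus_eq_between [OF c1 c2 sub A]
  note S = level_curve_sides [OF c1 c2 sub AK \<Gamma> E pos neg]
  have q0: "M q (\<i> * G q) = 0" if q: "q \<in> Q" for q
  proof -
    have "E q = 0" using q Q(1) \<Gamma>(1) by auto
    then obtain Y c where "\<i> * G q = c *\<^sub>R Y q" "M q (Y q) = 0"
      using cusp [OF q] unfolding cusp_model_def by metis
    then show ?thesis using linear_cmul [OF linear [of q]] by simp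
  qed
  have contf0: "continuous_on UNIV (\<lambda>z. M z (\<i> * G z))"
    by (intro continuous_apply continuous_intros E)
  have closedG: "closed \<Gamma>" using S(1) by (rule compact_imp_closed)
  have Qeq: "Q = \<Gamma> \<inter> {z. M z (\<i> * G z) = 0}" using Q q0 by blast
  have "closed Q"
    unfolding Qeq by (intro closed_Int closedG closed_Collect_eq contf0 continuous_intros)
  show fin: "finite Q"
  proof (rule ccontr)
    \<comment> \<open>A limit point \<open>x\<close> lies in the closed set \<open>Q\<close>. Near
      \<open>x\<close> the zeros of \<open>M z (\<i> * G z)\<close> on \<open>\<Gamma>\<close> are
      zeros of \<open>M z (Y z)\<close>, and the model allows only \<open>x\<close> itself.\<close>
    assume "infinite Q"
    then obtain x where x: "x islimpt Q"
      using Heine_Borel_imp_Bolzano_Weierstrass [OF S(1)] Q(1) by blast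
    then have "x \<in> Q" using \<open>closed Q\<close> closed_limpt by blast
    then obtain W Y where W: "open W" "x \<in> W"
      "\<And>p. p \<in> W \<Longrightarrow> E p = 0 \<Longrightarrow> \<exists>c. \<i> * G p = c *\<^sub>R Y p" "\<And>p. p \<in> W - {x} \<Longrightarrow> M p (Y p) \<noteq> 0"
      using cusp [OF \<open>x \<in> Q\<close>] unfolding cusp_model_def by metis
    obtain y where y: "y \<in> Q" "y \<in> W" "y \<noteq> x"
      using x W(1,2) unfolding islimpt_def by blast
    then have y0: "y \<in> \<Gamma>" "E y = 0" using Q(1) \<Gamma>(1) by auto
    then obtain c where c: "\<i> * G y = c *\<^sub>R Y y" using W(3) y by blast
    then have "c \<noteq> 0" using E(2) [OF y0(1)] by auto
    moreover have "c *\<^sub>R M y (Y y) = 0"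
      using q0 [OF y(1)] linear_cmul [OF linear [of y]] by (simp add: c)
    ultimately show False using W(4) y by auto
  qed
  obtain p0 where p0: "p0 \<in> inside (path_image p1)"
    using Jordan_inside_outside [OF c1] by blast
  have p0G: "p0 \<in> inside \<Gamma>" using p0 S(3) by blast
  obtain \<delta> where \<delta>: "\<delta> > 0" "\<And>z. z \<in> \<Gamma> \<Longrightarrow> z + of_real \<delta> * G z \<in> inside \<Gamma>"
    using S(6) by (auto simp: scaleR_conv_of_real)
  obtain g where g: "continuous_on UNIV g" "\<And>z. z \<in> \<Gamma> \<Longrightarrow> \<i> * G z = (z - p0) * exp (g z)"
  proof (rule normal_field_extension [OF closedG S(5) p0G])
    show "inside \<Gamma> \<inter> \<Gamma> = {}" by (rule inside_no_overlap)
    show "continuous_on \<Gamma> G" using E(3) by (rule continuous_on_subset) simp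
    show "\<delta> \<noteq> 0" using \<delta>(1) by simp
  qed (use \<delta>(2) in auto)
  \<comment> \<open>The factor \<open>z - p0\<close> winds once along each boundary curve and the
    exponential factor not at all; the only zero \<open>p0\<close> lies in the hole.\<close>
  define X where "X z = (z - p0) * exp (g z)" for z
  have X: "continuous_on T X" for T
    unfolding X_def by (intro continuous_intros continuous_on_subset [OF g(1)]) auto
  have X0: "X z \<noteq> 0" if "z \<noteq> p0" for z using that by (simp add: X_def)
  let ?f = "\<lambda>z. M z (X z)" and ?M = "inside (path_image p2) \<inter> outside (path_image p1)"
  have contf: "continuous_on T ?f" for T
    by (intro continuous_apply X continuous_intros)
  have p0out: "p0 \<notin> ?M" "p0 \<notin> A"
    using p0 inside_Int_outside [of "path_image p1"] unfolding AK by blast+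
  have f0: "?f z \<noteq> 0" if "z \<in> A - Q" for z
  proof (cases "E z = 0")
    case True
    then have "z \<in> \<Gamma> - Q" using that \<Gamma>(1) by auto
    then show ?thesis using Q(2) g(2) by (simp add: X_def)
  next
    case False
    have "z \<noteq> p0" using that p0out(2) by blast
    then show ?thesis using M(2) [OF False X0] by blast
  qed
  have MA: "?M \<subseteq> A"
    using inside_Int_outside [of "path_image p1"] unfolding AK by blast
  have oM: "open ?M"
    using Jordan_inside_outside [OF c1] Jordan_inside_outside [OF c2] by (intro open_Int) auto
  have index: "eventually (\<lambda>r. winding_number (?f \<circ> circlepath q r) 0 = of_int (n q)) (at_right 0)"
    if q: "q \<in> Q" for q
  proof -
    obtain W Y L where W: "open W" "q \<in> W" "continuous_on W Y" "\<forall>p\<in>W. Y p \<noteq> 0"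
      "\<forall>p\<in>W. E p = 0 \<longrightarrow> (\<exists>c. \<i> * G p = c *\<^sub>R Y p)" "\<forall>p\<in>W - {q}. M p (Y p) \<noteq> 0"
      "M q (Y q) = 0" "((\<lambda>p. M p (Y p)) has_derivative L) (at q)" "Im (cnj (L 1) * L \<i>) \<noteq> 0"
      "sgn (Im (cnj (L 1) * L \<i>)) = real_of_int (n q)"
      using cusp [OF q] unfolding cusp_model_def by (elim exE conjE) (rule that)
    let ?W = "W \<inter> ?M"
    have qM: "q \<in> ?M" using q Q(1) S(2) by blast
    have Y: "continuous_on ?W Y" using W(3) by (rule continuous_on_subset) simp
    have MY: "continuous_on ?W (\<lambda>p. M p (Y p))"
      by (intro continuous_apply Y continuous_intros)
    have "eventually (\<lambda>r. winding_number ((\<lambda>p. M p (Y p)) \<circ> circlepath q r) 0 =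
        of_real (sgn (Im (cnj (L 1) * L \<i>)))) (at_right 0)"
      by (rule index_of_regular_zero [OF _ _ MY W(7,8,9)]) (use W oM qM in auto)
    then have ind: "eventually (\<lambda>r. winding_number ((\<lambda>p. M p (Y p)) \<circ> circlepath q r) 0 = of_int (n q)) (at_right 0)"
      unfolding W(10) by simp
    show ?thesis
    proof (rule index_parallel_fields [OF _ _ _ linear X Y contf MY _ _ _ _ _ ind])
      show "open ?W" using W(1) oM by (rule open_Int)
      show "q \<in> ?W" using W(2) qM by simp
      show "q \<in> {z. E z = 0}" using q Q(1) \<Gamma>(1) by auto
      show "X z \<noteq> 0" if "z \<in> ?W" for z
        by (rule X0) (use that p0out(1) in blast)
      show "Y z \<noteq> 0" if "z \<in> ?W" for z using W(4) that by blast
      show "M z v \<noteq> 0" if "z \<in> ?W - {z. E z = 0}" "v \<noteq> 0" for z v using M(2) that by blast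
      show "\<exists>c. X z = c *\<^sub>R Y z" if z: "z \<in> ?W \<inter> {z. E z = 0}" for z
      proof -
        have "z \<in> \<Gamma>" using z MA \<Gamma>(1) by blast
        then have "X z = \<i> * G z" using g(2) by (simp add: X_def)
        then show ?thesis using W(5) z by auto
      qed
      show "M z (Y z) \<noteq> 0" if "z \<in> ?W - {q}" for z using W(6) that by blast
    qed
  qed
  have main: "winding_number (?f \<circ> p2) 0 = winding_number (?f \<circ> p1) 0 + (\<Sum>z\<in>Q. of_int (n z))"
    using winding_number_ring_index [OF c1 c2 sub ccw1 ccw2 AK fin _ contf f0 index] Q(1) S(2) by blast
  \<comment> \<open>Along a boundary curve both \<open>X\<close> and the velocity wind once, the
    latter by the turning number theorem, so they may be exchanged under \<open>M\<close>.\<close>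
  have step: "winding_number (?f \<circ> p) 0 = winding_number (\<lambda>t. M (p t) (p' t)) 0"
    if R: "regular_loop p p'" and p0: "p0 \<in> inside (path_image p)"
      and w: "winding_number p p0 = 1" and nz: "\<And>z. z \<in> path_image p \<Longrightarrow> E z \<noteq> 0" for p p'
  proof -
    interpret regular_loop p p' by fact
    have pp: "p0 \<notin> path_image p" using p0 inside_no_overlap by blast
    then have pt: "p t \<noteq> p0" for t unfolding path_image_eq by auto
    have sh: "path (\<lambda>t. p t - p0)" "0 \<notin> path_image (\<lambda>t. p t - p0)"
      using pp simple(3) by (auto simp: path_def path_image_def intro!: continuous_intros)
    have gp: "path (\<lambda>t. g (p t))" "p 1 = p 0" "p' 1 = p' 0"
      using simple(2) deriv_periodic [of 0] unfolding path_def pathfinish_def pathstart_def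
      by (auto intro!: continuous_on_compose2 [OF g(1)] cont)
    have e: "path (\<lambda>t. exp (g (p t)))" "0 \<notin> path_image (\<lambda>t. exp (g (p t)))"
      using gp(1) unfolding path_def by (auto simp: path_image_def intro!: continuous_intros)
    have "winding_number (\<lambda>t. (p t - p0) * exp (g (p t))) 0 = 1"
      using winding_number_mult [OF sh e] winding_number_exp_loop [OF gp(1)] gp(2) w
        winding_number_offset [of p p0] by (simp add: pathfinish_def pathstart_def)
    then have wX: "winding_number (\<lambda>t. X (p t)) 0 = winding_number p' 0"
      using turning_number [OF p0] w by (simp add: X_def)
    have "winding_number (\<lambda>t. M (p t) (X (p t))) 0 = winding_number (\<lambda>t. M (p t) (p' t)) 0"
    proof (rule winding_number_apply_cong [OF simple(3,2) _ _ _ _ _ _ wX])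
      show "path (\<lambda>t. X (p t))" "path p'"
        unfolding path_def by (auto intro!: continuous_on_compose2 [OF X] cont continuous_on_subset [OF cont_deriv])
      show "0 \<notin> path_image (\<lambda>t. X (p t))" "0 \<notin> path_image p'"
        using X0 [OF pt] regular by (auto simp: path_image_def)
    qed (use gp M(2) nz in \<open>auto simp: pathfinish_def pathstart_def\<close>)
    then show ?thesis by (simp add: o_def)
  qed
  have "p0 \<in> inside (path_image p2)"
    using p0 simple_loop_inside_outside(1) [OF c1 c2 sub] by blast
  then show "winding_number (\<lambda>t. M (p2 t) (p2' t)) 0 =
      winding_number (\<lambda>t. M (p1 t) (p1' t)) 0 + (\<Sum>z\<in>Q. of_int (n z))"
    using main step [OF R1 p0 ccw1 [OF p0]] step [OF R2 _ ccw2] pos neg by fastforce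
qed

section \<open>Fold and cusp normal forms\<close>

lemma smooth_on_has_derivative:
  assumes "smooth_on U f" "x \<in> U"
  shows "(f has_derivative frechet_derivative f (at x)) (at x)"
  by (rule iffD1 [OF frechet_derivative_works])
    (use assms(1) [unfolded smooth_on_def, rule_format, of "Suc 0"] assms(2) in simp)

lemma smooth_on_continuous:
  assumes "smooth_on U f" shows "continuous_on U f"
  using assms [unfolded smooth_on_def, rule_format, of 0] by simp

lemma smooth_on_deriv:
  assumes "smooth_on U f" shows "smooth_on U (\<lambda>x. frechet_derivative f (at x) v)"
  unfolding smooth_on_def
proof
  fix n show "Ck_on n U (\<lambda>x. frechet_derivative f (at x) v)"
    using assms [unfolded smooth_on_def, rule_format, of "Suc n"] by simp
qed

lemma has_derivative_vec_nth [derivative_intros]: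
  "(f has_derivative f') F \<Longrightarrow> ((\<lambda>x. f x $ i) has_derivative (\<lambda>v. f' v $ i)) F"
  by (rule bounded_linear.has_derivative [OF bounded_linear_vec_nth])

lemma vector2_eq: "(vector [a, b] :: real^2) = a *\<^sub>R axis 1 1 + b *\<^sub>R axis 2 1"
  by (simp add: vec_eq_iff forall_2 axis_def)

lemma axis_sum2: "(v :: real^2) = v$1 *\<^sub>R axis 1 1 + v$2 *\<^sub>R axis 2 1"
  by (simp add: vec_eq_iff forall_2 axis_def)

lemma linear_axis2:
  fixes f :: "real^2 \<Rightarrow> 'a::real_vector"
  assumes "linear f" shows "f v = v$1 *\<^sub>R f (axis 1 1) + v$2 *\<^sub>R f (axis 2 1)"
  by (subst axis_sum2) (simp add: linear_add [OF assms] linear_cmul [OF assms])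

lemma det_matrix2: "det (matrix (f :: real^2 \<Rightarrow> real^2)) = f (axis 1 1) $ 1 * f (axis 2 1) $ 2 - f (axis 2 1) $ 1 * f (axis 1 1) $ 2"
  by (simp add: det_2 matrix_def)

definition jac :: "(real^2 \<Rightarrow> real^2) \<Rightarrow> real^2 \<Rightarrow> real" where
  "jac f p = det (jacobian f (at p))"

lemma jac_eq:
  "jac f p = frechet_derivative f (at p) (axis 1 1) $ 1 * frechet_derivative f (at p) (axis 2 1) $ 2 -
    frechet_derivative f (at p) (axis 2 1) $ 1 * frechet_derivative f (at p) (axis 1 1) $ 2"
  by (simp add: jac_def jacobian_def det_matrix2)

lemma jac_det_matrix: "jac f p = det (matrix (frechet_derivative f (at p)))"
  by (simp add: jac_def jacobian_def)

lemma critical_set_jac: "critical_set F = {p. jac F p = 0}"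
  by (simp add: critical_set_def jac_def invertible_det_nz)

lemma jac_has_derivative:
  fixes f :: "real^2 \<Rightarrow> real^2"
  defines "D1 \<equiv> (\<lambda>x. frechet_derivative f (at x) (axis 1 1))" and "D2 \<equiv> (\<lambda>x. frechet_derivative f (at x) (axis 2 1))"
  assumes "smooth_on U f" "x \<in> U"
  shows "(jac f has_derivative (\<lambda>v.
      D1 x $ 1 * frechet_derivative D2 (at x) v $ 2 + frechet_derivative D1 (at x) v $ 1 * D2 x $ 2 -
      (D2 x $ 1 * frechet_derivative D1 (at x) v $ 2 + frechet_derivative D2 (at x) v $ 1 * D1 x $ 2))) (at x)"
proof -
  have "(D1 has_derivative frechet_derivative D1 (at x)) (at x)"
    "(D2 has_derivative frechet_derivative D2 (at x)) (at x)"
    unfolding D1_def D2_def by (rule smooth_on_has_derivative [OF smooth_on_deriv [OF assms(3)] assms(4)])+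
  moreover have "jac f = (\<lambda>x. D1 x $ 1 * D2 x $ 2 - D2 x $ 1 * D1 x $ 2)"
    by (simp add: fun_eq_iff jac_eq D1_def D2_def)
  ultimately show ?thesis
    by (auto intro!: derivative_eq_intros)
qed

lemma jac_differentiable:
  assumes "smooth_on U f" "x \<in> U"
  shows "(jac f has_derivative frechet_derivative (jac f) (at x)) (at x)"
  by (rule iffD1 [OF frechet_derivative_works differentiableI [OF jac_has_derivative [OF assms]]])

lemma continuous_on_jac_deriv:
  assumes "smooth_on U f"
  shows "continuous_on U (\<lambda>x. frechet_derivative (jac f) (at x) v)"
proof (rule continuous_on_eq)
  let ?D1 = "\<lambda>x. frechet_derivative f (at x) (axis 1 1)" and ?D2 = "\<lambda>x. frechet_derivative f (at x) (axis 2 1)"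
  show "continuous_on U (\<lambda>x. 
      ?D1 x $ 1 * frechet_derivative ?D2 (at x) v $ 2 + frechet_derivative ?D1 (at x) v $ 1 * ?D2 x $ 2 -
      (?D2 x $ 1 * frechet_derivative ?D1 (at x) v $ 2 + frechet_derivative ?D2 (at x) v $ 1 * ?D1 x $ 2))"
    by (intro continuous_intros smooth_on_continuous smooth_on_deriv assms)
qed (simp add: frechet_derivative_at [OF jac_has_derivative [OF assms], symmetric])

lemma frechet_derivative_nonzero:
  assumes "smooth_on U f" "p \<in> U" "jac f p \<noteq> 0" "v \<noteq> 0"
  shows "frechet_derivative f (at p) v \<noteq> 0"
proof
  assume z: "frechet_derivative f (at p) v = 0"
  have "linear (frechet_derivative f (at p))"
    using smooth_on_has_derivative [OF assms(1,2)] has_derivative_linear by blast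
  then have "matrix (frechet_derivative f (at p)) *v v = 0"
    using z fun_cong [OF matrix_vector_mul(2), of "frechet_derivative f (at p)" v] by simp
  moreover have "invertible (matrix (frechet_derivative f (at p)))"
    using assms(3) by (simp add: invertible_det_nz jac_det_matrix)
  ultimately show False
    using assms(4) by (metis inj_matrix_vector_mult matrix_vector_mult_0_right injD)
qed

lemma smooth_inverse_derivative:
  assumes "open U" "smooth_on U f" "smooth_on V g" "homeomorphism U V f g" "x \<in> U"
  shows "frechet_derivative g (at (f x)) (frechet_derivative f (at x) v) = v"
proof -
  have "f x \<in> V" using assms(4,5) by (auto simp: homeomorphism_def)
  have "((\<lambda>y. g (f y)) has_derivative (\<lambda>v. frechet_derivative g (at (f x)) (frechet_derivative f (at x) v))) (at x)"
    by (rule has_derivative_compose [OF smooth_on_has_derivative [OF assms(2,5)] smooth_on_has_derivative [OF assms(3) \<open>f x \<in> V\<close>]])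
  moreover have "((\<lambda>y. g (f y)) has_derivative (\<lambda>v. v)) (at x)"
    by (rule has_derivative_transform_within_open [OF has_derivative_ident assms(1,5)])
      (use assms(4) in \<open>auto simp: homeomorphism_def\<close>)
  ultimately show ?thesis by (metis has_derivative_unique)
qed

lemma det_matrix_compose3:
  fixes a b c :: "real^2 \<Rightarrow> real^2"
  assumes "linear a" "linear b" "linear c"
  shows "det (matrix (\<lambda>v. a (b (c v)))) = det (matrix a) * det (matrix b) * det (matrix c)"
proof -
  have "(\<lambda>v. a (b (c v))) = a \<circ> (b \<circ> c)" by (simp add: o_def)
  then show ?thesis
    using assms by (simp add: matrix_compose linear_compose det_mul mult.assoc)
qed

lemma jac_nonzero:
  fixes f :: "real^2 \<Rightarrow> real^2"
  assumes "open U" "smooth_on U f" "smooth_on V g" "homeomorphism U V f g" "x \<in> U"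
  shows "jac f x \<noteq> 0"
proof -
  have "f x \<in> V" using assms(4,5) by (auto simp: homeomorphism_def)
  have "frechet_derivative g (at (f x)) \<circ> frechet_derivative f (at x) = id"
    using smooth_inverse_derivative [OF assms] by auto
  moreover have "linear (frechet_derivative f (at x))" "linear (frechet_derivative g (at (f x)))"
    using smooth_on_has_derivative [OF assms(2,5)] smooth_on_has_derivative [OF assms(3) \<open>f x \<in> V\<close>]
      has_derivative_linear by blast+
  ultimately have "matrix (frechet_derivative g (at (f x))) ** matrix (frechet_derivative f (at x)) = mat 1"
    using matrix_compose matrix_id_mat_1 by metis
  then have "jac g (f x) * jac f x = 1"
    unfolding jac_det_matrix by (metis det_mul det_I)
  then show ?thesis by auto
qed

text \<open>A normal form unpacked around \<open>q\<close>. The inverse \<open>g\<close> of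
  \<open>\<Psi>\<close> is explicit because points and vectors are carried back from the normal
  form; of \<open>\<Phi>\<close> only injectivity and a nonvanishing Jacobian are kept.\<close>

locale local_form =
  fixes F \<Psi> \<Phi> g N :: "real^2 \<Rightarrow> real^2" and N' :: "real^2 \<Rightarrow> real^2 \<Rightarrow> real^2" and U V W :: "(real^2) set"
    and q :: "real^2"
  assumes smooth: "smooth_on UNIV F" "smooth_on U \<Psi>" "smooth_on V g" "smooth_on W \<Phi>"
    and opens: "open U" "open V" "open W" and hom: "homeomorphism U V \<Psi> g"
    and q: "q \<in> U" "\<Psi> q = 0"
    and \<Phi>: "inj_on \<Phi> W" "\<And>w. w \<in> W \<Longrightarrow> jac \<Phi> w \<noteq> 0"
    and NV: "N ` V \<subseteq> W" and F_eq: "\<And>p. p \<in> U \<Longrightarrow> F p = \<Phi> (N (\<Psi> p))"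
    and N: "\<And>x. (N has_derivative N' x) (at x)"
begin

abbreviation "\<kappa> x \<equiv> det (matrix (N' x))"
abbreviation "D\<Psi> p \<equiv> frechet_derivative \<Psi> (at p)"
abbreviation "D\<Phi> p \<equiv> frechet_derivative \<Phi> (at p)"
abbreviation "DF p \<equiv> frechet_derivative F (at p)"

text \<open>The nonvanishing factor that relates the Jacobian of \<open>F\<close> to that of the
  normal form.\<close>

definition u where "u p = jac \<Phi> (N (\<Psi> p)) * jac \<Psi> p"

lemma \<Psi>V: "p \<in> U \<Longrightarrow> \<Psi> p \<in> V" and N\<Psi>W: "p \<in> U \<Longrightarrow> N (\<Psi> p) \<in> W" and g\<Psi>: "p \<in> U \<Longrightarrow> g (\<Psi> p) = p"
  and gU: "x \<in> V \<Longrightarrow> g x \<in> U" and \<Psi>g: "x \<in> V \<Longrightarrow> \<Psi> (g x) = x"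
  using hom NV by (auto simp: homeomorphism_def)

lemma D\<Psi>: "p \<in> U \<Longrightarrow> (\<Psi> has_derivative D\<Psi> p) (at p)"
  by (rule smooth_on_has_derivative [OF smooth(2)])

lemma D\<Phi>: "w \<in> W \<Longrightarrow> (\<Phi> has_derivative D\<Phi> w) (at w)"
  by (rule smooth_on_has_derivative [OF smooth(4)])

lemma lin: "p \<in> U \<Longrightarrow> linear (D\<Psi> p)" "w \<in> W \<Longrightarrow> linear (D\<Phi> w)" "linear (N' x)"
  using D\<Psi> D\<Phi> N has_derivative_linear by blast+

lemma N\<Psi>: "p \<in> U \<Longrightarrow> ((\<lambda>p. N (\<Psi> p)) has_derivative (\<lambda>v. N' (\<Psi> p) (D\<Psi> p v))) (at p)"
  by (rule has_derivative_compose [OF D\<Psi> N])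

lemma DF_eq:
  assumes "p \<in> U" shows "DF p = (\<lambda>v. D\<Phi> (N (\<Psi> p)) (N' (\<Psi> p) (D\<Psi> p v)))"
proof -
  have "((\<lambda>p. \<Phi> (N (\<Psi> p))) has_derivative (\<lambda>v. D\<Phi> (N (\<Psi> p)) (N' (\<Psi> p) (D\<Psi> p v)))) (at p)"
    by (rule has_derivative_compose [OF N\<Psi> D\<Phi>]) (use assms N\<Psi>W in auto)
  then have "(F has_derivative (\<lambda>v. D\<Phi> (N (\<Psi> p)) (N' (\<Psi> p) (D\<Psi> p v)))) (at p)"
    by (rule has_derivative_transform_within_open [OF _ opens(1) assms]) (simp add: F_eq)
  then show ?thesis using frechet_derivative_at by metis
qed

lemma jac_F: "p \<in> U \<Longrightarrow> jac F p = u p * \<kappa> (\<Psi> p)"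
  by (simp add: jac_det_matrix [of F] DF_eq det_matrix_compose3 lin N\<Psi>W u_def jac_det_matrix)

lemma u_nonzero: "p \<in> U \<Longrightarrow> u p \<noteq> 0"
  using \<Phi>(2) [OF N\<Psi>W] jac_nonzero [OF opens(1) smooth(2,3) hom] by (simp add: u_def)

lemma u_differentiable:
  assumes "p \<in> U" obtains u' where "(u has_derivative u') (at p)"
proof -
  have "((\<lambda>p. jac \<Phi> (N (\<Psi> p))) has_derivative (\<lambda>v. frechet_derivative (jac \<Phi>) (at (N (\<Psi> p))) (N' (\<Psi> p) (D\<Psi> p v)))) (at p)"
    by (rule has_derivative_compose [OF N\<Psi> [OF assms] jac_differentiable [OF smooth(4) N\<Psi>W [OF assms]]])
  from has_derivative_mult [OF this jac_differentiable [OF smooth(2) assms]]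
  show ?thesis using that unfolding u_def [abs_def] by blast
qed

text \<open>At a zero of the Jacobian of the normal form the product rule loses the term with the
  derivative of \<open>u\<close>, so that derivative never has to be computed.\<close>

lemma jac_deriv:
  assumes p: "p \<in> U" and "\<kappa> (\<Psi> p) = 0" and \<kappa>': "(\<kappa> has_derivative \<kappa>') (at (\<Psi> p))"
  shows "frechet_derivative (jac F) (at p) v = u p * \<kappa>' (D\<Psi> p v)"
proof -
  obtain u' where u': "(u has_derivative u') (at p)" using u_differentiable [OF p] by blast
  have "((\<lambda>p. \<kappa> (\<Psi> p)) has_derivative (\<lambda>v. \<kappa>' (D\<Psi> p v))) (at p)"
    by (rule has_derivative_compose [OF D\<Psi> [OF p] \<kappa>'])
  from has_derivative_mult [OF u' this]
  have "((\<lambda>p. u p * \<kappa> (\<Psi> p)) has_derivative (\<lambda>v. u p * \<kappa>' (D\<Psi> p v))) (at p)"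
    by (simp add: assms(2))
  then have "(jac F has_derivative (\<lambda>v. u p * \<kappa>' (D\<Psi> p v))) (at p)"
    by (rule has_derivative_transform_within_open [OF _ opens(1) p]) (simp add: jac_F)
  then show ?thesis using frechet_derivative_at by metis
qed

lemma D\<Psi>_inverse: "p \<in> U \<Longrightarrow> frechet_derivative g (at (\<Psi> p)) (D\<Psi> p v) = v"
  by (rule smooth_inverse_derivative [OF opens(1) smooth(2,3) hom])

lemma D\<Psi>_inverse': "p \<in> U \<Longrightarrow> D\<Psi> p (frechet_derivative g (at (\<Psi> p)) v) = v"
  using smooth_inverse_derivative [OF opens(2) smooth(3,2) homeomorphism_symD [OF hom] \<Psi>V, of p v] by (simp add: g\<Psi>)

lemma D\<Psi>_inj: "p \<in> U \<Longrightarrow> D\<Psi> p v = D\<Psi> p w \<Longrightarrow> v = w"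
  using D\<Psi>_inverse by metis

lemma D\<Phi>_zero: "w \<in> W \<Longrightarrow> D\<Phi> w v = 0 \<Longrightarrow> v = 0"
  using frechet_derivative_nonzero [OF smooth(4) _ \<Phi>(2)] by blast

end

lemma has_normal_form_local:
  assumes "smooth_on UNIV F" "has_normal_form F p N" and "\<And>x. (N has_derivative N' x) (at x)"
  obtains \<Psi> \<Phi> g U V W where "local_form F \<Psi> \<Phi> g N N' U V W p"
proof -
  obtain U V W Z \<Psi> \<Phi> where *: "diffeomorphism_between U V \<Psi>" "p \<in> U" "\<Psi> p = 0"
    "diffeomorphism_between W Z \<Phi>" "N ` V \<subseteq> W" "\<forall>q\<in>U. F q = \<Phi> (N (\<Psi> q))"
    using assms(2) unfolding has_normal_form_def by blast
  obtain g where g: "homeomorphism U V \<Psi> g" "smooth_on V g" "open U" "open V" "smooth_on U \<Psi>"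
    using *(1) unfolding diffeomorphism_between_def by blast
  obtain h where h: "homeomorphism W Z \<Phi> h" "smooth_on Z h" "open W" "smooth_on W \<Phi>"
    using *(4) unfolding diffeomorphism_between_def by blast
  have "inj_on \<Phi> W" using h(1) by (metis homeomorphism_apply1 inj_on_inverseI)
  moreover have "jac \<Phi> w \<noteq> 0" if "w \<in> W" for w
    by (rule jac_nonzero [OF h(3,4,2,1) that])
  ultimately have "local_form F \<Psi> \<Phi> g N N' U V W p"
    using assms(1,3) * g h by unfold_locales auto
  then show ?thesis by (rule that)
qed

section \<open>The fold and the cusp\<close>

definition fold_map :: "real^2 \<Rightarrow> real^2" where
  "fold_map v = vector [v$1, (v$2)^2]"

definition fold_deriv :: "real^2 \<Rightarrow> real^2 \<Rightarrow> real^2" where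
  "fold_deriv x v = vector [v$1, 2 * x$2 * v$2]"

definition cusp_map :: "real^2 \<Rightarrow> real^2" where
  "cusp_map v = vector [v$1, (v$2)^3 - v$1 * v$2]"

definition cusp_deriv :: "real^2 \<Rightarrow> real^2 \<Rightarrow> real^2" where
  "cusp_deriv x v = vector [v$1, (3 * (x$2)^2 - x$1) * v$2 - x$2 * v$1]"

lemma fold_map_has_derivative: "(fold_map has_derivative fold_deriv x) (at x)"
  unfolding fold_map_def [abs_def] fold_deriv_def [abs_def] vector2_eq
  by (auto intro!: derivative_eq_intros)

lemma cusp_map_has_derivative: "(cusp_map has_derivative cusp_deriv x) (at x)"
  unfolding cusp_map_def [abs_def] cusp_deriv_def [abs_def] vector2_eq
  by (auto intro!: derivative_eq_intros simp: fun_eq_iff algebra_simps power2_eq_square)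

lemma det_fold_deriv: "det (matrix (fold_deriv x)) = 2 * x$2"
  by (simp add: det_matrix2 fold_deriv_def axis_def)

lemma det_cusp_deriv: "det (matrix (cusp_deriv x)) = 3 * (x$2)^2 - x$1"
  by (simp add: det_matrix2 cusp_deriv_def axis_def)

text \<open>In the normal form the critical set is the axis \<open>y = 0\<close>, with tangent
  direction \<open>axis 1 1\<close>, and the kernel of the derivative there is spanned by
  \<open>axis 2 1\<close>. So the kernel is transverse to the critical curve, and the tangent
  survives \<open>DF\<close>.\<close>

lemma fold_local:
  fixes F :: "real^2 \<Rightarrow> real^2"
  assumes "smooth_on UNIV F" "fold_point F q"
  shows "\<exists>v. frechet_derivative (jac F) (at q) v \<noteq> 0"
    and "\<And>v. v \<noteq> 0 \<Longrightarrow> frechet_derivative (jac F) (at q) v = 0 \<Longrightarrow> frechet_derivative F (at q) v \<noteq> 0"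
proof -
  have "has_normal_form F q fold_map"
    using assms(2) unfolding fold_point_def fold_map_def [abs_def] by blast
  then obtain \<Psi> \<Phi> g U V W where "local_form F \<Psi> \<Phi> g fold_map fold_deriv U V W q"
    using has_normal_form_local [OF assms(1) _ fold_map_has_derivative] by blast
  then interpret local_form F \<Psi> \<Phi> g fold_map fold_deriv U V W q .
  have \<kappa>': "(\<kappa> has_derivative (\<lambda>v. 2 * v$2)) (at x)" for x
    unfolding det_fold_deriv by (auto intro!: derivative_eq_intros)
  have jd: "frechet_derivative (jac F) (at q) v = u q * (2 * D\<Psi> q v $ 2)" for v
    by (rule jac_deriv [OF q(1) _ \<kappa>']) (simp add: det_fold_deriv q)
  have "D\<Psi> q (frechet_derivative g (at (\<Psi> q)) (axis 2 1)) = axis 2 1"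
    by (rule D\<Psi>_inverse' [OF q(1)])
  then have "frechet_derivative (jac F) (at q) (frechet_derivative g (at (\<Psi> q)) (axis 2 1)) \<noteq> 0"
    using jd u_nonzero [OF q(1)] by simp
  then show "\<exists>v. frechet_derivative (jac F) (at q) v \<noteq> 0" by blast
  fix v assume v: "v \<noteq> 0" "frechet_derivative (jac F) (at q) v = 0"
  then have w2: "D\<Psi> q v $ 2 = 0" using jd u_nonzero [OF q(1)] by simp
  have "D\<Psi> q v \<noteq> 0" using D\<Psi>_inj [OF q(1), of v 0] v lin(1) [OF q(1)] by (auto simp: linear_0)
  then have "fold_deriv (\<Psi> q) (D\<Psi> q v) \<noteq> 0"
    using w2 by (simp add: fold_deriv_def vec_eq_iff forall_2)
  then show "DF q v \<noteq> 0"
    unfolding DF_eq [OF q(1)] using D\<Phi>_zero [OF N\<Psi>W [OF q(1)]] by blast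
qed

text \<open>In the normal form the critical set \<open>x = 3 y\<^sup>2\<close> has the tangent field \<open>(6 y, 1)\<close>, which the
  derivative of the cusp map sends to \<open>(6 y, - 3 y\<^sup>2 - x)\<close>, a map with a regular zero at \<open>0\<close>.\<close>

lemma cusp_local:
  fixes F :: "real^2 \<Rightarrow> real^2"
  assumes "smooth_on UNIV F" "cusp_point F q"
  obtains \<sigma> :: int and B Y L where "\<sigma> \<in> {1, -1}" "open B" "q \<in> B" "continuous_on B Y" "\<And>p. p \<in> B \<Longrightarrow> Y p \<noteq> 0"
    "\<And>p v. p \<in> B \<Longrightarrow> jac F p = 0 \<Longrightarrow> frechet_derivative (jac F) (at p) v = 0 \<Longrightarrow> \<exists>c. v = c *\<^sub>R Y p"
    "\<exists>v. frechet_derivative (jac F) (at q) v \<noteq> 0"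
    "\<And>p. p \<in> B - {q} \<Longrightarrow> frechet_derivative F (at p) (Y p) \<noteq> 0" "frechet_derivative F (at q) (Y q) = 0"
    "((\<lambda>p. frechet_derivative F (at p) (Y p)) has_derivative L) (at q)" "sgn (det (matrix L)) = \<sigma>"
    "effective_on F q {p. of_int \<sigma> * jac F p > 0}"
    "\<And>S N. effective_on F q S \<Longrightarrow> open N \<Longrightarrow> q \<in> N \<Longrightarrow> \<exists>p \<in> S \<inter> N. of_int \<sigma> * jac F p > 0"
proof -
  have "has_normal_form F q cusp_map"
    using assms(2) unfolding cusp_point_def cusp_map_def [abs_def] by blast
  then obtain \<Psi> \<Phi> g U V W where "local_form F \<Psi> \<Phi> g cusp_map cusp_deriv U V W q"
    using has_normal_form_local [OF assms(1) _ cusp_map_has_derivative] by blast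
  then interpret local_form F \<Psi> \<Phi> g cusp_map cusp_deriv U V W q .
  have \<kappa>': "(\<kappa> has_derivative (\<lambda>v. 6 * x$2 * v$2 - v$1)) (at x)" for x
    unfolding det_cusp_deriv by (auto intro!: derivative_eq_intros)
  have jac_eq: "jac F p = u p * (3 * (\<Psi> p $ 2)^2 - \<Psi> p $ 1)" if "p \<in> U" for p
    using jac_F [OF that] by (simp add: det_cusp_deriv)
  have jd: "frechet_derivative (jac F) (at p) v = u p * (6 * \<Psi> p $ 2 * D\<Psi> p v $ 2 - D\<Psi> p v $ 1)"
    if "p \<in> U" "jac F p = 0" for p v
    by (rule jac_deriv [OF that(1) _ \<kappa>']) (use that u_nonzero jac_F in auto)
  have jq: "jac F q = 0" by (simp add: jac_eq q)
  \<comment> \<open>The sign of \<open>u q\<close> is both the index of the zero and the sign of the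
    Jacobian where \<open>3 y^2 - x > 0\<close>; on \<open>U1\<close> the sign of \<open>u\<close>
    is constant.\<close>
  define \<sigma> :: int where "\<sigma> = (if u q > 0 then 1 else -1)"
  have uq: "u q \<noteq> 0" by (rule u_nonzero [OF q(1)])
  have \<sigma>: "sgn (u q) = of_int \<sigma>" using uq by (auto simp: \<sigma>_def)
  obtain U1 where U1: "open U1" "q \<in> U1" "U1 \<subseteq> U" "\<And>p. p \<in> U1 \<Longrightarrow> of_int \<sigma> * u p > 0"
  proof -
    have "continuous_on U (\<lambda>p. of_int \<sigma> * u p)"
      by (intro continuous_intros continuous_at_imp_continuous_on ballI)
        (metis u_differentiable has_derivative_continuous)
    then have "open (U \<inter> (\<lambda>p. of_int \<sigma> * u p) -` {0<..})"
      by (rule continuous_open_preimage [OF _ opens(1)]) simp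
    moreover have "of_int \<sigma> * u q > 0" using uq by (auto simp: \<sigma>_def)
    ultimately show ?thesis
      using that [of "U \<inter> (\<lambda>p. of_int \<sigma> * u p) -` {0<..}"] q(1) by auto
  qed
  let ?Dg = "\<lambda>p. frechet_derivative g (at (\<Psi> p))"
  let ?t = "\<lambda>p. vector [6 * \<Psi> p $ 2, 1] :: real^2"
  define Y where "Y p = ?Dg p (?t p)" for p
  have DY: "D\<Psi> p (Y p) = ?t p" if "p \<in> U" for p
    unfolding Y_def by (rule D\<Psi>_inverse' [OF that])
  have cont\<Psi>: "continuous_on U \<Psi>" by (rule smooth_on_continuous [OF smooth(2)])
  have contY: "continuous_on U Y"
  proof (rule continuous_on_eq)
    show "continuous_on U (\<lambda>p. (6 * \<Psi> p $ 2) *\<^sub>R ?Dg p (axis 1 1) + 1 *\<^sub>R ?Dg p (axis 2 1))"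
      by (intro continuous_intros cont\<Psi> continuous_on_compose2 [OF smooth_on_continuous [OF smooth_on_deriv [OF smooth(3)]] cont\<Psi>])
        (use \<Psi>V in auto)
    fix p assume "p \<in> U"
    then have "linear (?Dg p)"
      using smooth_on_has_derivative [OF smooth(3) \<Psi>V] has_derivative_linear by blast
    then show "(6 * \<Psi> p $ 2) *\<^sub>R ?Dg p (axis 1 1) + 1 *\<^sub>R ?Dg p (axis 2 1) = Y p"
      unfolding Y_def by (subst linear_axis2 [of "?Dg p"]) auto
  qed
  have Y0: "Y p \<noteq> 0" if "p \<in> U" for p
  proof
    assume "Y p = 0"
    then have "?t p = 0" using DY [OF that] lin(1) [OF that] by (simp add: linear_0)
    then show False by (simp add: vec_eq_iff forall_2)
  qed
  \<comment> \<open>The image of the tangent \<open>(6 y, 1)\<close> under the derivative of the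
    cusp map: the second component is \<open>(3 y^2 - x) - 6 y^2\<close>.\<close>
  define h where "h x = (vector [6 * x$2, - 3 * (x$2)^2 - x$1] :: real^2)" for x :: "real^2"
  have DFY: "DF p (Y p) = D\<Phi> (cusp_map (\<Psi> p)) (h (\<Psi> p))" if "p \<in> U" for p
    unfolding DF_eq [OF that] DY [OF that]
    by (rule arg_cong [of _ _ "D\<Phi> (cusp_map (\<Psi> p))"])
      (simp add: cusp_deriv_def h_def vec_eq_iff forall_2 power2_eq_square algebra_simps)
  have h0: "h x = 0 \<longleftrightarrow> x = 0" for x
    by (auto simp: h_def vec_eq_iff forall_2)
  have \<Psi>0: "\<Psi> p = 0 \<longleftrightarrow> p = q" if "p \<in> U" for p
    using g\<Psi> [OF that] g\<Psi> [OF q(1)] q(2) by metis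
  let ?h' = "\<lambda>v::real^2. vector [6 * v$2, - v$1] :: real^2"
  define L where "L v = D\<Phi> (cusp_map 0) (?h' (D\<Psi> q v))" for v
  have W0: "cusp_map 0 \<in> W" using N\<Psi>W [OF q(1)] q(2) by simp
  have L: "((\<lambda>p. DF p (Y p)) has_derivative L) (at q)"
  proof -
    let ?A = "\<lambda>e p. D\<Phi> (cusp_map (\<Psi> p)) e"
    \<comment> \<open>The derivative of the factor coming from \<open>\<Phi>\<close> only has to
      exist: in the product rule it is multiplied by the coefficients of \<open>h\<close>, which
      vanish at \<open>q\<close>.\<close>
    have A: "\<exists>A'. (?A e has_derivative A') (at q)" for e
      using has_derivative_compose [OF N\<Psi> [OF q(1)] smooth_on_has_derivative [OF smooth_on_deriv [OF smooth(4)] N\<Psi>W [OF q(1)]]]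
      by blast
    obtain A1 A2 where A: "(?A (axis 1 1) has_derivative A1) (at q)" "(?A (axis 2 1) has_derivative A2) (at q)"
      using A by metis
    have "((\<lambda>p. (6 * \<Psi> p $ 2) *\<^sub>R ?A (axis 1 1) p + (- 3 * (\<Psi> p $ 2)^2 - \<Psi> p $ 1) *\<^sub>R ?A (axis 2 1) p) has_derivative
      (\<lambda>v. (6 * D\<Psi> q v $ 2) *\<^sub>R ?A (axis 1 1) q + (- D\<Psi> q v $ 1) *\<^sub>R ?A (axis 2 1) q)) (at q)"
      by (auto intro!: derivative_eq_intros A D\<Psi> q simp: q)
    moreover have "(\<lambda>v. (6 * D\<Psi> q v $ 2) *\<^sub>R ?A (axis 1 1) q + (- D\<Psi> q v $ 1) *\<^sub>R ?A (axis 2 1) q) = L"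
      unfolding L_def q(2) by (rule ext, subst (3) linear_axis2 [OF lin(2) [OF W0]]) simp
    ultimately have "((\<lambda>p. (6 * \<Psi> p $ 2) *\<^sub>R ?A (axis 1 1) p + (- 3 * (\<Psi> p $ 2)^2 - \<Psi> p $ 1) *\<^sub>R ?A (axis 2 1) p) has_derivative L) (at q)"
      by simp
    then show ?thesis
    proof (rule has_derivative_transform_within_open [OF _ opens(1) q(1)])
      fix p assume p: "p \<in> U"
      show "(6 * \<Psi> p $ 2) *\<^sub>R ?A (axis 1 1) p + (- 3 * (\<Psi> p $ 2)^2 - \<Psi> p $ 1) *\<^sub>R ?A (axis 2 1) p = DF p (Y p)"
        unfolding DFY [OF p] by (subst (3) linear_axis2 [OF lin(2) [OF N\<Psi>W [OF p]]]) (simp add: h_def)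
    qed
  qed
  have detL: "sgn (det (matrix L)) = \<sigma>"
  proof -
    have "linear ?h'"
      by (rule linearI) (auto simp: vec_eq_iff forall_2 algebra_simps)
    moreover have "det (matrix ?h') = 6" by (simp add: det_matrix2 axis_def)
    ultimately have "det (matrix L) = 6 * u q"
      unfolding L_def [abs_def] by (subst det_matrix_compose3 [OF lin(2) [OF W0] _ lin(1) [OF q(1)]])
        (simp_all add: u_def q(2) jac_det_matrix)
    then show ?thesis using \<sigma> by (simp add: sgn_mult)
  qed
  have crit: "p \<in> critical_set F \<longleftrightarrow> \<Psi> p $ 1 = 3 * (\<Psi> p $ 2)^2" if "p \<in> U" for p
    using jac_eq [OF that] u_nonzero [OF that] by (auto simp: critical_set_jac)
  have sgnjac: "of_int \<sigma> * jac F p > 0 \<longleftrightarrow> 3 * (\<Psi> p $ 2)^2 - \<Psi> p $ 1 > 0" if "p \<in> U1" for p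
  proof -
    have "of_int \<sigma> * jac F p = (of_int \<sigma> * u p) * (3 * (\<Psi> p $ 2)^2 - \<Psi> p $ 1)"
      using jac_eq U1(3) that by (simp add: subset_iff)
    then show ?thesis
      using U1(4) [OF that] zero_less_mult_iff by (metis less_asym)
  qed
  have eff: "effective_on F q {p. of_int \<sigma> * jac F p > 0}"
    unfolding effective_on_def
  proof (intro exI [of _ U1] conjI U1 subsetI)
    fix p assume "p \<in> {p \<in> U1. F p \<in> F ` (critical_set F \<inter> U1)} - critical_set F"
    then obtain p' where p: "p \<in> U1" "p \<notin> critical_set F" "p' \<in> critical_set F" "p' \<in> U1" "F p = F p'" by auto
    then have U: "p \<in> U" "p' \<in> U" using U1(3) by auto
    have "cusp_map (\<Psi> p) = cusp_map (\<Psi> p')"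
      using p(5) \<Phi>(1) N\<Psi>W U by (simp add: F_eq inj_on_def)
    then have e: "\<Psi> p $ 1 = \<Psi> p' $ 1" "(\<Psi> p $ 2)^3 - \<Psi> p $ 1 * \<Psi> p $ 2 = (\<Psi> p' $ 2)^3 - \<Psi> p' $ 1 * \<Psi> p' $ 2"
      by (auto simp: cusp_map_def vec_eq_iff forall_2)
    define t y where "t = \<Psi> p' $ 2" and "y = \<Psi> p $ 2"
    have x: "\<Psi> p $ 1 = 3 * t^2" using e(1) p(3) crit [OF U(2)] by (simp add: t_def)
    have x': "\<Psi> p' $ 1 = 3 * t^2" using p(3) crit [OF U(2)] by (simp add: t_def)
    have e2: "y^3 - 3 * t^2 * y = t^3 - 3 * t^2 * t"
      using e(2) unfolding x x' t_def [symmetric] y_def [symmetric] .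
    \<comment> \<open>At a critical point the cubic has the double root \<open>t\<close>, so the
      only other preimage on the same vertical line is \<open>y = - 2 * t\<close>, where
      \<open>3 y^2 - x = 9 t^2\<close>.\<close>
    have "(y - t) * (y - t) * (y + 2 * t) = (y^3 - 3 * t^2 * y) - (t^3 - 3 * t^2 * t)"
      by (simp add: power2_eq_square power3_eq_cube algebra_simps)
    then have "(y - t) * (y - t) * (y + 2 * t) = 0" unfolding e2 by simp
    moreover have yt: "y \<noteq> t"
    proof
      assume "y = t"
      then have "\<Psi> p $ 1 = 3 * (\<Psi> p $ 2)^2" using x by (simp add: y_def)
      then show False using p(2) crit [OF U(1)] by blast
    qed
    ultimately have y2: "y = - 2 * t" by auto
    then have "t \<noteq> 0" using yt by auto
    then have "3 * y^2 - 3 * t^2 > 0" by (simp add: y2 power_mult_distrib)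
    then show "p \<in> {p. of_int \<sigma> * jac F p > 0}"
      using sgnjac [OF p(1)] unfolding x [symmetric] y_def by simp
  qed
  \<comment> \<open>The nontrivial preimage accumulates at \<open>q\<close>, so any set on which
    \<open>q\<close> is effective contains points of sign \<open>\<sigma>\<close> near
    \<open>q\<close>. This later rules out the wrong side of \<open>\<Gamma>\<close>.\<close>
  have noneff: "\<exists>p \<in> S \<inter> N. of_int \<sigma> * jac F p > 0" if S: "effective_on F q S" and N: "open N" "q \<in> N" for S N
  proof -
    obtain U0 where U0: "open U0" "q \<in> U0" "{p \<in> U0. F p \<in> F ` (critical_set F \<inter> U0)} - critical_set F \<subseteq> S"
      using S unfolding effective_on_def by blast
    let ?O = "U0 \<inter> N \<inter> U1"
    have "continuous_on V g" by (rule smooth_on_continuous [OF smooth(3)])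
    then have "open (V \<inter> g -` ?O)"
      by (rule continuous_open_preimage [OF _ opens(2)]) (use U0 N U1 in auto)
    moreover have "0 \<in> V \<inter> g -` ?O"
      using \<Psi>V [OF q(1)] g\<Psi> [OF q(1)] q(2) U0 N U1 by auto
    ultimately obtain e where e: "e > 0" "ball 0 e \<subseteq> V \<inter> g -` ?O"
      by (rule openE)
    \<comment> \<open>Since \<open>t <= 1/2\<close>, both points below have norm at most
      \<open>3 t^2 + 2 t <= 7/2 * t\<close>, which is less than \<open>e\<close>.\<close>
    define t where "t = min (1/2) (e / 8)"
    have t: "0 < t" "t \<le> 1/2" "t \<le> e / 8" using e by (auto simp: t_def)
    have t2: "t^2 \<le> t / 2" using t by (simp add: power2_eq_square)
    \<comment> \<open>\<open>?a\<close> is critical for the normal form, and \<open>?b\<close> is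
      the second preimage of its image.\<close>
    let ?a = "vector [3 * t^2, t] :: real^2" and ?b = "vector [3 * t^2, - 2 * t] :: real^2"
    have nrm: "norm (vector [x, y] :: real^2) \<le> \<bar>x\<bar> + \<bar>y\<bar>" for x y
      using norm_le_l1_cart [of "vector [x, y] :: real^2"] by (simp add: sum_2)
    have "norm ?a < e" "norm ?b < e"
      using nrm [of "3 * t^2" t] nrm [of "3 * t^2" "- 2 * t"] t t2 by auto
    then have ab: "?a \<in> V" "g ?a \<in> ?O" "?b \<in> V" "g ?b \<in> ?O" using e(2) by (auto simp: subset_iff)
    have U: "g ?a \<in> U" "g ?b \<in> U" using gU ab by auto
    have "g ?a \<in> critical_set F \<inter> U0" using crit [OF U(1)] \<Psi>g [OF ab(1)] ab(2) by simp
    moreover have "F (g ?b) = F (g ?a)"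
      using U ab by (simp add: F_eq \<Psi>g cusp_map_def power2_eq_square power3_eq_cube)
    ultimately have "F (g ?b) \<in> F ` (critical_set F \<inter> U0)" by (rule rev_image_eqI)
    moreover have pos: "3 * (\<Psi> (g ?b) $ 2)^2 - \<Psi> (g ?b) $ 1 > 0"
      unfolding \<Psi>g [OF ab(3)] using t(1) by (simp add: power_mult_distrib)
    moreover have "g ?b \<notin> critical_set F" using crit [OF U(2)] pos by auto
    ultimately have "g ?b \<in> {p \<in> U0. F p \<in> F ` (critical_set F \<inter> U0)} - critical_set F"
      using ab(4) by simp
    then have "g ?b \<in> S" using U0(3) by (rule subsetD [rotated])
    then show ?thesis using sgnjac [of "g ?b"] pos ab by auto
  qed
  show ?thesis
  proof (rule that [of \<sigma> U Y L])
    show "\<sigma> \<in> {1, -1}" by (simp add: \<sigma>_def)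
    show "\<exists>c. v = c *\<^sub>R Y p" if p: "p \<in> U" "jac F p = 0" "frechet_derivative (jac F) (at p) v = 0" for p v
    proof
      \<comment> \<open>The differential of \<open>3 y^2 - x\<close> has a one-dimensional kernel,
        spanned by \<open>(6 y, 1)\<close>, which is the image of \<open>Y p\<close>.\<close>
      have "D\<Psi> p v $ 1 = 6 * \<Psi> p $ 2 * D\<Psi> p v $ 2"
        using jd [OF p(1,2), of v] p(3) u_nonzero [OF p(1)] by simp
      then have "D\<Psi> p v = (D\<Psi> p v $ 2) *\<^sub>R D\<Psi> p (Y p)"
        unfolding DY [OF p(1)] by (simp add: vec_eq_iff forall_2)
      then have "D\<Psi> p v = D\<Psi> p ((D\<Psi> p v $ 2) *\<^sub>R Y p)"
        using linear_cmul [OF lin(1) [OF p(1)], of "D\<Psi> p v $ 2" "Y p"] by simp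
      then show "v = (D\<Psi> p v $ 2) *\<^sub>R Y p" by (rule D\<Psi>_inj [OF p(1)])
    qed
    have "frechet_derivative (jac F) (at q) (?Dg q (axis 1 1)) \<noteq> 0"
      using jd [OF q(1) jq] D\<Psi>_inverse' [OF q(1)] uq by (simp add: q)
    then show "\<exists>v. frechet_derivative (jac F) (at q) v \<noteq> 0" by blast
    show "DF p (Y p) \<noteq> 0" if "p \<in> U - {q}" for p
    proof -
      have p: "p \<in> U" "p \<noteq> q" using that by auto
      then have "h (\<Psi> p) \<noteq> 0" using h0 \<Psi>0 by simp
      then show ?thesis using DFY [OF p(1)] D\<Phi>_zero [OF N\<Psi>W [OF p(1)]] by auto
    qed
    have "h 0 = 0" using h0 by blast
    then show "DF q (Y q) = 0"
      using DFY [OF q(1)] q(2) lin(2) [OF W0] by (simp add: linear_0)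
  qed (fact opens(1) q(1) contY Y0 L detL eff noneff)+
qed

section \<open>From the plane to the complex numbers\<close>

definition vec_of_complex :: "complex \<Rightarrow> real^2" where
  "vec_of_complex z = vector [Re z, Im z]"

lemma to_complex_inverse [simp]: "to_complex (vec_of_complex z) = z"
  by (simp add: to_complex_def vec_of_complex_def)

lemma vec_of_complex_inverse [simp]: "vec_of_complex (to_complex v) = v"
  by (simp add: to_complex_def vec_of_complex_def vec_eq_iff forall_2)

lemma to_complex_sel [simp]: "Re (to_complex v) = v$1" "Im (to_complex v) = v$2"
  by (simp_all add: to_complex_def)

lemma vec_of_complex_nth [simp]: "vec_of_complex z $ 1 = Re z" "vec_of_complex z $ 2 = Im z"
  by (simp_all add: vec_of_complex_def)

lemma vec_of_complex_axis: "vec_of_complex 1 = axis 1 1" "vec_of_complex \<i> = axis 2 1"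
  by (simp_all add: vec_eq_iff forall_2 axis_def)

lemma bounded_linear_to_complex: "bounded_linear to_complex"
proof -
  have "linear to_complex" by (rule linearI) (auto simp: complex_eq_iff)
  then show ?thesis by (simp add: linear_conv_bounded_linear)
qed

lemma bounded_linear_vec_of_complex: "bounded_linear vec_of_complex"
proof -
  have "linear vec_of_complex" by (rule linearI) (auto simp: vec_eq_iff forall_2)
  then show ?thesis by (simp add: linear_conv_bounded_linear)
qed

lemmas linear_to_complex = bounded_linear.linear [OF bounded_linear_to_complex]
lemmas linear_vec_of_complex = bounded_linear.linear [OF bounded_linear_vec_of_complex]
lemmas cont_to_complex = bounded_linear.continuous_on [OF bounded_linear_to_complex]
lemmas cont_vec_of_complex = bounded_linear.continuous_on [OF bounded_linear_vec_of_complex]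

lemma to_complex_scaleR: "to_complex (c *\<^sub>R v) = c *\<^sub>R to_complex v"
  by (rule linear_cmul [OF linear_to_complex])

lemma to_complex_eq_0_iff [simp]: "to_complex v = 0 \<longleftrightarrow> v = 0"
  by (auto simp: complex_eq_iff vec_eq_iff forall_2)

lemma vec_of_complex_eq_0_iff [simp]: "vec_of_complex z = 0 \<longleftrightarrow> z = 0"
  by (auto simp: complex_eq_iff vec_eq_iff forall_2)

lemma inj_to_complex: "inj_on to_complex S"
  by (rule inj_on_inverseI [of _ vec_of_complex]) simp

lemma to_complex_image_eq: "to_complex ` S = vec_of_complex -` S"
proof
  show "vec_of_complex -` S \<subseteq> to_complex ` S"
    by (metis image_eqI subsetI to_complex_inverse vimageE)
qed auto

lemma to_complex_image_eqI:
  assumes "\<And>x. to_complex x \<in> A \<longleftrightarrow> x \<in> B" shows "A = to_complex ` B"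
proof (rule set_eqI)
  fix z show "z \<in> A \<longleftrightarrow> z \<in> to_complex ` B"
    using assms [of "vec_of_complex z"] by (simp add: to_complex_image_eq)
qed

lemma to_complex_Compl: "- to_complex ` S = to_complex ` (- S)"
  unfolding to_complex_image_eq by auto

lemma frontier_to_complex: "frontier (to_complex ` A) = to_complex ` frontier A"
proof -
  have "bij to_complex"
    by (rule bij_betw_byWitness [of _ vec_of_complex]) auto
  then show ?thesis
    by (simp add: frontier_def closure_injective_linear_image [OF linear_to_complex inj_to_complex]
      interior_bijective_linear_image [OF linear_to_complex] image_set_diff [OF inj_to_complex])
qed

text \<open>Needed to transfer \<open>inside\<close> and \<open>outside\<close>, which are defined
  through components of the complement.\<close>

lemma connected_component_to_complex:
  "connected_component_set (to_complex ` S) (to_complex x) = to_complex ` connected_component_set S x"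
proof -
  have 1: "connected_component (to_complex ` S) (to_complex x) (to_complex y)"
    if cc: "connected_component S x y" for S x y
  proof -
    obtain T where T: "connected T" "T \<subseteq> S" "x \<in> T" "y \<in> T"
      using cc unfolding connected_component_def by blast
    have "connected (to_complex ` T)"
      by (intro connected_continuous_image T cont_to_complex continuous_on_id)
    then show ?thesis
      unfolding connected_component_def using T by (intro exI [of _ "to_complex ` T"]) auto
  qed
  have "connected_component S x (vec_of_complex w)"
    if cc: "connected_component (to_complex ` S) (to_complex x) w" for w
  proof -
    obtain T where T: "connected T" "T \<subseteq> to_complex ` S" "to_complex x \<in> T" "w \<in> T"
      using cc unfolding connected_component_def by blast
    have "connected (vec_of_complex ` T)"
      by (intro connected_continuous_image T cont_vec_of_complex continuous_on_id)
    moreover have "vec_of_complex ` T \<subseteq> S" using T(2) by auto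
    moreover have "x \<in> vec_of_complex ` T" "vec_of_complex w \<in> vec_of_complex ` T"
      using T(3,4) by (auto intro: rev_image_eqI)
    ultimately show ?thesis unfolding connected_component_def by blast
  qed
  then have "to_complex y \<in> connected_component_set (to_complex ` S) (to_complex x) \<longleftrightarrow> y \<in> connected_component_set S x" for y
    using 1 by (metis mem_Collect_eq vec_of_complex_inverse)
  then show ?thesis by (rule to_complex_image_eqI)
qed

lemma bounded_to_complex: "bounded (to_complex ` S) \<longleftrightarrow> bounded S"
proof
  assume "bounded (to_complex ` S)"
  then have "bounded (vec_of_complex ` to_complex ` S)"
    by (rule bounded_linear_image [OF _ bounded_linear_vec_of_complex])
  then show "bounded S" by (simp add: image_image)
qed (rule bounded_linear_image [OF _ bounded_linear_to_complex])

lemma inside_to_complex: "inside (to_complex ` S) = to_complex ` inside S"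
proof -
  have "to_complex x \<in> inside (to_complex ` S) \<longleftrightarrow> x \<in> inside S" for x
    unfolding inside_def
    by (simp add: to_complex_Compl connected_component_to_complex bounded_to_complex inj_image_mem_iff [OF inj_to_complex])
  then show ?thesis by (rule to_complex_image_eqI)
qed

lemma outside_to_complex: "outside (to_complex ` S) = to_complex ` outside S"
proof -
  have "to_complex x \<in> outside (to_complex ` S) \<longleftrightarrow> x \<in> outside S" for x
    unfolding outside_def
    by (simp add: to_complex_Compl connected_component_to_complex bounded_to_complex inj_image_mem_iff [OF inj_to_complex])
  then show ?thesis by (rule to_complex_image_eqI)
qed

section \<open>Parametrizations over the unit circle\<close>

lemma range_circ: "range circ = sphere 0 1"
proof -
  have "norm (circ t) = 1" for t
    by (simp add: circ_def norm_eq_sqrt_inner inner_vec_def sum_2)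
  moreover have "x \<in> range circ" if "norm x = 1" for x :: "real^2"
  proof -
    have "(x$1)\<^sup>2 + (x$2)\<^sup>2 = 1"
      using that by (simp add: norm_eq_sqrt_inner inner_vec_def sum_2 power2_eq_square)
    then obtain t where "0 \<le> t" "t < 2 * pi" "x$1 = cos t" "x$2 = sin t" by (rule sincos_total_2pi)
    then have "x = circ t" by (simp add: circ_def vec_eq_iff forall_2)
    then show ?thesis by blast
  qed
  ultimately show ?thesis by (metis (no_types, lifting) imageE mem_sphere_0 subsetI subset_antisym)
qed

lemma circ_eqD: "circ s = circ t \<Longrightarrow> \<exists>n::int. s = t + 2 * pi * of_int n"
  using sin_cos_eq_iff [of s t] by (simp add: circ_def vec_eq_iff forall_2)

definition loop_of :: "(real^2 \<Rightarrow> real^2) \<Rightarrow> real \<Rightarrow> complex" where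
  "loop_of c t = to_complex (c (circ (2 * pi * t)))"

text \<open>The factor \<open>2 * pi\<close> is the chain rule for the parameter interval
  \<open>{0..1}\<close>: this is the derivative of \<open>loop_of c\<close>.\<close>

definition velocity_of :: "(real^2 \<Rightarrow> real^2) \<Rightarrow> real \<Rightarrow> complex" where
  "velocity_of c t = to_complex ((2 * pi) *\<^sub>R vector_derivative (c \<circ> circ) (at (2 * pi * t)))"

lemma prc_curve_has_vector_derivative:
  assumes "prc_curve c"
  shows "((\<lambda>t. c (circ t)) has_vector_derivative vector_derivative (c \<circ> circ) (at t)) (at t)"
proof -
  have "(c \<circ> circ) differentiable (at t)"
    using assms by (simp add: prc_curve_def C1_differentiable_on_eq)
  then show ?thesis by (simp add: vector_derivative_works o_def)
qed

lemma regular_loop_of: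
  assumes "regular_parametrization c \<gamma>"
  shows "regular_loop (loop_of c) (velocity_of c)" "path_image (loop_of c) = to_complex ` \<gamma>"
proof -
  have c: "prc_curve c" "inj_on c (sphere 0 1)" "c ` sphere 0 1 = \<gamma>"
    using assms by (auto simp: regular_parametrization_def)
  have cont: "continuous_on UNIV (\<lambda>t. vector_derivative (c \<circ> circ) (at t))"
    using c(1) by (simp add: prc_curve_def C1_differentiable_on_eq)
  show R: "regular_loop (loop_of c) (velocity_of c)"
  proof
    fix t s :: real
    have "circ (2 * pi * (t + 1)) = circ (2 * pi * t)"
      by (simp add: circ_def distrib_left)
    then show "loop_of c (t + 1) = loop_of c t" by (simp add: loop_of_def)
    have "((\<lambda>t. 2 * pi * t) has_vector_derivative 2 * pi) (at t)"
      by (auto intro!: derivative_eq_intros simp: has_real_derivative_iff_has_vector_derivative [symmetric])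
    from vector_diff_chain_at [OF this prc_curve_has_vector_derivative [OF c(1)]]
    have "((\<lambda>t. c (circ (2 * pi * t))) has_vector_derivative
        (2 * pi) *\<^sub>R vector_derivative (c \<circ> circ) (at (2 * pi * t))) (at t)"
      by (simp add: o_def)
    from bounded_linear.has_vector_derivative [OF bounded_linear_to_complex this]
    show "(loop_of c has_vector_derivative velocity_of c t) (at t)"
      by (simp add: loop_of_def [abs_def] velocity_of_def)
    show "continuous_on UNIV (velocity_of c)"
      unfolding velocity_of_def [abs_def]
      by (intro cont_to_complex continuous_intros continuous_on_compose2 [OF cont]) auto
    show "velocity_of c t \<noteq> 0"
      using c(1) by (simp add: velocity_of_def prc_curve_def)
    assume "loop_of c s = loop_of c t"
    then have "c (circ (2 * pi * s)) = c (circ (2 * pi * t))"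
      unfolding loop_of_def by (metis vec_of_complex_inverse)
    moreover have "circ x \<in> sphere 0 1" for x using range_circ by blast
    ultimately have "circ (2 * pi * s) = circ (2 * pi * t)"
      using c(2) by (meson inj_onD)
    then obtain n :: int where "2 * pi * s = 2 * pi * t + 2 * pi * of_int n"
      using circ_eqD by blast
    then have "(2 * pi) * (t - s) = (2 * pi) * of_int (- n)" by (simp add: algebra_simps)
    then have "t - s = of_int (- n)" using mult_left_cancel [of "2 * pi" "t - s" "of_int (- n)"] by simp
    then show "t - s \<in> \<int>" by (metis Ints_of_int)
  qed
  have "range (\<lambda>t. circ (2 * pi * t)) = range circ"
  proof -
    have "circ t \<in> range (\<lambda>t. circ (2 * pi * t))" for t
      by (rule range_eqI [of _ _ "t / (2 * pi)"]) simp
    then show ?thesis by blast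
  qed
  moreover have "range (loop_of c) = to_complex ` c ` range (\<lambda>t. circ (2 * pi * t))"
    unfolding loop_of_def [abs_def] image_image ..
  ultimately have "range (loop_of c) = to_complex ` c ` range circ" by simp
  then show "path_image (loop_of c) = to_complex ` \<gamma>"
    using regular_loop.path_image_eq [OF R] range_circ c(3) by simp
qed

definition complex_deriv :: "(real^2 \<Rightarrow> real^2) \<Rightarrow> complex \<Rightarrow> complex \<Rightarrow> complex" where
  "complex_deriv F z v = to_complex (frechet_derivative F (at (vec_of_complex z)) (vec_of_complex v))"

lemma linear_maps_complex_deriv:
  assumes "smooth_on UNIV F" shows "linear_maps (complex_deriv F)"
proof (rule linear_maps.intro)
  fix z
  have "linear (frechet_derivative F (at (vec_of_complex z)))"
    using smooth_on_has_derivative [OF assms] has_derivative_linear by blast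
  from linear_compose [OF linear_compose [OF linear_vec_of_complex this] linear_to_complex]
  show "linear (complex_deriv F z)" by (simp add: complex_deriv_def [abs_def] o_def)
  have cont: "continuous_on UNIV (\<lambda>z. complex_deriv F z v)" for v
    unfolding complex_deriv_def
    by (intro cont_to_complex continuous_on_compose2 [OF smooth_on_continuous [OF smooth_on_deriv [OF assms]]]
        cont_vec_of_complex continuous_on_id) auto
  show "continuous_on UNIV (\<lambda>z. complex_deriv F z 1)" "continuous_on UNIV (\<lambda>z. complex_deriv F z \<i>)"
    by (rule cont)+
qed

lemma complex_deriv_nonzero:
  assumes "smooth_on UNIV F" "jac F (vec_of_complex z) \<noteq> 0" "v \<noteq> 0"
  shows "complex_deriv F z v \<noteq> 0"
  using frechet_derivative_nonzero [OF assms(1) UNIV_I assms(2)] assms(3) by (simp add: complex_deriv_def)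

text \<open>By the chain rule the derivative of \<open>F \<circ> c\<close> is \<open>DF\<close>
  applied to the velocity; the constant \<open>2 * pi\<close> from rescaling the parameter does not
  affect the winding number.\<close>

lemma rotation_number_image:
  assumes F: "smooth_on UNIV F" and c: "regular_parametrization c \<gamma>" and nz: "\<And>x. x \<in> \<gamma> \<Longrightarrow> jac F x \<noteq> 0"
  shows "rotation_number (F \<circ> c) = winding_number (\<lambda>t. complex_deriv F (loop_of c t) (velocity_of c t)) 0"
proof -
  interpret R: regular_loop "loop_of c" "velocity_of c" by (rule regular_loop_of [OF c])
  interpret M: linear_maps "complex_deriv F" by (rule linear_maps_complex_deriv [OF F])
  have prc: "prc_curve c" using c by (simp add: regular_parametrization_def)
  let ?w = "\<lambda>t. to_complex (vector_derivative ((F \<circ> c) \<circ> circ) (at (2 * pi * t)))"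
  have eq: "complex_deriv F (loop_of c t) (velocity_of c t) = of_real (2 * pi) * ?w t" for t
  proof -
    let ?x = "2 * pi * t" and ?v = "vector_derivative (c \<circ> circ) (at (2 * pi * t))"
    let ?D = "frechet_derivative F (at (c (circ ?x)))"
    have lin: "linear ?D"
      using smooth_on_has_derivative [OF F] has_derivative_linear by blast
    have "((\<lambda>t. F (c (circ t))) has_derivative (\<lambda>h. ?D (h *\<^sub>R ?v))) (at ?x)"
      by (rule has_derivative_compose [OF _ smooth_on_has_derivative [OF F]])
        (use prc_curve_has_vector_derivative [OF prc] in \<open>auto simp: has_vector_derivative_def\<close>)
    then have "((\<lambda>t. F (c (circ t))) has_vector_derivative ?D ?v) (at ?x)"
      by (simp add: has_vector_derivative_def linear_cmul [OF lin])
    then have "vector_derivative ((F \<circ> c) \<circ> circ) (at ?x) = ?D ?v"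
      by (simp add: o_def vector_derivative_at)
    then show ?thesis
      unfolding complex_deriv_def loop_of_def velocity_of_def vec_of_complex_inverse
      unfolding linear_cmul [OF lin] to_complex_scaleR by (simp add: scaleR_conv_of_real)
  qed
  have "complex_deriv F (loop_of c t) (velocity_of c t) \<noteq> 0" for t
  proof (rule complex_deriv_nonzero [OF F _ R.regular])
    have "loop_of c t \<in> to_complex ` \<gamma>" using regular_loop_of(2) [OF c] R.path_image_eq by blast
    then show "jac F (vec_of_complex (loop_of c t)) \<noteq> 0" using nz by auto
  qed
  then have w0: "?w t \<noteq> 0" for t unfolding eq by simp
  have weq: "?w = (\<lambda>t. of_real (1 / (2 * pi)) * complex_deriv F (loop_of c t) (velocity_of c t))"
    by (simp add: eq fun_eq_iff)
  have "path ?w"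
    unfolding weq path_def
    by (intro continuous_intros M.continuous_apply R.cont continuous_on_subset [OF R.cont_deriv]) auto
  then have "winding_number (\<lambda>t. of_real (2 * pi) * ?w t) 0 = winding_number ?w 0"
    by (intro winding_number_const_mult) (use w0 in \<open>auto simp: path_image_def\<close>)
  then show ?thesis unfolding rotation_number_def eq by simp
qed

section \<open>Cusps and the two sides of the critical curve\<close>

lemma compact_connected_annulus:
  assumes "closed_annulus A" shows "compact A" "connected A"
proof -
  let ?S = "{z :: real^2. 1 \<le> norm z \<and> norm z \<le> 2}"
  have hom: "A homeomorphic ?S" using assms by (simp add: closed_annulus_def)
  have "closed {z :: real^2. 1 \<le> norm z}"
    by (intro closed_Collect_le continuous_intros)
  then have "compact (cball (0::real^2) 2 \<inter> {z. 1 \<le> norm z})"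
    by (intro compact_Int_closed compact_cball)
  moreover have "cball (0::real^2) 2 \<inter> {z. 1 \<le> norm z} = ?S" by auto
  ultimately show "compact A" using hom homeomorphic_compactness by metis
  have "connected ?S" using connected_annulus(4) [of 1 "0::real^2" 2] by simp
  then show "connected A" using hom homeomorphic_connectedness by metis
qed

lemma cusp_model_to_complex:
  fixes F :: "real^2 \<Rightarrow> real^2" and E :: "complex \<Rightarrow> real" and G :: "complex \<Rightarrow> complex" and s :: real
  assumes F: "smooth_on UNIV F" and q: "cusp_point F q" and s: "s \<noteq> 0"
    and E: "\<And>z. E z = s * jac F (vec_of_complex z)"
    and G: "\<And>z v. inner (G z) v = s * frechet_derivative (jac F) (at (vec_of_complex z)) (vec_of_complex v)"
  obtains \<sigma> :: int where "\<sigma> \<in> {1, -1}" "cusp_model (complex_deriv F) E G (to_complex q) \<sigma>" "G (to_complex q) \<noteq> 0"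
    "effective_on F q {p. of_int \<sigma> * jac F p > 0}"
    "\<forall>S N. effective_on F q S \<longrightarrow> open N \<longrightarrow> q \<in> N \<longrightarrow> (\<exists>p \<in> S \<inter> N. of_int \<sigma> * jac F p > 0)"
proof -
  obtain \<sigma> :: int and B Y L where B: "\<sigma> \<in> {1, -1}" "open B" "q \<in> B" "continuous_on B Y" "\<And>p. p \<in> B \<Longrightarrow> Y p \<noteq> 0"
    and par: "\<And>p v. p \<in> B \<Longrightarrow> jac F p = 0 \<Longrightarrow> frechet_derivative (jac F) (at p) v = 0 \<Longrightarrow> \<exists>c. v = c *\<^sub>R Y p"
    and grad: "\<exists>v. frechet_derivative (jac F) (at q) v \<noteq> 0"
    and nz: "\<And>p. p \<in> B - {q} \<Longrightarrow> frechet_derivative F (at p) (Y p) \<noteq> 0" and z: "frechet_derivative F (at q) (Y q) = 0"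
    and L: "((\<lambda>p. frechet_derivative F (at p) (Y p)) has_derivative L) (at q)" "sgn (det (matrix L)) = \<sigma>"
    and eff: "effective_on F q {p. of_int \<sigma> * jac F p > 0}"
      "\<And>S N. effective_on F q S \<Longrightarrow> open N \<Longrightarrow> q \<in> N \<Longrightarrow> \<exists>p \<in> S \<inter> N. of_int \<sigma> * jac F p > 0"
    by (rule cusp_local [OF F q]) (rule that)
  let ?W = "vec_of_complex -` B" and ?Y = "\<lambda>z. to_complex (Y (vec_of_complex z))"
    and ?L = "\<lambda>v. to_complex (L (vec_of_complex v))"
  have "cusp_model (complex_deriv F) E G (to_complex q) \<sigma>"
    unfolding cusp_model_def
  proof (rule exI [of _ ?W], rule exI [of _ ?Y], rule exI [of _ ?L], intro conjI ballI impI)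
    show "open ?W"
      using B(2) by (rule open_vimage) (intro cont_vec_of_complex continuous_on_id)
    show "to_complex q \<in> ?W" using B(3) by simp
    show "continuous_on ?W ?Y"
      by (intro cont_to_complex continuous_on_compose2 [OF B(4)] cont_vec_of_complex continuous_on_id) auto
    show "?Y p \<noteq> 0" if "p \<in> ?W" for p using B(5) that by simp
    show "\<exists>c. \<i> * G p = c *\<^sub>R ?Y p" if p: "p \<in> ?W" "E p = 0" for p
    proof -
      \<comment> \<open>The rotated gradient is orthogonal to the gradient, so it lies in the kernel
        of the differential of \<open>jac F\<close>; on the critical set this kernel is spanned by
        \<open>Y\<close>.\<close>
      have "inner (G p) (\<i> * G p) = 0" by (simp add: inner_complex_def)
      then have "frechet_derivative (jac F) (at (vec_of_complex p)) (vec_of_complex (\<i> * G p)) = 0"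
        using s unfolding G by simp
      moreover have "jac F (vec_of_complex p) = 0" using p(2) s E by simp
      ultimately obtain c where "vec_of_complex (\<i> * G p) = c *\<^sub>R Y (vec_of_complex p)"
        using par [of "vec_of_complex p"] p(1) by auto
      then have "\<i> * G p = c *\<^sub>R ?Y p"
        by (metis to_complex_inverse to_complex_scaleR)
      then show ?thesis by blast
    qed
    show "complex_deriv F p (?Y p) \<noteq> 0" if "p \<in> ?W - {to_complex q}" for p
    proof -
      have "vec_of_complex p \<in> B - {q}" using that by auto
      then show ?thesis using nz by (simp add: complex_deriv_def)
    qed
    show "complex_deriv F (to_complex q) (?Y (to_complex q)) = 0"
      using z by (simp add: complex_deriv_def)
    have "((\<lambda>p. frechet_derivative F (at p) (Y p)) has_derivative L) (at (vec_of_complex (to_complex q)))"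
      using L(1) by simp
    from has_derivative_compose [OF bounded_linear_imp_has_derivative [OF bounded_linear_vec_of_complex] this]
    have "((\<lambda>z. frechet_derivative F (at (vec_of_complex z)) (Y (vec_of_complex z))) has_derivative
      (\<lambda>v. L (vec_of_complex v))) (at (to_complex q))" .
    from bounded_linear.has_derivative [OF bounded_linear_to_complex this]
    show "((\<lambda>z. complex_deriv F z (?Y z)) has_derivative ?L) (at (to_complex q))"
      by (simp add: complex_deriv_def)
    have J: "Im (cnj (?L 1) * ?L \<i>) = det (matrix L)"
      by (simp add: det_matrix2 vec_of_complex_axis algebra_simps)
    show "sgn (Im (cnj (?L 1) * ?L \<i>)) = real_of_int \<sigma>" unfolding J by (rule L(2))
    then show "Im (cnj (?L 1) * ?L \<i>) \<noteq> 0" using B(1) by auto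
  qed
  moreover have "G (to_complex q) \<noteq> 0"
  proof
    assume "G (to_complex q) = 0"
    then have "frechet_derivative (jac F) (at q) (vec_of_complex v) = 0" for v
      using G [of "to_complex q" v] s by simp
    then have "frechet_derivative (jac F) (at q) v = 0" for v
      by (metis vec_of_complex_inverse)
    then show False using grad by blast
  qed
  ultimately show ?thesis using that B(1) eff by blast
qed

text \<open>Passing from \<open>U\<close> to \<open>U \<inter> N\<close> only shrinks the local
  preimage, so effectiveness depends on \<open>S\<close> near \<open>q\<close> alone.\<close>

lemma effective_on_mono:
  assumes "effective_on F q S" "open N" "q \<in> N" "S \<inter> N \<subseteq> T"
  shows "effective_on F q T"
proof -
  obtain U where U: "open U" "q \<in> U" "{p \<in> U. F p \<in> F ` (critical_set F \<inter> U)} - critical_set F \<subseteq> S"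
    using assms(1) unfolding effective_on_def by blast
  show ?thesis
    unfolding effective_on_def
  proof (intro exI [of _ "U \<inter> N"] conjI)
    show "open (U \<inter> N)" using U(1) assms(2) by (rule open_Int)
    show "q \<in> U \<inter> N" using U(2) assms(3) by simp
    have "{p \<in> U \<inter> N. F p \<in> F ` (critical_set F \<inter> (U \<inter> N))} \<subseteq> {p \<in> U. F p \<in> F ` (critical_set F \<inter> U)} \<inter> N"
      by blast
    then show "{p \<in> U \<inter> N. F p \<in> F ` (critical_set F \<inter> (U \<inter> N))} - critical_set F \<subseteq> T"
      using U(3) assms(4) by blast
  qed
qed

theorem proposition15:
  fixes F :: "real^2 \<Rightarrow> real^2"
    and A \<Gamma> \<gamma>_in \<gamma>_out :: "(real^2) set"
    and c_in c_out :: "real^2 \<Rightarrow> real^2"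
    and s_in s_out :: real
  assumes "excellent F"
    and "closed_annulus A"
    and "\<Gamma> \<in> components (critical_set F)"
    and "\<Gamma> = A \<inter> critical_set F"
    and "components (frontier A) = {\<gamma>_in, \<gamma>_out}"
    and "\<gamma>_in \<subseteq> inside \<gamma>_out"
    and "smooth_simple_closed_curve \<gamma>_in"
    and "smooth_simple_closed_curve \<gamma>_out"
    and "regular_parametrization c_in \<gamma>_in" and "counterclockwise c_in"
    and "regular_parametrization c_out \<gamma>_out" and "counterclockwise c_out"
    and "s_in \<in> {1, -1}" and "s_out = - s_in"
    and "\<And>p. p \<in> \<gamma>_in \<Longrightarrow> sgn (det (jacobian F (at p))) = s_in"
    and "\<And>p. p \<in> \<gamma>_out \<Longrightarrow> sgn (det (jacobian F (at p))) = s_out"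
  shows "rotation_number (F \<circ> c_out) =
    rotation_number (F \<circ> c_in)
      + of_real s_in * of_nat (card (inner_cusps F \<Gamma>))
      + of_real s_out * of_nat (card (outer_cusps F \<Gamma>))"
proof -
  have F: "smooth_on UNIV F" and exc: "\<And>p. p \<in> critical_set F \<Longrightarrow> fold_point F p \<or> cusp_point F p"
    using assms(1) by (auto simp: excellent_def)
  have s0: "s_in \<noteq> 0" "s_in = 1 \<or> s_in = -1" using assms(13) by auto
  let ?J = "\<lambda>z. frechet_derivative (jac F) (at (vec_of_complex z))"
  let ?M = "complex_deriv F"
  \<comment> \<open>The factor \<open>s_in\<close> makes \<open>E\<close> positive on the inner and
    negative on the outer boundary curve, so both cases of the sign are treated at once.\<close>
  define E where "E z = s_in * jac F (vec_of_complex z)" for z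
  define G where "G z = of_real (s_in * ?J z (axis 1 1)) + \<i> * of_real (s_in * ?J z (axis 2 1))" for z
  have linJ: "linear (?J z)" for z
    using jac_differentiable [OF F UNIV_I] has_derivative_linear by blast
  have G: "inner (G z) v = s_in * ?J z (vec_of_complex v)" for z v
    by (subst linear_axis2 [OF linJ]) (simp add: G_def inner_complex_def algebra_simps)
  have derE: "(E has_derivative (\<lambda>v. inner (G z) v)) (at z)" for z
  proof -
    from has_derivative_compose [OF bounded_linear_imp_has_derivative [OF bounded_linear_vec_of_complex]
        jac_differentiable [OF F UNIV_I]]
    have "((\<lambda>z. s_in * jac F (vec_of_complex z)) has_derivative (\<lambda>v. s_in * ?J z (vec_of_complex v))) (at z)"
      by (rule has_derivative_mult_right)
    then show ?thesis unfolding G E_def [abs_def] .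
  qed
  have contG: "continuous_on UNIV G"
    unfolding G_def
    by (intro continuous_intros continuous_on_compose2 [OF continuous_on_jac_deriv [OF F]]
        cont_vec_of_complex) auto

  let ?p1 = "loop_of c_in" and ?p2 = "loop_of c_out"
  note R1 = regular_loop_of [OF assms(9)] and R2 = regular_loop_of [OF assms(11)]
  have img: "c_in ` sphere 0 1 = \<gamma>_in" "c_out ` sphere 0 1 = \<gamma>_out"
    using assms(9,11) by (auto simp: regular_parametrization_def)
  have sub: "path_image ?p1 \<subseteq> inside (path_image ?p2)"
    unfolding R1 R2 inside_to_complex using assms(6) by (rule image_mono)
  have ccw1: "winding_number ?p1 z = 1" if "z \<in> inside (path_image ?p1)" for z
    using that assms(10) unfolding R1 inside_to_complex
    by (auto simp: counterclockwise_def img loop_of_def [abs_def])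
  have ccw2: "winding_number ?p2 z = 1" if "z \<in> inside (path_image ?p2)" for z
    using that assms(12) unfolding R2 inside_to_complex
    by (auto simp: counterclockwise_def img loop_of_def [abs_def])
  let ?A = "to_complex ` A" and ?\<Gamma> = "to_complex ` \<Gamma>"
  have A: "compact ?A" "connected ?A"
    using compact_connected_annulus [OF assms(2)]
    by (intro compact_continuous_image connected_continuous_image cont_to_complex continuous_on_id; simp)+
  have "frontier A = \<gamma>_in \<union> \<gamma>_out"
    using Union_components [of "frontier A"] assms(5) by simp
  then have fr: "frontier ?A = path_image ?p1 \<union> path_image ?p2"
    unfolding frontier_to_complex R1 R2 by (simp add: image_Un)
  have crit: "p \<in> critical_set F \<longleftrightarrow> jac F p = 0" for p by (simp add: critical_set_jac)
  have \<Gamma>: "?\<Gamma> = ?A \<inter> {z. E z = 0}"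
    unfolding assms(4) to_complex_image_eq using s0 by (auto simp: E_def crit)
  have con\<Gamma>: "connected ?\<Gamma>" "?\<Gamma> \<noteq> {}"
    using in_components_nonempty [OF assms(3)]
    by (intro connected_continuous_image cont_to_complex continuous_on_id in_components_connected [OF assms(3)], simp)
  have pos: "E z > 0" if "z \<in> path_image ?p1" for z
  proof -
    have "sgn (jac F (vec_of_complex z)) = s_in"
      using that assms(15) unfolding R1 jac_def by auto
    then show ?thesis using s0 by (auto simp: E_def sgn_1_pos sgn_1_neg)
  qed
  have neg: "E z < 0" if "z \<in> path_image ?p2" for z
  proof -
    have "sgn (jac F (vec_of_complex z)) = - s_in"
      using that assms(14,16) unfolding R2 jac_def by auto
    then show ?thesis using s0 by (auto simp: E_def sgn_1_pos sgn_1_neg)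
  qed

  define Q where "Q = {q \<in> \<Gamma>. cusp_point F q}"
  \<comment> \<open>Bundles what is known at a cusp about its index, so that a single choice
    function \<open>\<sigma>\<close> provides all of it.\<close>
  define P where "P q \<tau> \<longleftrightarrow> \<tau> \<in> {1, -1} \<and> cusp_model ?M E G (to_complex q) \<tau> \<and> G (to_complex q) \<noteq> 0 \<and>
      effective_on F q {p. of_int \<tau> * jac F p > 0} \<and>
      (\<forall>S N. effective_on F q S \<longrightarrow> open N \<longrightarrow> q \<in> N \<longrightarrow> (\<exists>p \<in> S \<inter> N. of_int \<tau> * jac F p > 0))"
    for q and \<tau> :: int
  have "\<exists>\<tau>. P q \<tau>" if "q \<in> Q" for q
    by (rule cusp_model_to_complex [OF F _ s0(1) E_def G, of q]) (use that in \<open>auto simp: Q_def P_def\<close>)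
  then obtain \<sigma> where "\<forall>q\<in>Q. P q (\<sigma> q)"
    using bchoice [of Q P] by blast
  then have \<sigma>: "\<And>q. q \<in> Q \<Longrightarrow> \<sigma> q \<in> {1, -1}"
    "\<And>q. q \<in> Q \<Longrightarrow> cusp_model ?M E G (to_complex q) (\<sigma> q)" "\<And>q. q \<in> Q \<Longrightarrow> G (to_complex q) \<noteq> 0"
    "\<And>q. q \<in> Q \<Longrightarrow> effective_on F q {p. of_int (\<sigma> q) * jac F p > 0}"
    "\<And>q S N. q \<in> Q \<Longrightarrow> effective_on F q S \<Longrightarrow> open N \<Longrightarrow> q \<in> N \<Longrightarrow> \<exists>p \<in> S \<inter> N. of_int (\<sigma> q) * jac F p > 0"
    unfolding P_def by blast+
  have fold: "fold_point F q" if "q \<in> \<Gamma> - Q" for q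
    using that exc [of q] assms(4) by (auto simp: Q_def)
  have G0: "G z \<noteq> 0" if "z \<in> ?\<Gamma>" for z
  proof -
    obtain q where q: "q \<in> \<Gamma>" "z = to_complex q" using \<open>z \<in> ?\<Gamma>\<close> by blast
    show ?thesis
    proof (cases "q \<in> Q")
      case False
      then obtain v where v: "frechet_derivative (jac F) (at q) v \<noteq> 0"
        using fold_local(1) [OF F fold] q(1) by blast
      then have "inner (G z) (to_complex v) \<noteq> 0" unfolding G q(2) using s0(1) by simp
      then show ?thesis by auto
    qed (use \<sigma>(3) q(2) in simp)
  qed
  have foldM: "?M z (\<i> * G z) \<noteq> 0" if "z \<in> ?\<Gamma> - to_complex ` Q" for z
  proof -
    obtain q where q: "q \<in> \<Gamma> - Q" "z = to_complex q" using \<open>z \<in> ?\<Gamma> - to_complex ` Q\<close> by blast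
    \<comment> \<open>Away from the cusps every point of \<open>\<Gamma>\<close> is a fold, where
      the tangent vector \<open>\<i> * G z\<close> is not killed by \<open>DF\<close>.\<close>
    have "inner (G z) (\<i> * G z) = 0" by (simp add: inner_complex_def)
    then have "frechet_derivative (jac F) (at q) (vec_of_complex (\<i> * G z)) = 0"
      using s0(1) unfolding G q(2) by simp
    moreover have "vec_of_complex (\<i> * G z) \<noteq> 0" using G0 that by simp
    ultimately show ?thesis
      using fold_local(2) [OF F fold [OF q(1)]] by (simp add: complex_deriv_def q(2))
  qed
  have inj: "?M z v \<noteq> 0" if "E z \<noteq> 0" "v \<noteq> 0" for z v
    by (rule complex_deriv_nonzero [OF F]) (use that in \<open>auto simp: E_def\<close>)
  have cm: "cusp_model ?M E G z (\<sigma> (vec_of_complex z))" if "z \<in> to_complex ` Q" for z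
    using that \<sigma>(2) by auto
  have Qsub: "to_complex ` Q \<subseteq> ?\<Gamma>" by (auto simp: Q_def)
  note main = ring_turning_index [OF R1(1) R2(1) sub ccw1 ccw2 A fr \<Gamma> con\<Gamma> derE G0 contG pos neg
      linear_maps_complex_deriv [OF F] inj Qsub foldM cm]
  have finQ: "finite Q" using main(1) finite_imageD [OF _ inj_to_complex] by blast
  have jac1: "jac F x \<noteq> 0" if "x \<in> \<gamma>_in" for x
    using pos [of "to_complex x"] that unfolding R1 by (auto simp: E_def)
  have jac2: "jac F x \<noteq> 0" if "x \<in> \<gamma>_out" for x
    using neg [of "to_complex x"] that unfolding R2 by (auto simp: E_def)
  have "(\<Sum>z\<in>to_complex ` Q. of_int (\<sigma> (vec_of_complex z))) = (\<Sum>q\<in>Q. of_int (\<sigma> q) :: complex)"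
    by (subst sum.reindex [OF inj_to_complex]) simp
  then have rot: "rotation_number (F \<circ> c_out) = rotation_number (F \<circ> c_in) + (\<Sum>q\<in>Q. of_int (\<sigma> q))"
    using main(2) rotation_number_image [OF F assms(9) jac1] rotation_number_image [OF F assms(11) jac2] by simp

  interpret r1: regular_loop ?p1 "velocity_of c_in" by (rule R1(1))
  interpret r2: regular_loop ?p2 "velocity_of c_out" by (rule R2(1))
  note AK = annulus_eq_between [OF r1.simple(1,2) r2.simple(1,2) sub A fr]
  note S = level_curve_sides [OF r1.simple(1,2) r2.simple(1,2) sub AK \<Gamma> con\<Gamma> derE G0 contG pos neg]
  \<comment> \<open>In the open ring \<open>N\<close> the sign of \<open>jac F\<close> alone decides
    on which side of \<open>\<Gamma>\<close> a point lies.\<close>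
  define N where "N = to_complex -` (inside (path_image ?p2) \<inter> outside (path_image ?p1))"
  have N: "open N"
    unfolding N_def
    by (intro open_vimage open_Int cont_to_complex continuous_on_id)
      (use Jordan_inside_outside [OF r1.simple(1,2)] Jordan_inside_outside [OF r2.simple(1,2)] in auto)
  have QN: "q \<in> N" if "q \<in> Q" for q
    using that S(2) unfolding N_def Q_def by blast
  have side_in: "p \<in> inside \<Gamma>" if "p \<in> N" "s_in * jac F p > 0" for p
  proof -
    have "to_complex p \<in> inside (path_image ?p2) \<inter> {z. E z > 0}"
      using that by (simp add: N_def E_def)
    then have "to_complex p \<in> inside ?\<Gamma>" using S(3) by blast
    then show ?thesis by (simp add: inside_to_complex inj_image_mem_iff [OF inj_to_complex])
  qed
  have side_out: "p \<in> outside \<Gamma>" if "p \<in> N" "- s_in * jac F p > 0" for p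
  proof -
    have "to_complex p \<in> outside (path_image ?p1) \<inter> {z. E z < 0}"
      using that by (simp add: N_def E_def)
    then have "to_complex p \<in> outside ?\<Gamma>" using S(4) by blast
    then show ?thesis by (simp add: outside_to_complex inj_image_mem_iff [OF inj_to_complex])
  qed
  have inn: "inner_cusps F \<Gamma> = {q \<in> Q. of_int (\<sigma> q) = s_in}"
  proof -
    have "effective_on F q (inside \<Gamma>) \<longleftrightarrow> of_int (\<sigma> q) = s_in" if q: "q \<in> Q" for q
    proof
      assume "of_int (\<sigma> q) = s_in"
      then show "effective_on F q (inside \<Gamma>)"
        using \<sigma>(4) [OF q] side_in by (intro effective_on_mono [OF \<sigma>(4) [OF q] N QN [OF q]]) auto
    next
      assume eff: "effective_on F q (inside \<Gamma>)"
      \<comment> \<open>Effectiveness on the inside yields an inside point of \<open>N\<close> where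
        \<open>jac F\<close> has the sign \<open>\<sigma> q\<close>. Were this sign
        \<open>- s_in\<close>, the point would lie outside.\<close>
      obtain p where p: "p \<in> inside \<Gamma>" "p \<in> N" "of_int (\<sigma> q) * jac F p > 0"
        using \<sigma>(5) [OF q eff N QN [OF q]] by blast
      show "of_int (\<sigma> q) = s_in"
      proof (rule ccontr)
        assume "of_int (\<sigma> q) \<noteq> s_in"
        then have "of_int (\<sigma> q) = - s_in" using s0(2) \<sigma>(1) [OF q] by auto
        then have "p \<in> outside \<Gamma>" using side_out p by simp
        then show False using p(1) inside_Int_outside [of \<Gamma>] by blast
      qed
    qed
    then show ?thesis unfolding inner_cusps_def Q_def by auto
  qed
  have out: "outer_cusps F \<Gamma> = {q \<in> Q. of_int (\<sigma> q) = s_out}"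
  proof -
    have "effective_on F q (outside \<Gamma>) \<longleftrightarrow> of_int (\<sigma> q) = s_out" if q: "q \<in> Q" for q
    proof
      assume "of_int (\<sigma> q) = s_out"
      then show "effective_on F q (outside \<Gamma>)"
        using side_out assms(14) by (intro effective_on_mono [OF \<sigma>(4) [OF q] N QN [OF q]]) auto
    next
      assume eff: "effective_on F q (outside \<Gamma>)"
      obtain p where p: "p \<in> outside \<Gamma>" "p \<in> N" "of_int (\<sigma> q) * jac F p > 0"
        using \<sigma>(5) [OF q eff N QN [OF q]] by blast
      show "of_int (\<sigma> q) = s_out"
      proof (rule ccontr)
        assume "of_int (\<sigma> q) \<noteq> s_out"
        then have "of_int (\<sigma> q) = s_in" using s0(2) assms(14) \<sigma>(1) [OF q] by auto
        then have "p \<in> inside \<Gamma>" using side_in p by simp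
        then show False using p(1) inside_Int_outside [of \<Gamma>] by blast
      qed
    qed
    then show ?thesis unfolding outer_cusps_def Q_def by auto
  qed
  \<comment> \<open>Every index is 1 or -1, hence \<open>s_in\<close> or \<open>s_out\<close>, so
    each cusp on \<open>\<Gamma>\<close> is of exactly one kind.\<close>
  have "Q = inner_cusps F \<Gamma> \<union> outer_cusps F \<Gamma>"
    unfolding inn out using \<sigma>(1) s0(2) assms(14) by force
  moreover have "inner_cusps F \<Gamma> \<inter> outer_cusps F \<Gamma> = {}"
    unfolding inn out using s0(1) assms(14) by auto
  ultimately have "(\<Sum>q\<in>Q. of_int (\<sigma> q) :: complex) =
      (\<Sum>q\<in>inner_cusps F \<Gamma>. of_int (\<sigma> q)) + (\<Sum>q\<in>outer_cusps F \<Gamma>. of_int (\<sigma> q))"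
    using finQ by (simp add: sum.union_disjoint)
  also have "(\<Sum>q\<in>inner_cusps F \<Gamma>. of_int (\<sigma> q)) = (\<Sum>q\<in>inner_cusps F \<Gamma>. complex_of_real s_in)"
    by (rule sum.cong) (auto simp: inn)
  also have "(\<Sum>q\<in>outer_cusps F \<Gamma>. of_int (\<sigma> q)) = (\<Sum>q\<in>outer_cusps F \<Gamma>. complex_of_real s_out)"
    by (rule sum.cong) (auto simp: out)
  finally show ?thesis unfolding rot by (simp add: mult.commute)
qed

end
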